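(* Let $\Gamma$ be a countably infinite group, let $(K, \mathfrak{d})$ be a compact metric space, and let $f \colon \Omega \to K$ be a Borel function. For any $\varepsilon > 0$ and any open neighborhood $U \subseteq \mathrm{Prob}(K^\Gamma)$ of the measure $\mathbb{M}_{\boldsymbol{\lambda}} \pi_f$, there exists $C > 0$ with the following property: whenever $(D_n)_{n \in \mathbb{N}}$ is a sequence of finite subsets of $\Gamma$ with $|D_n| \geq C\log(n+2)$ for all $n \in \mathbb{N}$, there is a Borel map $g \colon \Omega \to K$ such that $\mathfrak{d}_{\boldsymbol{\lambda}}(f, g) \leq \varepsilon$ and $$\mathbb{M}_{D_n} \pi_g(x) \in U \qquad \text{for all } n \in \mathbb{N} \text{ and for } \boldsymbol{\lambda}\text{-a.e. } x \in \Omega.$$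
   Context: $\Omega = [0;1]^\Gamma$ and $\boldsymbol{\lambda} = \lambda^\Gamma$, where $\lambda$ is the Lebesgue probability measure on $[0;1]$. The group $\Gamma$ acts on $\Omega$ by the shift action $(\gamma \cdot x)(\delta) = x(\delta\gamma)$. For a compact metric space $L$, $\mathrm{Prob}(L)$ is the space of Borel probability measures on $L$ with the weak-$\ast$ topology; $K^\Gamma$ carries the product topology and is compact metrizable. For Borel $f \colon \Omega \to K$, the coding map $\pi_f \colon \Omega \to K^\Gamma$ is $\pi_f(x)(\gamma) = f(\gamma \cdot x)$. For a Borel map $\pi \colon \Omega \to L$ into a compact metrizable space, $\mathbb{M}_{\boldsymbol{\lambda}}\pi = \pi_*(\boldsymbol{\lambda})$ is the pushforward of $\boldsymbol{\lambda}$, and for $x \in \Omega$ and a nonempty finite $D \subset \Gamma$, $\mathbb{M}_D \pi(x) = \pi_*(\upsilon_{x,D})$, where $\upsilon_{x,D}$ is the finitely supported probability measure on $\Omega$ with $\upsilon_{x,D}(\{y\}) = |\{\delta \in D : \delta \cdot x = y\}|/|D|$ for $y \in D \cdot x$. For Borel $f, g \colon \Omega \to K$, $\mathfrak{d}_{\boldsymbol{\lambda}}(f,g) = \int_\Omega \mathfrak{d}(f(x), g(x))\, d\boldsymbol{\lambda}(x)$. $\mathbb{N}$ includes $0$. *)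

theory Defs
  imports "HOL-Probability.Probability"
begin

text \<open>
  The acting group is a type of class \<^class>\<open>group_add\<close>. This class does not assume
  commutativity; the group operation is merely written additively, so that
  \<open>\<delta> + \<gamma>\<close> stands for the product \<open>\<delta>\<gamma>\<close>.
\<close>

text \<open>
  The probability space \<open>(\<Omega>, \<lambda>\<^sup>\<Gamma>)\<close> with \<open>\<Omega> = [0;1]\<^sup>\<Gamma>\<close>. For countable \<open>\<Gamma>\<close> the product
  sigma-algebra is the Borel sigma-algebra of \<open>\<Omega>\<close>, so the Borel maps from \<open>\<Omega>\<close> to \<open>L\<close> are the
  elements of \<open>Omega \<rightarrow>\<^sub>M borel\<close>. Their values outside of \<open>space Omega\<close> are irrelevant.
\<close>

definition Omega :: "('g \<Rightarrow> real) measure" where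
  "Omega = PiM UNIV (\<lambda>_. restrict_space lborel {0..1})"

lemma space_Omega: "space Omega = {x. \<forall>\<gamma>. x \<gamma> \<in> {0..1}}"
  by (auto simp: Omega_def space_PiM space_restrict_space PiE_def Pi_def)

definition shift :: "'g::group_add \<Rightarrow> ('g \<Rightarrow> 'a) \<Rightarrow> 'g \<Rightarrow> 'a" where
  "shift \<gamma> x = (\<lambda>\<delta>. x (\<delta> + \<gamma>))"

definition coding_map :: "(('g::group_add \<Rightarrow> real) \<Rightarrow> 'k) \<Rightarrow> ('g \<Rightarrow> real) \<Rightarrow> 'g \<Rightarrow> 'k" where
  "coding_map f x = (\<lambda>\<gamma>. f (shift \<gamma> x))"

definition Prob :: "'l::topological_space measure set" where
  "Prob = {\<mu>. prob_space \<mu> \<and> sets \<mu> = sets borel}"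

text \<open>
  The weak-* topology: the coarsest topology on \<open>Prob\<close> making \<open>\<mu> \<mapsto> \<integral>\<phi> d\<mu>\<close> continuous for every
  continuous real-valued \<open>\<phi>\<close>. It is meant for compact spaces, on which every such \<open>\<phi>\<close> is bounded
  and hence integrable.
\<close>

definition weak_star_topology :: "'l::topological_space measure topology" where
  "weak_star_topology = topology_generated_by
     {{\<mu> \<in> Prob. (\<integral>y. \<phi> y \<partial>\<mu>) \<in> V} | (\<phi> :: 'l \<Rightarrow> real) V. continuous_on UNIV \<phi> \<and> open V}"

lemma topspace_weak_star_topology: "topspace weak_star_topology = Prob"
proof -
  have "Prob \<in> {{\<mu> \<in> Prob. (\<integral>y. \<phi> y \<partial>\<mu>) \<in> V} | (\<phi> :: 'a \<Rightarrow> real) V.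
      continuous_on UNIV \<phi> \<and> open V}"
    by (intro CollectI exI[of _ "\<lambda>_. 0"] exI[of _ UNIV]) auto
  then show ?thesis
    unfolding weak_star_topology_def topology_generated_by_topspace by blast
qed

definition pushforward_Omega :: "(('g \<Rightarrow> real) \<Rightarrow> 'l::topological_space) \<Rightarrow> 'l measure" where
  "pushforward_Omega \<pi> = distr Omega borel \<pi>"

text \<open>
  The measure \<open>\<upsilon>\<^bsub>x,D\<^esub>\<close>, for \<open>D\<close> finite and nonempty: the probability mass function vanishes
  outside of \<open>D \<cdot> x\<close>, since there the cardinality below is 0.
\<close>

definition orbit_pmf :: "'g::group_add set \<Rightarrow> ('g \<Rightarrow> real) \<Rightarrow> ('g \<Rightarrow> real) pmf" where
  "orbit_pmf D x = embed_pmf (\<lambda>y. real (card {\<delta> \<in> D. shift \<delta> x = y}) / real (card D))"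

lemma orbit_pmf_eq_map_pmf:
  assumes "finite D" "D \<noteq> {}"
  shows "orbit_pmf D x = map_pmf (\<lambda>\<delta>. shift \<delta> x) (pmf_of_set D)"
proof -
  have "pmf (map_pmf (\<lambda>\<delta>. shift \<delta> x) (pmf_of_set D)) y =
      real (card {\<delta> \<in> D. shift \<delta> x = y}) / real (card D)" for y
    using assms by (simp add: pmf_map measure_pmf_of_set vimage_def Int_def)
  then show ?thesis
    unfolding orbit_pmf_def by (metis (no_types, lifting) ext type_definition.Rep_inverse td_pmf_embed_pmf)
qed

lemma pmf_orbit_pmf:
  assumes "finite D" "D \<noteq> {}"
  shows "pmf (orbit_pmf D x) y = real (card {\<delta> \<in> D. shift \<delta> x = y}) / real (card D)"
  using assms
  by (simp add: orbit_pmf_eq_map_pmf pmf_map measure_pmf_of_set vimage_def Int_def)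

definition empirical_pushforward ::
  "'g::group_add set \<Rightarrow> (('g \<Rightarrow> real) \<Rightarrow> 'l::topological_space) \<Rightarrow> ('g \<Rightarrow> real) \<Rightarrow> 'l measure" where
  "empirical_pushforward D \<pi> x = distr (measure_pmf (orbit_pmf D x)) borel \<pi>"

definition dist_Omega ::
  "(('g \<Rightarrow> real) \<Rightarrow> 'k::metric_space) \<Rightarrow> (('g \<Rightarrow> real) \<Rightarrow> 'k) \<Rightarrow> real" where
  "dist_Omega f g = (\<integral>x. dist (f x) (g x) \<partial>Omega)"

end

theory Submission
  imports Defs
begin

text \<open>
  Replace \<open>f\<close> by a function of finitely many digits of finitely many coordinates, and each test
  function of the neighbourhood \<open>U\<close> by a function of finitely many coordinates. By Hoeffding's
  inequality, the average over \<open>D\<^sub>n\<close> at a given point is wrong with probability exponentially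
  small in \<open>|D\<^sub>n|\<close>, whereas the number of averages that are affected by one coordinate is linear in
  \<open>|D\<^sub>n|\<close>; so if \<open>|D\<^sub>n|\<close> grows at least logarithmically with a large constant, the local lemma
  condition holds with room to spare. Its solution is produced by the Moser--Tardos
  algorithm, equivariantly: the first digit of each coordinate is its initial value and the further
  digits are the values used when it is resampled. The analysis is pointwise: every resampling
  has a witness that is determined by the digits, and the expected number of witnesses does not
  depend on the order in which the constraints are inspected, which may thus depend on the point
  itself. Since few coordinates are ever resampled, the result is close to \<open>f\<close>.
\<close>

section \<open>Resampling and its witnesses\<close>

text \<open>Equivariance is the obstacle: no order on the group is invariant under shifts, so
  constraints must be inspected in an order read off from \<open>x\<close>, which is correlated with
  the digits of \<open>x\<close>. A union bound over all conceivable witnesses takes the place of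
  conditioning on the history and makes this correlation harmless.

  The local lemma is used with a budget \<eta> per coordinate: over the events containing a
  coordinate, the sum of \<open>p e * exp (\<eta> * card (vbl e))\<close> must not exceed \<eta>.
  This \<eta> has two tasks. An event of kind \<open>n\<close> reads at most
  \<open>card Q * card (D n)\<close> coordinates and has probability at most
  \<open>b * exp (- c * card (D n))\<close>, so \<eta> of order \<open>c / card Q\<close> leaves
  half of the decay intact. Also, \<eta> bounds the probability that a given coordinate is ever
  resampled, and hence how far \<open>g\<close> departs from \<open>f\<close>. Every kind
  \<open>n\<close> contributes at every coordinate, so the remaining exponentials must be summable
  over \<open>n\<close> with a total below \<eta>; for sizes of order \<open>log (n + 2)\<close>
  they are powers of \<open>n + 2\<close>, and a large \<open>C\<close> makes the exponent large
  enough.\<close>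

locale event_system =
  fixes vbl :: "'e \<Rightarrow> 'v set" and bad :: "'e \<Rightarrow> ('v \<Rightarrow> 'a) \<Rightarrow> bool"
  assumes finite_vbl: "finite (vbl e)"
    and vbl_nonempty: "vbl e \<noteq> {}"
    and bad_cong: "(\<And>v. v \<in> vbl e \<Longrightarrow> a v = b v) \<Longrightarrow> bad e a = bad e b"
begin

text \<open>A witness of the resampling of \<open>e\<close> is a finite set of pairs (level, event). It has \<open>e\<close> on level
  \<open>0\<close> and is built by going back in time, where every resampled event that overlaps with the
  set built so far goes one level beyond the last level it overlaps with. Earlier resamplings of \<open>v\<close>
  are thus on higher levels, so that \<open>height W i v\<close> is the number of resamplings of \<open>v\<close> before
  those on level \<open>i\<close>.\<close>

definition touches :: "(nat \<times> 'e) set \<Rightarrow> 'e \<Rightarrow> nat \<Rightarrow> bool" where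
  "touches W e i \<longleftrightarrow> (\<exists>e'. (i, e') \<in> W \<and> vbl e \<inter> vbl e' \<noteq> {})"

definition levels :: "(nat \<times> 'e) set \<Rightarrow> 'v \<Rightarrow> nat set" where
  "levels W v = {j. \<exists>e. (j, e) \<in> W \<and> v \<in> vbl e}"

definition height :: "(nat \<times> 'e) set \<Rightarrow> nat \<Rightarrow> 'v \<Rightarrow> nat" where
  "height W i v = card {j \<in> levels W v. i < j}"

definition stack :: "(nat \<times> 'e) set \<Rightarrow> bool" where
  "stack W \<longleftrightarrow> finite W \<and> (\<forall>j e. (Suc j, e) \<in> W \<longrightarrow> touches W e j) \<and>
     (\<forall>i e e'. (i, e) \<in> W \<longrightarrow> (i, e') \<in> W \<longrightarrow> e \<noteq> e' \<longrightarrow> vbl e \<inter> vbl e' = {})"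

definition stacks :: "'v \<Rightarrow> (nat \<times> 'e) set set" where
  "stacks v = {W. stack W \<and> (\<exists>e. v \<in> vbl e \<and> {e'. (0, e') \<in> W} = {e})}"

text \<open>In a witness built from a run, \<open>T v (height W i v)\<close> is the value that the
  event on level \<open>i\<close> saw when it was found bad. Validity refers to the table alone, so
  its probability can be computed without any knowledge of the run.\<close>

definition valid :: "('v \<Rightarrow> nat \<Rightarrow> 'a) \<Rightarrow> (nat \<times> 'e) set \<Rightarrow> bool" where
  "valid T W \<longleftrightarrow> (\<forall>(i, e) \<in> W. bad e (\<lambda>v. T v (height W i v)))"

definition add_events :: "(nat \<times> 'e) set \<Rightarrow> 'e set \<Rightarrow> (nat \<times> 'e) set" where
  "add_events W R = W \<union>
     {(Suc i, e) | i e. e \<in> R \<and> touches W e i \<and> (\<forall>i'. touches W e i' \<longrightarrow> i' \<le> i)}"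

text \<open>Time runs backwards: \<open>R t\<close> is the last set before time
  \<open>Suc t\<close>, so it is added first.\<close>

primrec past :: "(nat \<Rightarrow> 'e set) \<Rightarrow> nat \<Rightarrow> (nat \<times> 'e) set \<Rightarrow> (nat \<times> 'e) set" where
  "past R 0 W = W"
| "past R (Suc t) W = past R t (add_events W (R t))"

text \<open>The value of \<open>v\<close> after its \<open>i\<close>-th resampling is \<open>T v i\<close>, and \<open>I t\<close> is the set of events that are
  inspected at time \<open>t\<close>.\<close>

primrec count :: "('v \<Rightarrow> nat \<Rightarrow> 'a) \<Rightarrow> (nat \<Rightarrow> 'e set) \<Rightarrow> nat \<Rightarrow> 'v \<Rightarrow> nat" where
  "count T I 0 v = 0"
| "count T I (Suc t) v = count T I t v +
     (if \<exists>e \<in> I t. v \<in> vbl e \<and> bad e (\<lambda>u. T u (count T I t u)) then 1 else 0)"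

definition resampled :: "('v \<Rightarrow> nat \<Rightarrow> 'a) \<Rightarrow> (nat \<Rightarrow> 'e set) \<Rightarrow> nat \<Rightarrow> 'e set" where
  "resampled T I t = {e \<in> I t. bad e (\<lambda>u. T u (count T I t u))}"

text \<open>The set inspected at one time may be infinite. Disjointness makes simultaneous
  resampling unambiguous, since a variable then belongs to at most one event of the set.\<close>

definition disjoint_vbl :: "'e set \<Rightarrow> bool" where
  "disjoint_vbl R \<longleftrightarrow> (\<forall>e \<in> R. \<forall>e' \<in> R. e \<noteq> e' \<longrightarrow> vbl e \<inter> vbl e' = {})"

lemma disjoint_vblD: "disjoint_vbl R \<Longrightarrow> e \<in> R \<Longrightarrow> e' \<in> R \<Longrightarrow> v \<in> vbl e \<Longrightarrow> v \<in> vbl e' \<Longrightarrow> e = e'"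
  unfolding disjoint_vbl_def by blast

lemma count_Suc: "count T I (Suc t) v =
    count T I t v + (if \<exists>e \<in> resampled T I t. v \<in> vbl e then 1 else 0)"
  by (auto simp: resampled_def)

lemma count_mono: "s \<le> t \<Longrightarrow> count T I s v \<le> count T I t v"
  by (rule lift_Suc_mono_le[of "\<lambda>t. count T I t v"]) auto

lemma levelsI: "(j, e) \<in> W \<Longrightarrow> v \<in> vbl e \<Longrightarrow> j \<in> levels W v"
  unfolding levels_def by auto

lemma finite_levels:
  assumes "finite W" shows "finite (levels W v)"
  by (rule finite_subset[of _ "fst ` W"]) (use assms in \<open>force simp: levels_def\<close>)+

lemma touches_fst: "touches W e i \<Longrightarrow> i \<in> fst ` W"
  unfolding touches_def by force

lemma touches_max:
  assumes "finite W" "touches W e i"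
  obtains m where "i \<le> m" "touches W e m" "\<And>i'. touches W e i' \<Longrightarrow> i' \<le> m"
proof -
  have fin: "finite {j. touches W e j}"
    by (rule finite_subset[of _ "fst ` W"]) (use assms touches_fst in auto)
  show ?thesis
    by (rule that[of "Max {j. touches W e j}"])
      (use Max_in[OF fin] Max_ge[OF fin] assms(2) in auto)
qed

text \<open>Although \<open>R\<close> may be infinite, an event is added only if it contains one of
  the finitely many variables of \<open>W\<close>, and by disjointness each variable lies in at most
  one event of \<open>R\<close>.\<close>

lemma finite_add_events:
  assumes "finite W" "disjoint_vbl R"
  shows "finite (add_events W R)"
proof -
  let ?V = "\<Union>(i, e) \<in> W. vbl e"
  have "finite ?V" using assms(1) finite_vbl by auto
  have "finite {e \<in> R. v \<in> vbl e}" for v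
  proof (cases "\<exists>e \<in> R. v \<in> vbl e")
    case True
    then obtain e where "e \<in> R" "v \<in> vbl e" by auto
    then have "{e \<in> R. v \<in> vbl e} \<subseteq> {e}" using disjoint_vblD[OF assms(2)] by auto
    then show ?thesis by (rule finite_subset) auto
  next
    case False
    then have "{e \<in> R. v \<in> vbl e} = {}" by auto
    then show ?thesis by (simp only: finite.emptyI)
  qed
  then have "finite (\<Union>v \<in> ?V. {e \<in> R. v \<in> vbl e})" using \<open>finite ?V\<close> by blast
  then have "finite (Suc ` fst ` W \<times> (\<Union>v \<in> ?V. {e \<in> R. v \<in> vbl e}))" using assms(1) by blast
  moreover have "add_events W R \<subseteq> W \<union> Suc ` fst ` W \<times> (\<Union>v \<in> ?V. {e \<in> R. v \<in> vbl e})"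
    unfolding add_events_def touches_def by force
  ultimately show ?thesis using assms(1) by (meson finite_Un finite_subset)
qed

lemma touches_mono: "W \<subseteq> W' \<Longrightarrow> touches W e i \<Longrightarrow> touches W' e i"
  unfolding touches_def by blast

text \<open>A new event goes one level beyond the last level that it touches, so it overlaps the
  level below and cannot overlap an old event on its own level. Two new events are disjoint as
  members of \<open>R\<close>.\<close>

lemma stack_add_events:
  assumes W: "stack W" and R: "disjoint_vbl R"
  shows "stack (add_events W R)"
  unfolding stack_def
proof (intro conjI allI impI)
  show "finite (add_events W R)" using finite_add_events W R by (auto simp: stack_def)
  have sub: "W \<subseteq> add_events W R" by (auto simp: add_events_def)
  show "touches (add_events W R) e j" if "(Suc j, e) \<in> add_events W R" for j e
    by (rule touches_mono[OF sub]) (use that W in \<open>auto simp: add_events_def stack_def\<close>)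
  have old_new: "vbl e \<inter> vbl e' = {}"
    if "(i, e) \<in> W" "i = Suc j" "\<forall>i'. touches W e' i' \<longrightarrow> i' \<le> j" for i j e e'
    using that unfolding touches_def by (metis Int_commute Suc_n_not_le_n)
  show "vbl e \<inter> vbl e' = {}"
    if "(i, e) \<in> add_events W R" "(i, e') \<in> add_events W R" "e \<noteq> e'" for i e e'
    using that(1)
  proof (cases "(i, e) \<in> W"; cases "(i, e') \<in> W")
    assume "(i, e) \<in> W" "(i, e') \<in> W"
    then show ?thesis using W that(3) unfolding stack_def by blast
  next
    assume "(i, e) \<in> W" "(i, e') \<notin> W"
    then show ?thesis using that(2) old_new[of i e _ e'] unfolding add_events_def by blast
  next
    assume "(i, e) \<notin> W" "(i, e') \<in> W"
    then show ?thesis using that(1) old_new[of i e' _ e] unfolding add_events_def by blast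
  next
    assume "(i, e) \<notin> W" "(i, e') \<notin> W"
    then show ?thesis using that R unfolding add_events_def disjoint_vbl_def by blast
  qed
qed

lemma layer0_add_events: "(0, e) \<in> add_events W R \<longleftrightarrow> (0, e) \<in> W"
  by (auto simp: add_events_def)

lemma stack_past:
  assumes "stack W" "\<forall>t. disjoint_vbl (R t)"
  shows "stack (past R t W)"
  using assms(1) by (induction t arbitrary: W) (auto intro: stack_add_events assms(2)[rule_format])

lemma layer0_past: "(0, e) \<in> past R t W \<longleftrightarrow> (0, e) \<in> W"
  by (induction t arbitrary: W) (auto simp: layer0_add_events)

text \<open>An event containing \<open>v\<close> that was resampled earlier touches the top level
  \<open>i\<close> of \<open>v\<close>, so it goes strictly above \<open>i\<close> and supplies the
  new top. Hence every resampling adds exactly one level to \<open>v\<close>. The first conjunct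
  says that nothing is inserted at or below the old top; the induction needs it to split the count
  at the new top.\<close>

lemma levels_past:
  assumes "\<forall>t. disjoint_vbl (R t)"
  shows "finite W \<Longrightarrow> i \<in> levels W v \<Longrightarrow> (\<And>j. j \<in> levels W v \<Longrightarrow> j \<le> i) \<Longrightarrow>
    {j \<in> levels (past R t W) v. j \<le> i} \<subseteq> levels W v \<and>
    card {j \<in> levels (past R t W) v. i < j} = card {s. s < t \<and> (\<exists>e \<in> R s. v \<in> vbl e)}"
proof (induction t arbitrary: W i)
  case 0
  then have "{j \<in> levels W v. i < j} = {}" by fastforce
  then have "card {j \<in> levels W v. i < j} = 0" by (simp only: card.empty)
  then show ?case by simp
next
  case (Suc t)
  let ?W = "add_events W (R t)"
  let ?S = "\<lambda>t. {s. s < t \<and> (\<exists>e \<in> R s. v \<in> vbl e)}"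
  have fin: "finite ?W" by (rule finite_add_events) (use Suc.prems assms in auto)
  have mono: "W \<subseteq> ?W" by (auto simp: add_events_def)
  show ?case
  proof (cases "\<exists>e \<in> R t. v \<in> vbl e")
    case False
    then have lev: "levels ?W v = levels W v" unfolding levels_def add_events_def by auto
    have S: "?S (Suc t) = ?S t" using False less_Suc_eq by auto
    show ?thesis
      using Suc.IH[of ?W i] fin Suc.prems unfolding lev S by auto
  next
    case True
    then obtain e where e: "e \<in> R t" "v \<in> vbl e" by auto
    have "touches W e i" using Suc.prems(2) e unfolding touches_def levels_def by blast
    \<comment> \<open>Here \<open>m\<close> may exceed \<open>i\<close>, because \<open>e\<close>
      may touch higher levels through its other variables. This leaves gaps in the levels of
      \<open>v\<close>, which is why \<open>height\<close> counts occupied levels only.\<close>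
    then obtain m where m: "i \<le> m" "touches W e m" "\<And>i'. touches W e i' \<Longrightarrow> i' \<le> m"
      using touches_max Suc.prems(1) by blast
    have lev: "levels ?W v = insert (Suc m) (levels W v)"
    proof (intro equalityI subsetI)
      fix j assume "j \<in> levels ?W v"
      then obtain e' where e': "(j, e') \<in> ?W" "v \<in> vbl e'" unfolding levels_def by auto
      show "j \<in> insert (Suc m) (levels W v)"
      proof (cases "(j, e') \<in> W")
        case True
        then show ?thesis using e' by (auto intro: levelsI)
      next
        case False
        then obtain k where k: "j = Suc k" "e' \<in> R t" "touches W e' k"
            "\<forall>i'. touches W e' i' \<longrightarrow> i' \<le> k"
          using e'(1) unfolding add_events_def by auto
        then have "e' = e" using disjoint_vblD[OF assms[rule_format] _ e(1) e'(2) e(2)] by auto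
        then have "k = m" using k m by (simp add: le_antisym)
        then show ?thesis using k by simp
      qed
    next
      fix j assume "j \<in> insert (Suc m) (levels W v)"
      moreover have "(Suc m, e) \<in> ?W" unfolding add_events_def using e m by auto
      ultimately show "j \<in> levels ?W v" using mono e(2) unfolding levels_def by auto
    qed
    have IH: "{j \<in> levels (past R t ?W) v. j \<le> Suc m} \<subseteq> levels ?W v \<and>
        card {j \<in> levels (past R t ?W) v. Suc m < j} = card (?S t)"
    proof (rule Suc.IH[OF fin])
      fix j assume "j \<in> levels ?W v"
      then show "j \<le> Suc m" using Suc.prems(3) m(1) unfolding lev by fastforce
    qed (auto simp: lev)
    have in_past: "Suc m \<in> levels (past R t ?W) v"
    proof -
      have "W' \<subseteq> past R t W'" for W'
      proof (induction t arbitrary: W')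
        case (Suc t)
        then show ?case by (force simp: add_events_def)
      qed simp
      then have "levels ?W v \<subseteq> levels (past R t ?W) v" unfolding levels_def by blast
      then show ?thesis using lev by auto
    qed
    have split: "{j \<in> levels (past R t ?W) v. i < j} =
        insert (Suc m) {j \<in> levels (past R t ?W) v. Suc m < j}"
    proof (intro equalityI subsetI)
      fix j assume j: "j \<in> {j \<in> levels (past R t ?W) v. i < j}"
      show "j \<in> insert (Suc m) {j \<in> levels (past R t ?W) v. Suc m < j}"
      proof (cases "j \<le> Suc m")
        case True
        then have "j \<in> levels ?W v" using IH j by auto
        then show ?thesis using lev j Suc.prems(3)[of j] by auto
      qed (use j in auto)
    qed (use in_past m(1) in auto)
    have "finite (past R t W')" if "finite W'" for W'
      using that
    proof (induction t arbitrary: W')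
      case (Suc t)
      then show ?case by (simp add: finite_add_events assms)
    qed simp
    then have "finite (levels (past R t ?W) v)" by (intro finite_levels) (use fin in blast)
    then have "card {j \<in> levels (past R t ?W) v. i < j} = Suc (card (?S t))"
      unfolding split using IH by (subst card_insert_disjoint) auto
    moreover have "?S (Suc t) = insert t (?S t)" using True less_Suc_eq by auto
    then have "card (?S (Suc t)) = Suc (card (?S t))" by simp
    moreover have "{j \<in> levels (past R t ?W) v. j \<le> i} \<subseteq> levels W v"
    proof
      fix j assume "j \<in> {j \<in> levels (past R t ?W) v. j \<le> i}"
      then have "j \<in> levels ?W v" "j \<le> i" using IH m(1) by auto
      then show "j \<in> levels W v" using lev m(1) by auto
    qed
    ultimately show ?thesis by simp
  qed
qed

lemma count_eq_card:
  "count T I t v = card {s. s < t \<and> (\<exists>e \<in> resampled T I s. v \<in> vbl e)}"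
proof (induction t)
  case (Suc t)
  let ?S = "\<lambda>t. {s. s < t \<and> (\<exists>e \<in> resampled T I s. v \<in> vbl e)}"
  show ?case
  proof (cases "\<exists>e \<in> resampled T I t. v \<in> vbl e")
    case True
    then have "?S (Suc t) = insert t (?S t)" using less_Suc_eq by auto
    then show ?thesis using Suc.IH True unfolding count_Suc by simp
  next
    case False
    then have "?S (Suc t) = ?S t" using less_Suc_eq by auto
    then show ?thesis using Suc.IH False unfolding count_Suc by simp
  qed
qed simp

lemma height_past:
  assumes "\<forall>t. disjoint_vbl (I t)" "finite W" "i \<in> levels W v"
    "\<And>j. j \<in> levels W v \<Longrightarrow> j \<le> i"
  shows "height (past (resampled T I) t W) i v = count T I t v"
proof -
  have "\<forall>t. disjoint_vbl (resampled T I t)"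
    using assms(1) unfolding disjoint_vbl_def resampled_def by auto
  then show ?thesis
    using levels_past[of "resampled T I" W i v t] assms unfolding height_def count_eq_card by blast
qed

text \<open>At the moment when an event is added, its level is the top level of each of its
  variables. From then on \<open>height_past\<close> applies, so the values that it reads in the
  finished witness are those at the time of its resampling.\<close>

lemma bad_past:
  assumes I: "\<forall>t. disjoint_vbl (I t)"
  shows "finite W \<Longrightarrow> (i, e) \<in> past (resampled T I) t W \<Longrightarrow> (i, e) \<notin> W \<Longrightarrow>
    bad e (\<lambda>v. T v (height (past (resampled T I) t W) i v))"
proof (induction t arbitrary: W)
  case (Suc t)
  let ?R = "resampled T I"
  let ?W = "add_events W (?R t)"
  have dR: "\<forall>t. disjoint_vbl (?R t)"
    using I unfolding disjoint_vbl_def resampled_def by auto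
  have fin: "finite ?W" by (rule finite_add_events) (use Suc.prems dR in auto)
  show ?case
  proof (cases "(i, e) \<in> ?W")
    case False
    then show ?thesis using Suc.IH[OF fin] Suc.prems by auto
  next
    case True
    then obtain m where m: "i = Suc m" "e \<in> ?R t" "\<forall>i'. touches W e i' \<longrightarrow> i' \<le> m"
      using Suc.prems(3) unfolding add_events_def by auto
    have "height (past ?R t ?W) i v = count T I t v" if v: "v \<in> vbl e" for v
    proof (rule height_past[OF I fin levelsI[OF True v]])
      fix j assume "j \<in> levels ?W v"
      then obtain e' where e': "(j, e') \<in> ?W" "v \<in> vbl e'" unfolding levels_def by auto
      show "j \<le> i"
      proof (cases "(j, e') \<in> W")
        case True
        then have "touches W e j" unfolding touches_def using v e' by auto
        then show ?thesis using m by fastforce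
      next
        case False
        then obtain k where k: "j = Suc k" "e' \<in> ?R t" "touches W e' k"
          using e' unfolding add_events_def by auto
        then have "e' = e" using disjoint_vblD[OF dR[rule_format] _ m(2) e'(2) v] by auto
        then show ?thesis using k m by auto
      qed
    qed
    then have "bad e (\<lambda>v. T v (height (past ?R t ?W) i v)) \<longleftrightarrow> bad e (\<lambda>v. T v (count T I t v))"
      by (intro bad_cong) auto
    moreover have "bad e (\<lambda>v. T v (count T I t v))" using m(2) by (simp add: resampled_def)
    ultimately show ?thesis by simp
  qed
qed auto

text \<open>This links runs to the table. At the start the root is the only event, so level 0 is the
  top level of its variables and \<open>height_past\<close> applies to it; the events added later
  are covered by \<open>bad_past\<close>.\<close>

lemma past_in_stacks:
  assumes I: "\<forall>t. disjoint_vbl (I t)" and e: "e \<in> resampled T I t" "v \<in> vbl e"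
  defines "W \<equiv> past (resampled T I) t {(0, e)}"
  shows "W \<in> stacks v" "valid T W" "height W 0 v = count T I t v"
proof -
  have dR: "\<forall>t. disjoint_vbl (resampled T I t)"
    using I unfolding disjoint_vbl_def resampled_def by auto
  have "stack {(0, e)}" unfolding stack_def by auto
  then have "stack W" unfolding W_def using stack_past dR by blast
  moreover have l0: "(0, e') \<in> W \<longleftrightarrow> e' = e" for e' unfolding W_def layer0_past by auto
  ultimately show "W \<in> stacks v" unfolding stacks_def using e(2) by auto
  have h: "height W 0 u = count T I t u" if "u \<in> vbl e" for u
    unfolding W_def by (rule height_past) (use I that in \<open>auto simp: levels_def\<close>)
  then show "height W 0 v = count T I t v" using e by simp
  show "valid T W"
    unfolding valid_def
  proof (intro ballI, clarify)
    fix i e' assume ie: "(i, e') \<in> W"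
    show "bad e' (\<lambda>v. T v (height W i v))"
    proof (cases "i = 0")
      case True
      then have "e' = e" using ie l0 by simp
      moreover have "bad e (\<lambda>v. T v (height W 0 v)) \<longleftrightarrow> bad e (\<lambda>v. T v (count T I t v))"
        using h by (intro bad_cong) auto
      ultimately show ?thesis using e(1) True by (simp add: resampled_def)
    next
      case False
      then show ?thesis using bad_past[OF I, of "{(0, e)}" i e' T t] ie unfolding W_def by auto
    qed
  qed
qed

lemma count_pos_imp_valid:
  assumes "\<forall>t. disjoint_vbl (I t)" "count T I t v > 0"
  shows "\<exists>W \<in> stacks v. valid T W"
proof -
  have "{s. s < t \<and> (\<exists>e \<in> resampled T I s. v \<in> vbl e)} \<noteq> {}"
    using assms(2) unfolding count_eq_card by (metis card.empty less_irrefl)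
  then show ?thesis using past_in_stacks[OF assms(1)] by blast
qed

text \<open>Two resamplings of \<open>v\<close> have different witnesses, since \<open>height W 0 v\<close> recovers the number of
  earlier resamplings of \<open>v\<close>.\<close>

lemma finite_resamplings:
  assumes I: "\<forall>t. disjoint_vbl (I t)" and fin: "finite {W \<in> stacks v. valid T W}"
  shows "finite {t. \<exists>e \<in> resampled T I t. v \<in> vbl e}"
proof -
  let ?R = "{t. \<exists>e \<in> resampled T I t. v \<in> vbl e}"
  have "inj_on (\<lambda>t. count T I t v) ?R"
  proof (rule linorder_inj_onI)
    fix s t assume st: "s < t" "s \<in> ?R"
    then have "count T I s v < count T I (Suc s) v" by (auto simp: count_Suc simp del: count.simps)
    also have "\<dots> \<le> count T I t v" by (rule count_mono) (use st in auto)
    finally show "count T I s v \<noteq> count T I t v" by simp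
  qed auto
  moreover have "(\<lambda>t. count T I t v) ` ?R \<subseteq> (\<lambda>W. height W 0 v) ` {W \<in> stacks v. valid T W}"
  proof clarify
    fix t e assume "e \<in> resampled T I t" "v \<in> vbl e"
    from past_in_stacks[OF I this]
    show "count T I t v \<in> (\<lambda>W. height W 0 v) ` {W \<in> stacks v. valid T W}"
      by (metis (mono_tags, lifting) image_eqI mem_Collect_eq)
  qed
  ultimately show ?thesis using fin by (meson finite_imageI finite_imageD finite_subset)
qed

lemma count_eventually_const:
  assumes "\<forall>t. disjoint_vbl (I t)" "finite {W \<in> stacks v. valid T W}"
  shows "\<exists>s. \<forall>t \<ge> s. count T I t v = count T I s v"
proof -
  obtain s where s: "\<And>t. t \<in> {t. \<exists>e \<in> resampled T I t. v \<in> vbl e} \<Longrightarrow> t < s"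
    using finite_resamplings[OF assms] unfolding finite_nat_set_iff_bounded by blast
  have "count T I t v = count T I s v" if "t \<ge> s" for t
    using that
  proof (induction t rule: dec_induct)
    case (step n)
    then have "\<not> (\<exists>e \<in> resampled T I n. v \<in> vbl e)" using s[of n] by auto
    then show ?case using step by (simp add: count_Suc del: count.simps)
  qed simp
  then show ?thesis by blast
qed

text \<open>A junk value if \<open>v\<close> is resampled infinitely often.\<close>

definition final_count :: "('v \<Rightarrow> nat \<Rightarrow> 'a) \<Rightarrow> (nat \<Rightarrow> 'e set) \<Rightarrow> 'v \<Rightarrow> nat" where
  "final_count T I v = (LEAST k. \<forall>t. count T I t v \<le> k)"

lemma eventually_final_count:
  assumes "\<forall>t. disjoint_vbl (I t)" "finite {W \<in> stacks v. valid T W}"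
  shows "\<forall>\<^sub>F t in sequentially. count T I t v = final_count T I v"
proof -
  obtain s where s: "\<And>t. t \<ge> s \<Longrightarrow> count T I t v = count T I s v"
    using count_eventually_const[OF assms] by blast
  have "final_count T I v = count T I s v"
    unfolding final_count_def
  proof (rule Least_equality)
    show "\<forall>t. count T I t v \<le> count T I s v"
      by (metis count_mono nat_le_linear s)
  qed blast
  then show ?thesis using s unfolding eventually_sequentially by (metis)
qed

text \<open>On the finitely many variables of \<open>e\<close> the run is constant from some time
  on. If \<open>e\<close> were bad for the final values, its next inspection would resample it and
  raise a count.\<close>

lemma final_not_bad:
  assumes I: "\<forall>t. disjoint_vbl (I t)" and fin: "\<And>v. finite {W \<in> stacks v. valid T W}"
    and inf: "infinite {t. e \<in> I t}"
  shows "\<not> bad e (\<lambda>v. T v (final_count T I v))"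
proof
  assume b: "bad e (\<lambda>v. T v (final_count T I v))"
  have "\<forall>\<^sub>F t in sequentially. \<forall>v \<in> vbl e. count T I t v = final_count T I v"
    using eventually_final_count[OF I fin] finite_vbl by (simp add: eventually_ball_finite)
  then obtain s where s: "\<And>t v. t \<ge> s \<Longrightarrow> v \<in> vbl e \<Longrightarrow> count T I t v = final_count T I v"
    unfolding eventually_sequentially by blast
  obtain t where t: "t \<ge> s" "e \<in> I t" using inf by (metis (mono_tags) finite_nat_set_iff_bounded_le mem_Collect_eq nat_le_linear)
  have "bad e (\<lambda>v. T v (count T I t v))"
    using b bad_cong[of e "\<lambda>v. T v (count T I t v)"] s t by auto
  \<comment> \<open>A bad event without variables would never be noticed by the counts;
    \<open>vbl_nonempty\<close> excludes it.\<close>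
  moreover obtain v where v: "v \<in> vbl e" using vbl_nonempty by blast
  ultimately have "count T I (Suc t) v = count T I t v + 1" using t by auto
  then show False using s[of t v] s[of "Suc t" v] t v by simp
qed

lemma final_count_eq_0:
  assumes I: "\<forall>t. disjoint_vbl (I t)" and "\<not> (\<exists>W \<in> stacks v. valid T W)"
  shows "final_count T I v = 0"
proof -
  have "count T I t v = 0" for t using count_pos_imp_valid[OF I] assms(2) by auto
  then show ?thesis unfolding final_count_def by simp
qed

end

section \<open>The expected number of witnesses\<close>

text \<open>There are only countably many patterns on \<open>S\<close>, so the preimage of any set
  whatsoever is a countable union of cylinders.\<close>

lemma measurable_PiM_finite_dependence:
  fixes h :: "('i \<Rightarrow> 'a::countable) \<Rightarrow> 'b" and q :: "'a pmf"
  assumes S: "finite S" "S \<subseteq> I"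
    and dep: "\<And>x y. (\<And>i. i \<in> S \<Longrightarrow> x i = y i) \<Longrightarrow> h x = h y"
    and range: "\<And>x. h x \<in> space N"
  shows "h \<in> PiM I (\<lambda>_. measure_pmf q) \<rightarrow>\<^sub>M N"
proof (rule measurableI)
  fix A assume "A \<in> sets N"
  let ?M = "PiM I (\<lambda>_. measure_pmf q)"
  let ?B = "{b \<in> PiE S (\<lambda>_. UNIV). h b \<in> A}"
  have "countable (PiE S (\<lambda>_. UNIV :: 'a set))" by (rule countable_PiE) (use S in auto)
  then have B: "countable ?B" by (rule countable_subset[rotated]) auto
  have "h -` A \<inter> space ?M = (\<Union>b \<in> ?B. {x \<in> space ?M. \<forall>s \<in> S. x s = b s})"
  proof (intro equalityI subsetI)
    fix x assume x: "x \<in> h -` A \<inter> space ?M"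
    have "h (restrict x S) = h x" by (rule dep) auto
    then show "x \<in> (\<Union>b \<in> ?B. {x \<in> space ?M. \<forall>s \<in> S. x s = b s})"
      using x by (intro UN_I[of "restrict x S"]) auto
  next
    fix x assume "x \<in> (\<Union>b \<in> ?B. {x \<in> space ?M. \<forall>s \<in> S. x s = b s})"
    then obtain b where "h b \<in> A" "x \<in> space ?M" "\<forall>s \<in> S. x s = b s" by auto
    moreover from this have "h x = h b" by (intro dep) auto
    ultimately show "x \<in> h -` A \<inter> space ?M" by auto
  qed
  moreover have "{x \<in> space ?M. \<forall>s \<in> S. x s = b s} \<in> sets ?M" for b
  proof (rule sets.sets_Collect_finite_All[OF _ S(1)])
    fix s assume "s \<in> S"
    then have "(\<lambda>x. x s) \<in> ?M \<rightarrow>\<^sub>M measure_pmf q" using S by (intro measurable_component_singleton) auto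
    from measurable_sets[OF this, of "{b s}"] show "{x \<in> space ?M. x s = b s} \<in> sets ?M"
      by (simp add: vimage_def Int_def conj_commute)
  qed
  ultimately show "h -` A \<inter> space ?M \<in> sets ?M"
    using B by (auto intro: sets.countable_UN')
qed (rule range)

lemma prob_space_PiM_pmf: "prob_space (PiM I (\<lambda>_. measure_pmf q))"
  by (intro prob_space_PiM measure_pmf.prob_space_axioms)

lemma space_PiM_pmf_UNIV [simp]: "space (PiM UNIV (\<lambda>_. measure_pmf q)) = UNIV"
  by (simp add: space_PiM)

lemma sets_PiM_finite_dependence:
  fixes q :: "'a::countable pmf"
  assumes "finite S" and "\<And>x y. (\<And>i. i \<in> S \<Longrightarrow> x i = y i) \<Longrightarrow> P x = P y"
  shows "{x. P x} \<in> sets (PiM UNIV (\<lambda>_. measure_pmf q))"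
proof -
  have "P \<in> PiM UNIV (\<lambda>_. measure_pmf q) \<rightarrow>\<^sub>M count_space UNIV"
    by (rule measurable_PiM_finite_dependence[OF assms(1)]; (rule assms(2))?; simp)
  from measurable_sets[OF this, of "{True}"] show ?thesis by (simp add: vimage_def)
qed

lemma indep_vars_coordinates:
  fixes q :: "'a pmf"
  shows "prob_space.indep_vars (PiM UNIV (\<lambda>_::'i. measure_pmf q)) (\<lambda>_. measure_pmf q) (\<lambda>i x. x i) UNIV"
proof -
  interpret prob_space "PiM UNIV (\<lambda>_::'i. measure_pmf q)" by (rule prob_space_PiM_pmf)
  let ?M = "PiM UNIV (\<lambda>_::'i. measure_pmf q)"
  have "distr ?M (measure_pmf q) (\<lambda>x. x i) = measure_pmf q" for i
    using distr_PiM_component[of UNIV "\<lambda>_. measure_pmf q" i] measure_pmf.prob_space_axioms by auto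
  then show ?thesis
    by (subst indep_vars_iff_distr_eq_PiM) (auto simp: restrict_UNIV distr_id2)
qed

lemma indep_vars_blocks:
  fixes q :: "'a::countable pmf" and Y :: "'j \<Rightarrow> ('i \<Rightarrow> 'a) \<Rightarrow> 'b"
  assumes K: "\<And>j. j \<in> L \<Longrightarrow> finite (K j)" "disjoint_family_on K L"
    and dep: "\<And>j x y. j \<in> L \<Longrightarrow> (\<And>i. i \<in> K j \<Longrightarrow> x i = y i) \<Longrightarrow> Y j x = Y j y"
    and range: "\<And>j x. j \<in> L \<Longrightarrow> Y j x \<in> space (N j)"
  shows "prob_space.indep_vars (PiM UNIV (\<lambda>_. measure_pmf q)) N Y L"
proof -
  interpret prob_space "PiM UNIV (\<lambda>_::'i. measure_pmf q)" by (rule prob_space_PiM_pmf)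
  have "indep_vars (\<lambda>j. PiM (K j) (\<lambda>_. measure_pmf q)) (\<lambda>j x. restrict (\<lambda>i. x i) (K j)) L"
    by (rule indep_vars_restrict[OF indep_vars_coordinates]) (use K in auto)
  then have "indep_vars N (\<lambda>j x. Y j (restrict (\<lambda>i. x i) (K j))) L"
  proof (rule indep_vars_compose2)
    fix j assume "j \<in> L"
    then show "Y j \<in> PiM (K j) (\<lambda>_. measure_pmf q) \<rightarrow>\<^sub>M N j"
      by (intro measurable_PiM_finite_dependence[of "K j"] K dep range) auto
  qed
  moreover have "Y j (restrict (\<lambda>i. x i) (K j)) = Y j x" if "j \<in> L" for j x
    by (rule dep[OF that]) auto
  ultimately show ?thesis by (simp cong: indep_vars_cong)
qed

text \<open>Applied to three injections: from variables to the cells that an event of a witness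
  reads, from coordinates to the first cells of their rows, and to the right translations of the
  group.\<close>

lemma distr_PiM_pmf_inj:
  assumes "inj f"
  shows "distr (PiM UNIV (\<lambda>_. measure_pmf q)) (PiM UNIV (\<lambda>_. measure_pmf q)) (\<lambda>x i. x (f i)) =
    PiM UNIV (\<lambda>_. measure_pmf q)"
  using distr_PiM_reindex[of UNIV "\<lambda>_. measure_pmf q" f UNIV] assms measure_pmf.prob_space_axioms
  by (auto simp: restrict_UNIV)

lemma (in prob_space) AE_finite_events:
  assumes S: "countable S" and A: "\<And>s. s \<in> S \<Longrightarrow> A s \<in> events"
    and sum: "\<And>F. finite F \<Longrightarrow> F \<subseteq> S \<Longrightarrow> (\<Sum>s \<in> F. prob (A s)) \<le> c"
  shows "AE x in M. finite {s \<in> S. x \<in> A s}" and "prob (\<Union>s \<in> S. A s) \<le> c"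
proof -
  \<comment> \<open>The events are enumerated by the natural numbers, with empty sets at the indices
    that code no element of \<open>S\<close>, so that Borel-Cantelli and countable subadditivity
    apply.\<close>
  define B where "B n = (if n \<in> to_nat_on S ` S then A (from_nat_into S n) else {})" for n
  have B: "B (to_nat_on S s) = A s" if "s \<in> S" for s using S that by (simp add: B_def)
  have meas: "B n \<in> events" for n using A S by (auto simp: B_def)
  have bound: "(\<Sum>n<m. prob (B n)) \<le> c" for m
  proof -
    let ?F = "{s \<in> S. to_nat_on S s < m}"
    have inj: "inj_on (to_nat_on S) ?F" using inj_on_to_nat_on[OF S] by (rule inj_on_subset) auto
    have "finite (to_nat_on S ` ?F)" by (rule finite_subset[of _ "{..<m}"]) auto
    then have fin: "finite ?F" using inj finite_imageD by blast
    have "(\<Sum>n<m. prob (B n)) = (\<Sum>n \<in> to_nat_on S ` ?F. prob (B n))"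
      by (rule sum.mono_neutral_right) (auto simp: B_def)
    also have "\<dots> = (\<Sum>s \<in> ?F. prob (A s))"
      by (subst sum.reindex[OF inj]) (auto intro!: sum.cong simp: B)
    also have "\<dots> \<le> c" by (rule sum) (use fin in auto)
    finally show ?thesis .
  qed
  have summ: "summable (\<lambda>n. prob (B n))"
  proof (rule bounded_imp_summable)
    fix n show "(\<Sum>k\<le>n. prob (B k)) \<le> c" using bound[of "Suc n"] by (simp add: lessThan_Suc_atMost)
  qed auto
  have "AE x in M. eventually (\<lambda>n. x \<in> space M - B n) sequentially"
    by (rule borel_cantelli_AE1) (use meas summ in \<open>auto simp: emeasure_eq_measure\<close>)
  then show "AE x in M. finite {s \<in> S. x \<in> A s}"
  proof (rule eventually_mono)
    fix x assume "\<forall>\<^sub>F n in sequentially. x \<in> space M - B n"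
    then obtain m where m: "\<And>n. n \<ge> m \<Longrightarrow> x \<notin> B n" unfolding eventually_sequentially by auto
    have "to_nat_on S s < m" if "s \<in> S" "x \<in> A s" for s
      using m[of "to_nat_on S s"] B[OF that(1)] that(2) by (metis leI)
    then have "to_nat_on S ` {s \<in> S. x \<in> A s} \<subseteq> {..<m}" by auto
    then have "finite (to_nat_on S ` {s \<in> S. x \<in> A s})" by (rule finite_subset) auto
    moreover have "inj_on (to_nat_on S) {s \<in> S. x \<in> A s}"
      using inj_on_to_nat_on[OF S] by (rule inj_on_subset) auto
    ultimately show "finite {s \<in> S. x \<in> A s}" by (rule finite_imageD)
  qed
  have "(\<Union>s \<in> S. A s) \<subseteq> (\<Union>n. B n)"
  proof
    fix x assume "x \<in> (\<Union>s \<in> S. A s)"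
    then obtain s where "s \<in> S" "x \<in> A s" by auto
    then show "x \<in> (\<Union>n. B n)" using B[of s] by blast
  qed
  then have "prob (\<Union>s \<in> S. A s) \<le> prob (\<Union>n. B n)"
    by (rule finite_measure_mono) (use meas in auto)
  also have "\<dots> \<le> (\<Sum>n. prob (B n))"
    by (rule finite_measure_subadditive_countably) (use meas summ in auto)
  also have "\<dots> \<le> c" by (rule suminf_le_const[OF summ bound])
  finally show "prob (\<Union>s \<in> S. A s) \<le> c" .
qed

section \<open>The total weight of the witnesses at a variable\<close>

context event_system
begin

definition weight :: "('e \<Rightarrow> real) \<Rightarrow> (nat \<times> 'e) set \<Rightarrow> real" where
  "weight p W = (\<Prod>(i, e) \<in> W. p e)"

text \<open>Disjointness inside a level is dropped and levels and events are cut off. The family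
  becomes finite, and removing layer 0 turns depth \<open>Suc d\<close> into depth \<open>d\<close>,
  on which the induction runs.\<close>

definition towers :: "'e set \<Rightarrow> nat \<Rightarrow> 'e set \<Rightarrow> (nat \<times> 'e) set set" where
  "towers E d I = {W. W \<subseteq> {..d} \<times> E \<and> {e. (0, e) \<in> W} = I \<and>
     (\<forall>j e. (Suc j, e) \<in> W \<longrightarrow> touches W e j)}"

definition lower :: "(nat \<times> 'e) set \<Rightarrow> (nat \<times> 'e) set" where
  "lower W = {(j, e). (Suc j, e) \<in> W}"

lemma finite_towers: "finite E \<Longrightarrow> finite (towers E d I)"
  by (rule finite_subset[of _ "Pow ({..d} \<times> E)"]) (auto simp: towers_def)

lemma tower_eq_lower:
  assumes "{e. (0, e) \<in> W} = I"
  shows "W = {0} \<times> I \<union> map_prod Suc id ` lower W"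
proof (intro set_eqI, clarify)
  fix j e show "(j, e) \<in> W \<longleftrightarrow> (j, e) \<in> {0} \<times> I \<union> map_prod Suc id ` lower W"
    using assms by (cases j) (auto simp: lower_def map_prod_def image_iff)
qed

lemma weight_tower:
  assumes "finite W" "{e. (0, e) \<in> W} = I"
  shows "weight p W = (\<Prod>e \<in> I. p e) * weight p (lower W)"
proof -
  have inj: "inj_on (map_prod Suc id) (lower W)" by (auto simp: inj_on_def)
  have fin: "finite ({0::nat} \<times> I)" "finite (map_prod Suc id ` lower W)"
    using assms tower_eq_lower[OF assms(2)] by (metis finite_Un)+
  have "weight p W = weight p ({0} \<times> I) * weight p (map_prod Suc id ` lower W)"
    unfolding weight_def
    by (subst (1) tower_eq_lower[OF assms(2)], rule prod.union_disjoint) (use fin in auto)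
  moreover have "weight p ({0} \<times> I) = (\<Prod>e \<in> I. p e)"
    unfolding weight_def using prod.cartesian_product[of "\<lambda>i e. p e" I "{0::nat}"] by simp
  moreover have "weight p (map_prod Suc id ` lower W) = weight p (lower W)"
    unfolding weight_def by (subst prod.reindex[OF inj]) (auto intro!: prod.cong)
  ultimately show ?thesis by simp
qed

text \<open>Let \<open>\<mu> e = p e * exp (\<eta> * card (vbl e))\<close>. Above layer
  \<open>I\<close> comes a set \<open>J\<close> of events overlapping \<open>I\<close>, and by
  induction everything from \<open>J\<close> upwards weighs at most the product of \<mu> over
  \<open>J\<close>. The sum over all \<open>J\<close> is at most \<open>exp (\<eta> * s)\<close>,
  where \<open>s\<close> is the sum of \<open>card (vbl e)\<close> over \<open>I\<close>. This is
  exactly the factor by which the product of \<mu> over \<open>I\<close> exceeds that of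
  \<open>p\<close>.\<close>

lemma sum_weight_towers:
  fixes p :: "'e \<Rightarrow> real" and \<eta> :: real
  assumes E: "finite E" and p: "\<And>e. p e \<ge> 0" and \<eta>: "\<eta> \<ge> 0"
    and sum: "\<And>v. (\<Sum>e \<in> {e \<in> E. v \<in> vbl e}. p e * exp (\<eta> * card (vbl e))) \<le> \<eta>"
  shows "I \<subseteq> E \<Longrightarrow> (\<Sum>W \<in> towers E d I. weight p W) \<le> (\<Prod>e \<in> I. p e * exp (\<eta> * card (vbl e)))"
proof (induction d arbitrary: I)
  case 0
  have "towers E 0 I \<subseteq> {{0} \<times> I}" unfolding towers_def by fastforce
  moreover have "weight p ({0} \<times> I) = (\<Prod>e \<in> I. p e)"
    unfolding weight_def using prod.cartesian_product[of "\<lambda>i e. p e" I "{0::nat}"] by simp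
  ultimately have "(\<Sum>W \<in> towers E 0 I. weight p W) \<le> (\<Prod>e \<in> I. p e)"
    using p prod_nonneg[of I p] by (auto simp: subset_singleton_iff)
  also have "\<dots> \<le> (\<Prod>e \<in> I. p e * exp (\<eta> * card (vbl e)))"
  proof (intro prod_mono conjI p)
    fix e show "p e \<le> p e * exp (\<eta> * card (vbl e))"
      using mult_left_mono[of 1 "exp (\<eta> * card (vbl e))" "p e"] p \<eta> by simp
  qed
  finally show ?case .
next
  case (Suc d)
  have fI: "finite I" using Suc.prems E finite_subset by auto
  let ?\<mu> = "\<lambda>e. p e * exp (\<eta> * card (vbl e))"
  define N where "N = {e \<in> E. vbl e \<inter> (\<Union>(vbl ` I)) \<noteq> {}}"
  have fN: "finite N" "N \<subseteq> E" using E by (auto simp: N_def)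
  have w0: "weight p W \<ge> 0" for W unfolding weight_def using p by (auto intro!: prod_nonneg)
  have lower_in: "lower W \<in> (\<Union>J \<in> Pow N. towers E d J)" if W: "W \<in> towers E (Suc d) I" for W
  proof (intro UN_I[of "{e. (1, e) \<in> W}"])
    show "{e. (1, e) \<in> W} \<in> Pow N"
      using W unfolding towers_def N_def touches_def by fastforce
    show "lower W \<in> towers E d {e. (1, e) \<in> W}"
      using W unfolding towers_def lower_def touches_def by auto
  qed
  have inj: "inj_on lower (towers E (Suc d) I)"
  proof (rule inj_onI)
    fix W W' assume W: "W \<in> towers E (Suc d) I" "W' \<in> towers E (Suc d) I" and eq: "lower W = lower W'"
    have "W = {0} \<times> I \<union> map_prod Suc id ` lower W" "W' = {0} \<times> I \<union> map_prod Suc id ` lower W'"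
      by (rule tower_eq_lower; use W in \<open>simp add: towers_def\<close>)+
    then show "W = W'" unfolding eq by (rule trans[OF _ sym])
  qed
  have fW: "finite W" if "W \<in> towers E (Suc d) I" for W
    by (rule finite_subset[of _ "{..Suc d} \<times> E"]) (use that E in \<open>auto simp: towers_def\<close>)
  have "(\<Sum>W \<in> towers E (Suc d) I. weight p W) =
      (\<Sum>W \<in> towers E (Suc d) I. (\<Prod>e \<in> I. p e) * weight p (lower W))"
  proof (rule sum.cong[OF refl])
    fix W assume W: "W \<in> towers E (Suc d) I"
    then have "{e. (0, e) \<in> W} = I" by (simp add: towers_def)
    then show "weight p W = (\<Prod>e \<in> I. p e) * weight p (lower W)"
      by (rule weight_tower[OF fW[OF W]])
  qed
  also have "\<dots> = (\<Prod>e \<in> I. p e) * (\<Sum>W \<in> lower ` towers E (Suc d) I. weight p W)"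
    by (simp add: sum.reindex[OF inj] sum_distrib_left)
  also have "\<dots> \<le> (\<Prod>e \<in> I. p e) * (\<Sum>W \<in> (\<Union>J \<in> Pow N. towers E d J). weight p W)"
    using lower_in w0 fN E p
    by (intro mult_left_mono sum_mono2 prod_nonneg) (auto simp: finite_towers)
  also have "(\<Sum>W \<in> (\<Union>J \<in> Pow N. towers E d J). weight p W) =
      (\<Sum>J \<in> Pow N. \<Sum>W \<in> towers E d J. weight p W)"
    by (rule sum.UNION_disjoint) (use fN E finite_towers in \<open>auto simp: towers_def\<close>)
  also have "\<dots> \<le> (\<Sum>J \<in> Pow N. \<Prod>e \<in> J. ?\<mu> e)"
    using fN by (intro sum_mono Suc.IH) auto
  \<comment> \<open>Expanding the product enumerates the subsets of \<open>N\<close>; afterwards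
    \<open>1 + u \<le> exp u\<close> is applied to each factor.\<close>
  also have "\<dots> = (\<Prod>e \<in> N. ?\<mu> e + 1)" using prod_add[OF fN(1), of ?\<mu> "\<lambda>_. 1"] by simp
  also have "\<dots> \<le> (\<Prod>e \<in> N. exp (?\<mu> e))"
    by (intro prod_mono) (use p in \<open>auto simp: add.commute intro!: add_nonneg_nonneg\<close>)
  also have "\<dots> = exp (\<Sum>e \<in> N. ?\<mu> e)" by (simp add: exp_sum fN)
  \<comment> \<open>Every event of \<open>N\<close> is charged to the variables that it shares with
    layer 0, of which there is at least one. Each variable is charged at most \<eta> by
    assumption.\<close>
  also have "(\<Sum>e \<in> N. ?\<mu> e) \<le> (\<Sum>v \<in> \<Union>(vbl ` I). \<Sum>e \<in> {e \<in> E. v \<in> vbl e}. ?\<mu> e)"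
  proof -
    let ?V = "\<Union>(vbl ` I)"
    have fV: "finite ?V" using fI finite_vbl by auto
    have "(\<Sum>e \<in> N. ?\<mu> e) \<le> (\<Sum>e \<in> N. \<Sum>v \<in> {v \<in> ?V. v \<in> vbl e}. ?\<mu> e)"
    proof (rule sum_mono)
      fix e assume "e \<in> N"
      then have "{v \<in> ?V. v \<in> vbl e} \<noteq> {}" by (auto simp: N_def)
      moreover have "finite {v \<in> ?V. v \<in> vbl e}" by (rule finite_subset[OF _ fV]) auto
      ultimately have "1 \<le> card {v \<in> ?V. v \<in> vbl e}" using card_gt_0_iff Suc_le_eq by (metis One_nat_def)
      then have "1 * ?\<mu> e \<le> card {v \<in> ?V. v \<in> vbl e} * ?\<mu> e"
        by (intro mult_right_mono) (use p in auto)
      then show "?\<mu> e \<le> (\<Sum>v \<in> {v \<in> ?V. v \<in> vbl e}. ?\<mu> e)" by simp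
    qed
    also have "\<dots> \<le> (\<Sum>e \<in> E. \<Sum>v \<in> {v \<in> ?V. v \<in> vbl e}. ?\<mu> e)"
      by (rule sum_mono2) (use E fN p in auto)
    also have "\<dots> = (\<Sum>v \<in> ?V. \<Sum>e \<in> {e \<in> E. v \<in> vbl e}. ?\<mu> e)"
      by (rule sum.swap_restrict) (use E fV in auto)
    finally show ?thesis .
  qed
  also have "\<dots> \<le> (\<Sum>v \<in> \<Union>(vbl ` I). \<eta>)" by (intro sum_mono sum)
  also have "\<dots> = \<eta> * card (\<Union>(vbl ` I))" by simp
  also have "\<dots> \<le> \<eta> * (\<Sum>e \<in> I. card (vbl e))"
    using card_UN_le[OF fI, of vbl] \<eta> by (intro mult_left_mono) linarith+
  finally have "(\<Sum>W \<in> towers E (Suc d) I. weight p W) \<le>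
      (\<Prod>e \<in> I. p e) * exp (\<eta> * (\<Sum>e \<in> I. card (vbl e)))"
    using p by (auto simp: prod_nonneg mult_left_mono)
  also have "\<dots> = (\<Prod>e \<in> I. ?\<mu> e)"
    using fI by (simp add: prod.distrib sum_distrib_left exp_sum)
  finally show ?case .
qed

text \<open>A finite family of stacks involves finitely many levels and events, so it lies in towers
  over single roots \<open>e\<close> containing \<open>v\<close>. Summing the bound for towers over
  these roots gives the left side of the assumption once more.\<close>

lemma sum_weight_stacks:
  fixes p :: "'e \<Rightarrow> real" and \<eta> :: real
  assumes p: "\<And>e. p e \<ge> 0" and \<eta>: "\<eta> \<ge> 0"
    and sum: "\<And>v E. finite E \<Longrightarrow> (\<And>e. e \<in> E \<Longrightarrow> v \<in> vbl e) \<Longrightarrow>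
      (\<Sum>e \<in> E. p e * exp (\<eta> * card (vbl e))) \<le> \<eta>"
    and F: "finite F" "F \<subseteq> stacks v"
  shows "(\<Sum>W \<in> F. weight p W) \<le> \<eta>"
proof -
  have fin: "finite (\<Union>F)" using F by (auto simp: stacks_def stack_def)
  define E where "E = snd ` \<Union>F"
  have "finite (fst ` \<Union>F)" using fin by auto
  then obtain d where d: "\<And>i. i \<in> fst ` \<Union>F \<Longrightarrow> i \<le> d" unfolding finite_nat_set_iff_bounded_le by auto
  have fE: "finite E" using fin by (auto simp: E_def)
  let ?E = "{e \<in> E. v \<in> vbl e}"
  have sub: "F \<subseteq> (\<Union>e \<in> ?E. towers E d {e})"
  proof
    fix W assume W: "W \<in> F"
    then obtain e where e: "v \<in> vbl e" "{e'. (0, e') \<in> W} = {e}" "stack W" using F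
      by (auto simp: stacks_def)
    have "(0, e) \<in> W" using e by auto
    then have "e \<in> E" using W unfolding E_def by force
    moreover have "W \<subseteq> {..d} \<times> E"
    proof (rule subrelI)
      fix i e' assume "(i, e') \<in> W"
      then have "(i, e') \<in> \<Union>F" using W by auto
      then show "(i, e') \<in> {..d} \<times> E" using d unfolding E_def by force
    qed
    ultimately show "W \<in> (\<Union>e \<in> ?E. towers E d {e})"
      using e unfolding towers_def stack_def by auto
  qed
  have w0: "weight p W \<ge> 0" for W unfolding weight_def using p by (auto intro!: prod_nonneg)
  have "(\<Sum>W \<in> F. weight p W) \<le> (\<Sum>W \<in> (\<Union>e \<in> ?E. towers E d {e}). weight p W)"
    by (rule sum_mono2) (use sub w0 fE finite_towers in auto)
  also have "\<dots> = (\<Sum>e \<in> ?E. \<Sum>W \<in> towers E d {e}. weight p W)"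
    by (rule sum.UNION_disjoint) (use fE finite_towers in \<open>auto simp: towers_def\<close>)
  also have "\<dots> \<le> (\<Sum>e \<in> ?E. \<Prod>e \<in> {e}. p e * exp (\<eta> * card (vbl e)))"
  proof (intro sum_mono sum_weight_towers[OF fE p \<eta>])
    show "(\<Sum>e \<in> {e \<in> E. v \<in> vbl e}. p e * exp (\<eta> * card (vbl e))) \<le> \<eta>" for v
      by (rule sum) (use fE in auto)
  qed auto
  also have "\<dots> = (\<Sum>e \<in> ?E. p e * exp (\<eta> * card (vbl e)))" by simp
  also have "\<dots> \<le> \<eta>" by (rule sum) (auto simp: fE)
  finally show ?thesis .
qed

lemma height_less:
  assumes "finite W" "i < i'" "i' \<in> levels W v"
  shows "height W i' v < height W i v"
  unfolding height_def
  by (rule psubset_card_mono) (use assms finite_levels[of W v] in auto)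

definition valid_set :: "(nat \<times> 'e) set \<Rightarrow> ('v \<times> nat \<Rightarrow> 'a) set" where
  "valid_set W = {x. valid (\<lambda>v i. x (v, i)) W}"

end

section \<open>Witnesses in a random table\<close>

lemma (in event_system) countable_stacks:
  assumes "countable (UNIV :: 'e set)"
  shows "countable (stacks v)"
  by (rule countable_subset[OF _ countable_Collect_finite_subset[of "UNIV :: (nat \<times> 'e) set"]])
    (use assms in \<open>auto simp: stacks_def stack_def simp flip: UNIV_Times_UNIV\<close>)

text \<open>The condition is imposed per variable, and finite sets \<open>E\<close> stand for the
  possibly infinite family of events containing \<open>v\<close>. The same \<eta> will bound the
  expected number of valid witnesses at \<open>v\<close>.\<close>

locale lll_system = event_system vbl bad
  for vbl :: "'e::countable \<Rightarrow> 'v set" and bad :: "'e \<Rightarrow> ('v \<Rightarrow> 'a::countable) \<Rightarrow> bool" +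
  fixes q :: "'a pmf" and p :: "'e \<Rightarrow> real" and \<eta> :: real
  assumes prob_bad: "measure (PiM UNIV (\<lambda>_::'v. measure_pmf q)) {x. bad e x} \<le> p e"
    and \<eta>_nonneg: "\<eta> \<ge> 0"
    and lll_condition: "finite E \<Longrightarrow> (\<And>e. e \<in> E \<Longrightarrow> v \<in> vbl e) \<Longrightarrow>
      (\<Sum>e \<in> E. p e * exp (\<eta> * card (vbl e))) \<le> \<eta>"
begin

text \<open>The events of a stack read pairwise different cells of the table and are therefore
  independent. The cells read by one event form an injective image of its variables, so each factor
  is the probability of the event under the product measure.\<close>

lemma prob_valid_set:
  assumes W: "stack W"
  shows "measure (PiM UNIV (\<lambda>_. measure_pmf q)) (valid_set W) \<le> weight p W"
    and "valid_set W \<in> sets (PiM UNIV (\<lambda>_. measure_pmf q))"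
proof -
  let ?M = "PiM UNIV (\<lambda>_::'v \<times> nat. measure_pmf q)"
  interpret prob_space ?M by (rule prob_space_PiM_pmf)
  define K where "K = (\<lambda>(i, e). (\<lambda>v. (v, height W i v)) ` vbl e)"
  define Y where "Y = (\<lambda>(i, e) x. bad e (\<lambda>v. x (v, height W i v)))"
  have fin: "finite W" using W by (simp add: stack_def)
  have fK: "finite (K k)" for k by (auto simp: K_def finite_vbl split: prod.split)
  have dep: "Y k x = Y k y" if "\<And>j. j \<in> K k \<Longrightarrow> x j = y j" for k x y
    using that unfolding Y_def K_def by (cases k) (auto intro!: bad_cong)
  \<comment> \<open>Two events that share a variable are on different levels, where it has different heights.\<close>
  have disj: "disjoint_family_on K W"
    unfolding disjoint_family_on_def
  proof (intro ballI impI equals0I)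
    fix k k' j assume "k \<in> W" "k' \<in> W" "k \<noteq> k'" "j \<in> K k \<inter> K k'"
    moreover obtain i e i' e' v h where "k = (i, e)" "k' = (i', e')" "j = (v, h)" by (metis surj_pair)
    ultimately have ie: "(i, e) \<in> W" "(i', e') \<in> W" "(i, e) \<noteq> (i', e')"
      "(v, h) \<in> K (i, e)" "(v, h) \<in> K (i', e')" by auto
    then have v: "v \<in> vbl e" "v \<in> vbl e'" "height W i v = height W i' v" by (auto simp: K_def)
    have "i \<in> levels W v" "i' \<in> levels W v" using ie v by (auto intro: levelsI)
    then have "i = i'" using height_less[OF fin, of i i' v] height_less[OF fin, of i' i v] v
      by (metis less_irrefl linorder_neqE_nat)
    then show False using ie v W unfolding stack_def by blast
  qed
  have indep: "indep_vars (\<lambda>_. count_space UNIV) Y W"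
    by (rule indep_vars_blocks[OF fK disj]; (rule dep)?; simp)
  have ev: "{x. Y k x} \<in> events" for k
    by (rule sets_PiM_finite_dependence[OF fK[of k]]; rule dep; simp)
  have valid: "valid_set W = {x \<in> space ?M. \<forall>k \<in> W. Y k x}"
    by (auto simp: valid_set_def valid_def Y_def)
  show "valid_set W \<in> events"
    unfolding valid by (rule sets.sets_Collect_finite_All) (use fin ev in auto)
  show "prob (valid_set W) \<le> weight p W"
  proof (cases "W = {}")
    case True
    then show ?thesis by (simp add: weight_def)
  next
    case False
    have "valid_set W = (\<Inter>k\<in>W. Y k -` {True} \<inter> space ?M)" using False unfolding valid by auto
    then have "prob (valid_set W) = (\<Prod>k\<in>W. prob (Y k -` {True} \<inter> space ?M))"
      using indep_varsD_finite[OF indep False fin, of "\<lambda>_. {True}"] by simp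
    also have "\<dots> \<le> (\<Prod>k\<in>W. p (snd k))"
    proof (intro prod_mono conjI)
      fix k assume "k \<in> W"
      obtain i e where k: "k = (i, e)" by fastforce
      let ?f = "\<lambda>v. (v, height W i v)" and ?N = "PiM UNIV (\<lambda>_::'v. measure_pmf q)"
      have ev: "{x. bad e x} \<in> sets ?N"
        by (rule sets_PiM_finite_dependence[OF finite_vbl[of e]]; rule bad_cong; simp)
      have d: "distr ?M ?N (\<lambda>x v. x (?f v)) = ?N" by (rule distr_PiM_pmf_inj) (auto simp: inj_def)
      have m: "(\<lambda>x v. x (?f v)) \<in> ?M \<rightarrow>\<^sub>M ?N" by (rule measurable_PiM_single') auto
      have "measure ?N {x. bad e x} = prob ((\<lambda>x v. x (?f v)) -` {x. bad e x} \<inter> space ?M)"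
        by (subst (1) d[symmetric], rule measure_distr[OF m ev])
      also have "(\<lambda>x v. x (?f v)) -` {x. bad e x} \<inter> space ?M = Y k -` {True} \<inter> space ?M"
        by (auto simp: Y_def k)
      finally show "prob (Y k -` {True} \<inter> space ?M) \<le> p (snd k)" using prob_bad[of e] k by simp
    qed auto
    finally show ?thesis by (simp add: weight_def case_prod_beta)
  qed
qed

lemma sum_prob_valid:
  assumes "finite F" "F \<subseteq> stacks v"
  shows "(\<Sum>W \<in> F. measure (PiM UNIV (\<lambda>_. measure_pmf q)) (valid_set W)) \<le> \<eta>"
proof -
  have p: "p e \<ge> 0" for e using prob_bad[of e] measure_nonneg order_trans by blast
  have "(\<Sum>W \<in> F. measure (PiM UNIV (\<lambda>_. measure_pmf q)) (valid_set W)) \<le> (\<Sum>W \<in> F. weight p W)"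
    using assms by (intro sum_mono prob_valid_set) (auto simp: stacks_def)
  also have "\<dots> \<le> \<eta>"
    using sum_weight_stacks[OF p \<eta>_nonneg lll_condition assms] .
  finally show ?thesis .
qed

text \<open>The first claim will make the run stop at every variable; the second bounds the
  probability that a variable is resampled at all.\<close>

lemma AE_finite_valid:
  "AE x in PiM UNIV (\<lambda>_. measure_pmf q). finite {W \<in> stacks v. valid (\<lambda>v i. x (v, i)) W}"
  and prob_ex_valid:
  "measure (PiM UNIV (\<lambda>_. measure_pmf q)) {x. \<exists>W \<in> stacks v. valid (\<lambda>v i. x (v, i)) W} \<le> \<eta>"
  and sets_ex_valid:
  "{x. \<exists>W \<in> stacks v. valid (\<lambda>v i. x (v, i)) W} \<in> sets (PiM UNIV (\<lambda>_. measure_pmf q))"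
proof -
  let ?M = "PiM UNIV (\<lambda>_::'v \<times> nat. measure_pmf q)"
  interpret prob_space ?M by (rule prob_space_PiM_pmf)
  have ev: "valid_set W \<in> events" if "W \<in> stacks v" for W
    using that by (intro prob_valid_set) (auto simp: stacks_def)
  have c: "countable (stacks v)" by (rule countable_stacks) auto
  have eq: "{x. \<exists>W \<in> stacks v. valid (\<lambda>v i. x (v, i)) W} = (\<Union>W \<in> stacks v. valid_set W)"
    by (auto simp: valid_set_def)
  show "AE x in ?M. finite {W \<in> stacks v. valid (\<lambda>v i. x (v, i)) W}"
    using AE_finite_events(1)[OF c ev sum_prob_valid] by (simp add: valid_set_def)
  show "prob {x. \<exists>W \<in> stacks v. valid (\<lambda>v i. x (v, i)) W} \<le> \<eta>"
    unfolding eq by (rule AE_finite_events(2)[OF c ev sum_prob_valid])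
  show "{x. \<exists>W \<in> stacks v. valid (\<lambda>v i. x (v, i)) W} \<in> events"
    unfolding eq using c ev by (intro sets.countable_UN') auto
qed

end

section \<open>Digits of a random point\<close>

text \<open>Digits after the point in base \<open>N\<close>, numbered from 0. Reduction modulo
  \<open>N\<close> also assigns digits to the end point 1, namely zeros, which changes the law only
  on a null set.\<close>

definition digit :: "nat \<Rightarrow> nat \<Rightarrow> real \<Rightarrow> nat" where
  "digit N i y = nat (\<lfloor>real N ^ Suc i * y\<rfloor> mod int N)"

lemma measurable_digit [measurable]: "digit N i \<in> borel \<rightarrow>\<^sub>M count_space UNIV"
  unfolding digit_def by measurable

lemma digit_less: "N > 0 \<Longrightarrow> digit N i y < N"
  by (simp add: digit_def nat_less_iff)

lemma digit_0_affine:
  assumes "0 \<le> z" "z < 1" "a < N"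
  shows "digit N 0 ((real a + z) / real N) = a"
proof -
  have "real N * ((real a + z) / real N) = real a + z" using assms by simp
  moreover have "\<lfloor>real a + z\<rfloor> = int a" using assms by linarith
  ultimately show ?thesis using assms by (simp add: digit_def)
qed

lemma digit_Suc_affine:
  assumes "N > 0"
  shows "digit N (Suc i) ((real a + z) / real N) = digit N i z"
proof -
  have "real N ^ Suc (Suc i) * ((real a + z) / real N) = real N ^ Suc i * z + of_int (int (N ^ Suc i * a))"
    using assms by (simp add: field_simps)
  then have "\<lfloor>real N ^ Suc (Suc i) * ((real a + z) / real N)\<rfloor> =
      \<lfloor>real N ^ Suc i * z\<rfloor> + int (N ^ Suc i * a)"
    by (simp only: floor_add_int)
  also have "int (N ^ Suc i * a) = int (N ^ i * a) * int N" by simp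
  finally have "\<lfloor>real N ^ Suc (Suc i) * ((real a + z) / real N)\<rfloor> =
      \<lfloor>real N ^ Suc i * z\<rfloor> + int (N ^ i * a) * int N" .
  then show ?thesis unfolding digit_def by (simp only: mod_mult_self1)
qed

text \<open>Writing \<open>y = (a + z) / N\<close> splits off the first digit \<open>a\<close> and
  leaves the other digits to \<open>z\<close>. So the part with first digit \<open>a\<close> is a
  copy of the set for \<open>z\<close>, shrunk by the factor \<open>N\<close>, and one copy occurs
  for each admissible \<open>a\<close>.\<close>

lemma emeasure_digits:
  assumes N: "N > 0"
  shows "emeasure lborel {y \<in> {0..<1}. \<forall>i<m. digit N i y \<in> A i} =
    (\<Prod>i<m. emeasure (measure_pmf (pmf_of_set {..<N})) (A i))"
proof (induction m arbitrary: A)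
  case 0
  have "{y \<in> {0..<1}. \<forall>i<0. digit N i y \<in> A i} = {0..<1}" for A :: "nat \<Rightarrow> nat set" by auto
  then show ?case by simp
next
  case (Suc m)
  define S where "S = {z \<in> {0..<1}. \<forall>i<m. digit N i z \<in> A (Suc i)}"
  define P where "P a = {y. real N * y - real a \<in> S}" for a :: nat
  have S [measurable]: "S \<in> sets borel" unfolding S_def by measurable
  have P [measurable]: "P a \<in> sets borel" for a unfolding P_def by measurable
  let ?A = "A 0 \<inter> {..<N}"
  have conv: "y = (real a + (real N * y - real a)) / real N" for y :: real and a using N by simp
  have "{y \<in> {0..<1}. \<forall>i<Suc m. digit N i y \<in> A i} = (\<Union>a \<in> ?A. P a)"
  proof (intro equalityI subsetI)
    fix y assume y: "y \<in> {y \<in> {0..<1}. \<forall>i<Suc m. digit N i y \<in> A i}"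
    define a where "a = nat \<lfloor>real N * y\<rfloor>"
    have Ny: "0 \<le> real N * y" "real N * y < real N" using y N by auto
    then have a: "0 \<le> real N * y - real a" "real N * y - real a < 1" "a < N"
      unfolding a_def by (linarith, linarith, simp add: nat_less_iff floor_less_iff)
    have "digit N 0 y = a" using digit_0_affine[OF a] conv[of y a] by simp
    moreover have "digit N (Suc i) y = digit N i (real N * y - real a)" for i
      using digit_Suc_affine[OF N, of i a "real N * y - real a"] conv[of y a] by simp
    moreover have "digit N 0 y \<in> A 0" "\<forall>i<m. digit N (Suc i) y \<in> A (Suc i)" using y by auto
    ultimately show "y \<in> (\<Union>a \<in> ?A. P a)" using a unfolding P_def S_def by auto
  next
    fix y assume "y \<in> (\<Union>a \<in> ?A. P a)"
    then obtain a where a: "a \<in> A 0" "a < N" "real N * y - real a \<in> S" unfolding P_def by auto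
    let ?z = "real N * y - real a"
    have z: "0 \<le> ?z" "?z < 1" "\<forall>i<m. digit N i ?z \<in> A (Suc i)" using a unfolding S_def by auto
    have "digit N i y \<in> A i" if "i < Suc m" for i
    proof (cases i)
      case 0
      then show ?thesis using digit_0_affine[OF z(1,2) a(2)] conv[of y a] a by simp
    next
      case (Suc j)
      then show ?thesis
        using digit_Suc_affine[OF N, of j a ?z] conv[of y a] z(3) that by simp
    qed
    moreover have "0 \<le> y" using z N by (metis add_nonneg_nonneg conv divide_nonneg_nonneg of_nat_0_le_iff)
    moreover have "y < 1"
    proof -
      have "real N * y < real a + 1" using z by simp
      also have "\<dots> \<le> real N" using a by simp
      finally show ?thesis using N by simp
    qed
    ultimately show "y \<in> {y \<in> {0..<1}. \<forall>i<Suc m. digit N i y \<in> A i}" by auto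
  qed
  then have "emeasure lborel {y \<in> {0..<1}. \<forall>i<Suc m. digit N i y \<in> A i} = emeasure lborel (\<Union>a \<in> ?A. P a)"
    by simp
  also have "\<dots> = (\<Sum>a \<in> ?A. emeasure lborel (P a))"
  proof (rule sum_emeasure[symmetric])
    have "a = b" if "real N * y - real a \<in> S" "real N * y - real b \<in> S" for y a b
      using that unfolding S_def by auto
    then show "disjoint_family_on P ?A" unfolding disjoint_family_on_def P_def by blast
  qed auto
  also have "\<dots> = (\<Sum>a \<in> ?A. ennreal (1 / N) * emeasure lborel S)"
  proof (rule sum.cong[OF refl])
    fix a
    have "emeasure lborel (P a) = (\<integral>\<^sup>+ y. indicator (P a) y \<partial>lborel)" by simp
    also have "\<dots> = ennreal \<bar>1 / N\<bar> * (\<integral>\<^sup>+ z. indicator (P a) (a / N + 1 / N * z) \<partial>lborel)"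
      by (rule nn_integral_real_affine) (use N in auto)
    also have "(\<lambda>z. indicator (P a) (a / N + 1 / N * z) :: ennreal) = indicator S"
      using N by (auto simp: P_def indicator_def fun_eq_iff field_simps)
    finally show "emeasure lborel (P a) = ennreal (1 / N) * emeasure lborel S" by simp
  qed
  also have "\<dots> = ennreal (card ?A / N) * emeasure lborel S"
    by (simp add: ennreal_of_nat_eq_real_of_nat mult.assoc[symmetric] ennreal_mult[symmetric])
  also have "ennreal (card ?A / N) = emeasure (measure_pmf (pmf_of_set {..<N})) (A 0)"
    using N by (subst emeasure_pmf_of_set) (auto simp: Int_commute lessThan_empty_iff)
  also have "emeasure lborel S = (\<Prod>i<m. emeasure (measure_pmf (pmf_of_set {..<N})) (A (Suc i)))"
    unfolding S_def by (rule Suc.IH)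
  finally show ?case by (simp only: prod.lessThan_Suc_shift)
qed

section \<open>The law of the digits of a point of \<open>Omega\<close>\<close>

abbreviation unit_interval :: "real measure" where
  "unit_interval \<equiv> restrict_space lborel {0..1}"

lemma prob_space_unit_interval: "prob_space unit_interval"
  by (rule prob_spaceI) (simp add: space_restrict_space emeasure_restrict_space)

lemma prob_space_Omega: "prob_space Omega"
  unfolding Omega_def by (intro prob_space_PiM prob_space_unit_interval)

lemma measurable_Omega_component [measurable]: "(\<lambda>x. x \<gamma>) \<in> Omega \<rightarrow>\<^sub>M borel"
proof -
  have "(\<lambda>x. x \<gamma>) \<in> Omega \<rightarrow>\<^sub>M unit_interval"
    unfolding Omega_def by (rule measurable_component_singleton) simp
  then show ?thesis by (simp add: measurable_restrict_space2_iff)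
qed

definition table :: "nat \<Rightarrow> ('g \<Rightarrow> real) \<Rightarrow> 'g \<times> nat \<Rightarrow> nat" where
  "table N x = (\<lambda>(\<gamma>, i). digit N i (x \<gamma>))"

lemma measurable_table:
  "table N \<in> Omega \<rightarrow>\<^sub>M PiM UNIV (\<lambda>_. measure_pmf q)"
proof (rule measurable_PiM_single')
  fix j :: "'a \<times> nat"
  have "(\<lambda>x. table N x j) \<in> Omega \<rightarrow>\<^sub>M count_space UNIV" unfolding table_def case_prod_beta by measurable
  then show "(\<lambda>x. table N x j) \<in> Omega \<rightarrow>\<^sub>M measure_pmf q" by simp
qed auto

text \<open>The measures are compared on cylinders. Rows belong to different coordinates of the
  product, and within a row the digits are handled by \<open>emeasure_digits\<close>.\<close>

lemma distr_table:
  assumes N: "N > 0"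
  shows "distr Omega (PiM UNIV (\<lambda>_. measure_pmf (pmf_of_set {..<N}))) (table N) =
    PiM UNIV (\<lambda>_::'g \<times> nat. measure_pmf (pmf_of_set {..<N}))"
proof -
  let ?q = "pmf_of_set {..<N}" and ?U = "\<lambda>_::'g. unit_interval"
  let ?P = "PiM UNIV (\<lambda>_::'g \<times> nat. measure_pmf ?q)"
  interpret prob_space "Omega :: ('g \<Rightarrow> real) measure" by (rule prob_space_Omega)
  interpret P: product_prob_space "\<lambda>_::'g \<times> nat. measure_pmf ?q" UNIV
    by unfold_locales
  interpret U: product_prob_space ?U UNIV
    by (intro product_prob_spaceI prob_space_unit_interval)
  show ?thesis
  proof (rule measure_eqI_PiM_infinite)
    show "finite_measure (distr Omega ?P (table N))"
      by (intro prob_space.finite_measure prob_space_distr measurable_table)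
  next
    fix A :: "'g \<times> nat \<Rightarrow> nat set" and J :: "('g \<times> nat) set"
    assume J: "finite J"
    define G where "G = fst ` J"
    obtain m where m: "\<And>i. i \<in> snd ` J \<Longrightarrow> i < m"
      using J finite_nat_set_iff_bounded by (meson finite_imageI)
    \<comment> \<open>Unconstrained cells are padded with \<open>UNIV\<close>, so that the
      constraint lives on the full rectangle of rows in \<open>G\<close> and digits below
      \<open>m\<close>.\<close>
    define A' where "A' j = (if j \<in> J then A j else UNIV)" for j
    define B where "B \<gamma> = {y \<in> {0..1}. \<forall>i<m. digit N i y \<in> A' (\<gamma>, i)}" for \<gamma>
    have fG: "finite G" using J by (simp add: G_def)
    have sub: "J \<subseteq> G \<times> {..<m}" unfolding G_def using m by force
    have B [measurable]: "B \<gamma> \<in> sets borel" for \<gamma> unfolding B_def by measurable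
    have "emeasure unit_interval (B \<gamma>) = (\<Prod>i<m. emeasure (measure_pmf ?q) (A' (\<gamma>, i)))" for \<gamma>
    proof -
      have "emeasure unit_interval (B \<gamma>) = emeasure lborel (B \<gamma>)"
        by (rule emeasure_restrict_space) (auto simp: B_def)
      also have "\<dots> = emeasure lborel {y \<in> {0..<1}. \<forall>i<m. digit N i y \<in> A' (\<gamma>, i)}"
      proof (rule emeasure_eq_AE)
        have "AE y in lborel. y \<noteq> (1::real)" by (rule AE_lborel_singleton)
        then show "AE y in lborel. (y \<in> B \<gamma>) = (y \<in> {y \<in> {0..<1}. \<forall>i<m. digit N i y \<in> A' (\<gamma>, i)})"
          by (rule eventually_mono) (auto simp: B_def)
      qed auto
      finally show ?thesis using emeasure_digits[OF N] by simp
    qed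
    note B_eq = this
    have "table N -` prod_emb UNIV (\<lambda>_. measure_pmf ?q) J (Pi\<^sub>E J A) \<inter> space Omega =
        prod_emb UNIV ?U G (Pi\<^sub>E G B)"
    proof (intro set_eqI)
      fix x :: "'g \<Rightarrow> real"
      have "(\<forall>j \<in> J. table N x j \<in> A j) \<longleftrightarrow> (\<forall>\<gamma> \<in> G. \<forall>i<m. digit N i (x \<gamma>) \<in> A' (\<gamma>, i))"
        using sub unfolding A'_def table_def by (force split: prod.splits)
      then show "x \<in> table N -` prod_emb UNIV (\<lambda>_. measure_pmf ?q) J (Pi\<^sub>E J A) \<inter> space Omega \<longleftrightarrow>
          x \<in> prod_emb UNIV ?U G (Pi\<^sub>E G B)"
        by (auto simp: prod_emb_def B_def space_Omega space_restrict_space PiE_iff Ball_def)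
    qed
    then have "emeasure (distr Omega ?P (table N)) (prod_emb UNIV (\<lambda>_. measure_pmf ?q) J (Pi\<^sub>E J A)) =
        emeasure Omega (prod_emb UNIV ?U G (Pi\<^sub>E G B))"
      by (subst emeasure_distr[OF measurable_table]) (use J in \<open>auto intro!: sets_PiM_I\<close>)
    also have "\<dots> = (\<Prod>\<gamma> \<in> G. emeasure unit_interval (B \<gamma>))"
      unfolding Omega_def by (rule U.emeasure_PiM_emb) (use fG in \<open>auto simp: sets_restrict_space B_def intro!: image_eqI[OF _ B]\<close>)
    also have "\<dots> = (\<Prod>j \<in> G \<times> {..<m}. emeasure (measure_pmf ?q) (A' j))"
      unfolding B_eq by (subst prod.cartesian_product) (simp add: case_prod_beta)
    also have "\<dots> = (\<Prod>j \<in> J. emeasure (measure_pmf ?q) (A j))"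
      by (rule prod.mono_neutral_cong_right) (use fG sub in \<open>auto simp: A'_def\<close>)
    also have "\<dots> = emeasure ?P (prod_emb UNIV (\<lambda>_. measure_pmf ?q) J (Pi\<^sub>E J A))"
      by (rule P.emeasure_PiM_emb[symmetric]) (use J in auto)
    finally show "emeasure (distr Omega ?P (table N)) (prod_emb UNIV (\<lambda>_. measure_pmf ?q) J (Pi\<^sub>E J A)) =
        emeasure ?P (prod_emb UNIV (\<lambda>_. measure_pmf ?q) J (Pi\<^sub>E J A))" .
  qed auto
qed

definition first_digits :: "nat \<Rightarrow> ('g \<Rightarrow> real) \<Rightarrow> 'g \<Rightarrow> nat" where
  "first_digits N x = (\<lambda>\<gamma>. digit N 0 (x \<gamma>))"

lemma measurable_first_digits:
  "first_digits N \<in> Omega \<rightarrow>\<^sub>M PiM UNIV (\<lambda>_. measure_pmf q)"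
proof (rule measurable_PiM_single')
  fix j :: 'a
  have "(\<lambda>x. first_digits N x j) \<in> Omega \<rightarrow>\<^sub>M count_space UNIV" unfolding first_digits_def by measurable
  then show "(\<lambda>x. first_digits N x j) \<in> Omega \<rightarrow>\<^sub>M measure_pmf q" by simp
qed auto

lemma distr_first_digits:
  assumes N: "N > 0"
  shows "distr Omega (PiM UNIV (\<lambda>_. measure_pmf (pmf_of_set {..<N}))) (first_digits N) =
    PiM UNIV (\<lambda>_::'g. measure_pmf (pmf_of_set {..<N}))"
proof -
  let ?P = "PiM UNIV (\<lambda>_. measure_pmf (pmf_of_set {..<N}))"
  have inj: "inj (\<lambda>\<gamma>::'g. (\<gamma>, 0::nat))" by (auto simp: inj_def)
  have "distr (distr Omega ?P (table N)) ?P (\<lambda>x (\<gamma>::'g). x (\<gamma>, 0::nat)) = distr Omega ?P (first_digits N)"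
    by (subst distr_distr) (auto simp: comp_def table_def first_digits_def[abs_def] intro!: measurable_table measurable_PiM_single')
  then show ?thesis unfolding distr_table[OF N] distr_PiM_pmf_inj[OF inj] by simp
qed

text \<open>Equal coordinates have equal first digits in every base, which has probability
  \<open>1 / (n + 1)\<close> in base \<open>n + 1\<close>. Distinct coordinates are what allows a
  schedule to tell group elements apart.\<close>

lemma AE_Omega_neq:
  assumes "\<gamma> \<noteq> \<delta>"
  shows "AE x in Omega. x \<gamma> \<noteq> x \<delta>"
proof -
  interpret prob_space "Omega :: ('a \<Rightarrow> real) measure" by (rule prob_space_Omega)
  let ?E = "{x \<in> space Omega. x \<gamma> = x \<delta>}"
  have E [measurable]: "?E \<in> events" by measurable
  have "prob ?E \<le> 1 / real (Suc n)" for n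
  proof -
    let ?N = "Suc n"
    let ?q = "pmf_of_set {..<?N}"
    let ?P = "PiM UNIV (\<lambda>_::'a. measure_pmf ?q)"
    interpret P: product_prob_space "\<lambda>_::'a. measure_pmf ?q" UNIV by unfold_locales
    let ?D = "\<lambda>d. {a \<in> space ?P. \<forall>i\<in>{\<gamma>, \<delta>}. a i \<in> {d}}"
    have D: "?D d \<in> sets ?P" for d
      using sets_PiM_finite_dependence[of "{\<gamma>, \<delta>}" "\<lambda>a. \<forall>i\<in>{\<gamma>, \<delta>}. a i \<in> {d}"] by simp
    have m: "P.prob (?D d) = 1 / real ?N * (1 / real ?N)" if "d < ?N" for d
    proof -
      have "emeasure ?P (?D d) = (\<Prod>i\<in>{\<gamma>, \<delta>}. emeasure (measure_pmf ?q) {d})"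
        by (rule P.emeasure_PiM_Collect) auto
      also have "\<dots> = ennreal (1 / real ?N * (1 / real ?N))"
        using assms that by (simp add: emeasure_pmf_single ennreal_mult' pmf_of_set lessThan_empty_iff flip: ennreal_mult)
      finally show ?thesis by (rule measure_eq_emeasure_eq_ennreal[rotated]) simp
    qed
    have "prob ?E \<le> prob (first_digits ?N -` (\<Union>d<?N. ?D d) \<inter> space Omega)"
    proof (rule finite_measure_mono)
      show "?E \<subseteq> first_digits ?N -` (\<Union>d<?N. ?D d) \<inter> space Omega"
        using digit_less[of ?N] by (auto simp: first_digits_def)
      show "first_digits ?N -` (\<Union>d<?N. ?D d) \<inter> space Omega \<in> events"
        by (rule measurable_sets[OF measurable_first_digits]) (use D in auto)
    qed
    also have "\<dots> = P.prob (\<Union>d<?N. ?D d)"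
      by (subst (2) distr_first_digits[of ?N, symmetric], simp, rule measure_distr[symmetric, OF measurable_first_digits])
        (use D in auto)
    also have "\<dots> \<le> (\<Sum>d<?N. P.prob (?D d))"
      by (rule P.finite_measure_subadditive_finite) (use D in auto)
    also have "\<dots> = (\<Sum>d<?N. 1 / real ?N * (1 / real ?N))" by (rule sum.cong) (use m in auto)
    also have "\<dots> = 1 / real ?N" by simp
    finally show ?thesis .
  qed
  then have "\<not> 0 < prob ?E" using reals_Archimedean[of "prob ?E"] by (auto simp: inverse_eq_divide leD)
  then have "prob ?E = 0" by (simp add: zero_less_measure_iff)
  then show ?thesis
    using AE_iff_measurable[OF E, of "\<lambda>x. x \<gamma> \<noteq> x \<delta>"] by (simp add: emeasure_eq_measure)
qed

section \<open>Concentration of orbit averages\<close>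

lemma greedy_colouring:
  assumes "finite D" and sym: "symp R"
    and deg: "\<And>x. x \<in> D \<Longrightarrow> card {y \<in> D. R x y} < m"
  shows "\<exists>col :: 'a \<Rightarrow> nat. col ` D \<subseteq> {..<m} \<and>
    (\<forall>x \<in> D. \<forall>y \<in> D. x \<noteq> y \<longrightarrow> R x y \<longrightarrow> col x \<noteq> col y)"
  using assms(1,3)
proof (induction D rule: finite_induct)
  case (insert x D)
  have deg': "card {z \<in> D. R y z} < m" if "y \<in> insert x D" for y
  proof -
    have "card {z \<in> D. R y z} \<le> card {z \<in> insert x D. R y z}"
      by (rule card_mono) (use insert.hyps in auto)
    then show ?thesis using insert.prems[OF that] by simp
  qed
  have "\<exists>col. col ` D \<subseteq> {..<m} \<and> (\<forall>x \<in> D. \<forall>y \<in> D. x \<noteq> y \<longrightarrow> R x y \<longrightarrow> col x \<noteq> col y)"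
    by (rule insert.IH) (use deg' in simp)
  then obtain col where col: "col ` D \<subseteq> {..<m}"
      "\<forall>x \<in> D. \<forall>y \<in> D. x \<noteq> y \<longrightarrow> R x y \<longrightarrow> col x \<noteq> col y"
    by (elim exE conjE) (rule that)
  have "card (col ` {y \<in> D. R x y}) < card {..<m}"
    using card_image_le[of "{y \<in> D. R x y}" col] deg'[of x] insert.hyps by simp
  then have "\<not> {..<m} \<subseteq> col ` {y \<in> D. R x y}"
    using card_mono[of "col ` {y \<in> D. R x y}" "{..<m}"] insert.hyps by auto
  then obtain c where c: "c < m" "c \<notin> col ` {y \<in> D. R x y}" by auto
  show ?case
  proof (intro exI[of _ "col(x := c)"] conjI ballI impI)
    show "(col(x := c)) ` insert x D \<subseteq> {..<m}" using col(1) c(1) by (auto simp: image_subset_iff)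
    fix y z assume yz: "y \<in> insert x D" "z \<in> insert x D" "y \<noteq> z" "R y z"
    have "R z y" by (rule sympD[OF sym yz(4)])
    have c': "col u \<noteq> c" if "u \<in> D" "R x u" for u using c(2) that by blast
    show "(col(x := c)) y \<noteq> (col(x := c)) z"
    proof (cases "y = x"; cases "z = x")
      assume "y = x" "z \<noteq> x"
      then show ?thesis using yz c'[of z] by simp
    next
      assume "y \<noteq> x" "z = x"
      then show ?thesis using yz \<open>R z y\<close> c'[of y] by simp
    next
      assume "y \<noteq> x" "z \<noteq> x"
      then show ?thesis using yz col(2) by simp
    qed (use yz in simp)
  qed
qed simp

lemma shift_shift: "shift \<gamma> (shift \<delta> x) = shift (\<gamma> + \<delta>) x"
  by (simp add: shift_def add.assoc)

lemma inj_add_right: "inj (\<lambda>\<eta>::'g::group_add. \<eta> + \<delta>)"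
  by (auto simp: inj_def)

lemma measurable_shift: "shift \<delta> \<in> PiM UNIV (\<lambda>_. M) \<rightarrow>\<^sub>M PiM UNIV (\<lambda>_. M)"
  unfolding shift_def by (rule measurable_PiM_single') (auto simp: space_PiM intro: measurable_component_singleton)

lemma distr_shift:
  "distr (PiM UNIV (\<lambda>_::'g::group_add. measure_pmf q)) (PiM UNIV (\<lambda>_. measure_pmf q)) (shift \<delta>) =
    PiM UNIV (\<lambda>_. measure_pmf q)"
  using distr_PiM_pmf_inj[OF inj_add_right, of q \<delta>] by (simp add: shift_def[abs_def])

text \<open>Greedy colouring splits \<open>D\<close> into boundedly many classes in each of which the translates of \<open>Q\<close> are
  disjoint, so that Hoeffding's inequality applies to each class.\<close>

lemma concentration:
  fixes q :: "'a::countable pmf" and \<psi> :: "('g::group_add \<Rightarrow> 'a) \<Rightarrow> real"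
  assumes Q: "finite Q" and dep: "\<And>x y. (\<And>i. i \<in> Q \<Longrightarrow> x i = y i) \<Longrightarrow> \<psi> x = \<psi> y"
    and bnd: "\<And>x. \<bar>\<psi> x\<bar> \<le> B" and r: "r > 0"
  defines "M \<equiv> PiM UNIV (\<lambda>_. measure_pmf q)"
  shows "\<exists>b c::real. c > 0 \<and> (\<forall>D. finite D \<longrightarrow> D \<noteq> {} \<longrightarrow>
    measure M {x. r \<le> \<bar>(\<Sum>\<delta>\<in>D. \<psi> (shift \<delta> x)) / card D - (\<integral>x. \<psi> x \<partial>M)\<bar>} \<le>
      b * exp (- c * card D))"
proof -
  interpret prob_space M unfolding M_def by (rule prob_space_PiM_pmf)
  have [simp]: "space M = UNIV" by (simp add: M_def)
  define \<mu> where "\<mu> = (\<integral>x. \<psi> x \<partial>M)"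
  \<comment> \<open>If the translates by \<delta> and \<open>\<delta>'\<close> meet, then
    \<open>\<delta>' = - b + a + \<delta>\<close> with \<open>a\<close> and \<open>b\<close> in
    \<open>Q\<close>. So all degrees are at most \<open>card Q * card Q\<close>, and one more colour
    suffices.\<close>
  define m where "m = card Q * card Q + 1"
  \<comment> \<open>\<open>B\<close> may be 0, but the bound appears in denominators below.\<close>
  define B' where "B' = B + 1"
  have B': "B' > 0" "\<bar>\<psi> x\<bar> \<le> B'" for x using bnd[of x] by (auto simp: B'_def)
  \<comment> \<open>Hoeffding's exponent for a class is
    \<open>2 * (r * card D / m)^2 / (card (E j) * 4 * B'^2)\<close>, which is at least
    \<open>c * card D\<close> because \<open>card (E j) \<le> card D\<close>.\<close>
  define c where "c = r\<^sup>2 / (2 * (real m)\<^sup>2 * B'\<^sup>2)"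
  have m: "m > 0" by (simp add: m_def)
  have c: "c > 0" using r m B' by (simp add: c_def)
  define R where "R \<delta> \<delta>' \<longleftrightarrow> (\<lambda>a. a + \<delta>) ` Q \<inter> (\<lambda>a. a + \<delta>') ` Q \<noteq> {}" for \<delta> \<delta>'
  have "measure M {x. r \<le> \<bar>(\<Sum>\<delta>\<in>D. \<psi> (shift \<delta> x)) / card D - \<mu>\<bar>} \<le> (real m * 2) * exp (- c * card D)"
    if D: "finite D" "D \<noteq> {}" for D
  proof -
    have cD: "real (card D) > 0" using D by (simp add: card_gt_0_iff)
    define X where "X \<delta> x = \<psi> (shift \<delta> x)" for \<delta> x
    have X_dep: "X \<delta> x = X \<delta> y" if "\<And>j. j \<in> (\<lambda>a. a + \<delta>) ` Q \<Longrightarrow> x j = y j" for \<delta> x y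
      unfolding X_def using that by (intro dep) (auto simp: shift_def)
    have X_meas: "X \<delta> \<in> borel_measurable M" for \<delta>
      unfolding M_def
      by (rule measurable_PiM_finite_dependence[of "(\<lambda>a. a + \<delta>) ` Q"]; (rule X_dep)?; simp add: Q)
    have \<psi>_meas: "\<psi> \<in> borel_measurable M"
      unfolding M_def by (rule measurable_PiM_finite_dependence[of Q]; (rule dep)?; simp add: Q)
    have EX: "expectation (X \<delta>) = \<mu>" for \<delta>
    proof -
      have "\<mu> = (\<integral>x. \<psi> x \<partial>distr M M (shift \<delta>))"
        unfolding \<mu>_def M_def distr_shift ..
      also have "\<dots> = (\<integral>x. \<psi> (shift \<delta> x) \<partial>M)"
        by (rule integral_distr) (use \<psi>_meas in \<open>simp_all add: M_def measurable_shift\<close>)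
      finally show ?thesis by (simp add: X_def[abs_def])
    qed
    have deg: "card {y \<in> D. R x y} < m" for x
    proof -
      have "{y \<in> D. R x y} \<subseteq> (\<lambda>(a, b). - b + a + x) ` (Q \<times> Q)"
      proof
        fix y assume "y \<in> {y \<in> D. R x y}"
        then obtain a b where "a \<in> Q" "b \<in> Q" "a + x = b + y" unfolding R_def by auto
        then have "y = - b + a + x" by (metis add.assoc add.left_neutral left_minus)
        then show "y \<in> (\<lambda>(a, b). - b + a + x) ` (Q \<times> Q)" using \<open>a \<in> Q\<close> \<open>b \<in> Q\<close> by auto
      qed
      then have "card {y \<in> D. R x y} \<le> card (Q \<times> Q)" by (rule surj_card_le[rotated]) (use Q in simp)
      then show ?thesis by (simp add: m_def card_cartesian_product)
    qed
    have sym: "symp R" unfolding R_def symp_def by blast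
    obtain col where col: "col ` D \<subseteq> {..<m}"
        "\<forall>x \<in> D. \<forall>y \<in> D. x \<noteq> y \<longrightarrow> R x y \<longrightarrow> col x \<noteq> col y"
      using greedy_colouring[of D R m, OF D(1) sym deg] by (elim exE conjE) (rule that)
    define E where "E j = {\<delta> \<in> D. col \<delta> = j}" for j :: nat
    have fE: "finite (E j)" for j using D by (simp add: E_def)
    \<comment> \<open>If the average over \<open>D\<close> is off by \<open>r\<close>, one of the
      \<open>m\<close> classes takes an \<open>m\<close>-th share of the deviation. The threshold is
      relative to \<open>card D\<close> rather than \<open>card (E j)\<close>, so small classes
      satisfy the same bound.\<close>
    define \<Delta> where "\<Delta> j = {x. r * card D / m \<le> \<bar>(\<Sum>\<delta>\<in>E j. X \<delta> x) - card (E j) * \<mu>\<bar>}" for j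
    have \<Delta>: "\<Delta> j \<in> events" for j
    proof -
      have "\<Delta> j = {x \<in> space M. r * card D / m \<le> \<bar>(\<Sum>\<delta>\<in>E j. X \<delta> x) - card (E j) * \<mu>\<bar>}"
        by (simp add: \<Delta>_def)
      also have "\<dots> \<in> events" using X_meas by measurable
      finally show ?thesis .
    qed
    have prob_\<Delta>: "prob (\<Delta> j) \<le> 2 * exp (- c * card D)" for j
    proof (cases "E j = {}")
      case True
      have "r * card D / m > 0" using r m cD by simp
      then have "\<Delta> j = {}" using True by (auto simp: \<Delta>_def)
      then show ?thesis by simp
    next
      case False
      have indep: "indep_vars (\<lambda>_. borel) X (E j)"
        unfolding M_def
      proof (rule indep_vars_blocks[of _ "\<lambda>\<delta>. (\<lambda>a. a + \<delta>) ` Q"])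
        show "disjoint_family_on (\<lambda>\<delta>. (\<lambda>a. a + \<delta>) ` Q) (E j)"
          unfolding disjoint_family_on_def
        proof (intro ballI impI)
          fix x y assume "x \<in> E j" "y \<in> E j" "x \<noteq> y"
          then have "x \<in> D" "y \<in> D" "col x = col y" "x \<noteq> y" by (auto simp: E_def)
          then have "\<not> R x y" using col(2) by blast
          then show "(\<lambda>a. a + x) ` Q \<inter> (\<lambda>a. a + y) ` Q = {}" by (simp add: R_def)
        qed
      qed (use Q in simp, rule X_dep, simp, simp)
      interpret H: Hoeffding_ineq M "E j" X "\<lambda>_. - B'" "\<lambda>_. B'" "card (E j) * \<mu>"
      proof unfold_locales
        show "AE x in M. X i x \<in> {- B'..B'}" for i
          using B'(2) by (auto simp: X_def abs_le_iff minus_le_iff)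
      qed (use fE indep in \<open>simp_all add: EX\<close>)
      have cE: "0 < real (card (E j))" "real (card (E j)) \<le> card D"
        using False fE D by (auto simp: card_gt_0_iff E_def intro: card_mono)
      have s: "(\<Sum>i\<in>E j. (B' - - B')\<^sup>2) = card (E j) * (4 * B'\<^sup>2)"
        by (simp add: power2_eq_square)
      have "prob (\<Delta> j) \<le> 2 * exp (- 2 * (r * card D / m)\<^sup>2 / (card (E j) * (4 * B'\<^sup>2)))"
        using H.Hoeffding_ineq_abs_ge[of "r * card D / m"] r cE B' unfolding s \<Delta>_def by simp
      also have "c * card D \<le> 2 * (r * card D / m)\<^sup>2 / (card (E j) * (4 * B'\<^sup>2))"
      proof -
        have "c * card D = 2 * (r * card D / m)\<^sup>2 / (card D * (4 * B'\<^sup>2))"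
          using m B'(1) cD by (simp add: c_def field_simps power2_eq_square)
        also have "\<dots> \<le> 2 * (r * card D / m)\<^sup>2 / (card (E j) * (4 * B'\<^sup>2))"
          by (rule divide_left_mono) (use cE cD B'(1) in \<open>auto intro!: mult_right_mono mult_pos_pos\<close>)
        finally show ?thesis .
      qed
      then have "2 * exp (- 2 * (r * card D / m)\<^sup>2 / (card (E j) * (4 * B'\<^sup>2))) \<le> 2 * exp (- c * card D)"
        by simp
      finally show ?thesis .
    qed
    have "{x. r \<le> \<bar>(\<Sum>\<delta>\<in>D. \<psi> (shift \<delta> x)) / card D - \<mu>\<bar>} \<subseteq> (\<Union>j<m. \<Delta> j)"
    proof
      fix x assume x: "x \<in> {x. r \<le> \<bar>(\<Sum>\<delta>\<in>D. \<psi> (shift \<delta> x)) / card D - \<mu>\<bar>}"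
      show "x \<in> (\<Union>j<m. \<Delta> j)"
      proof (rule ccontr)
        assume "x \<notin> (\<Union>j<m. \<Delta> j)"
        then have small: "\<bar>(\<Sum>\<delta>\<in>E j. X \<delta> x) - card (E j) * \<mu>\<bar> < r * card D / m" if "j < m" for j
          using that by (auto simp: \<Delta>_def not_le)
        have "(\<Sum>\<delta>\<in>D. X \<delta> x - \<mu>) = (\<Sum>j<m. \<Sum>\<delta>\<in>E j. X \<delta> x - \<mu>)"
          unfolding E_def by (rule sum.group[symmetric]) (use D col in auto)
        then have "\<bar>\<Sum>\<delta>\<in>D. X \<delta> x - \<mu>\<bar> \<le> (\<Sum>j<m. \<bar>\<Sum>\<delta>\<in>E j. X \<delta> x - \<mu>\<bar>)"
          by simp
        also have "\<dots> < (\<Sum>j<m. r * card D / m)"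
          by (rule sum_strict_mono) (use small m in \<open>auto simp: sum_subtractf lessThan_empty_iff\<close>)
        also have "\<dots> = r * card D" using m by simp
        finally have "\<bar>(\<Sum>\<delta>\<in>D. X \<delta> x) - card D * \<mu>\<bar> < r * card D" by (simp add: sum_subtractf)
        moreover have "(\<Sum>\<delta>\<in>D. X \<delta> x) / card D - \<mu> = ((\<Sum>\<delta>\<in>D. X \<delta> x) - card D * \<mu>) / card D"
          using cD by (simp add: field_simps)
        ultimately have "\<bar>(\<Sum>\<delta>\<in>D. X \<delta> x) / card D - \<mu>\<bar> < r"
          using cD by (simp add: abs_divide divide_less_eq)
        then show False using x by (simp add: X_def)
      qed
    qed
    then have "prob {x. r \<le> \<bar>(\<Sum>\<delta>\<in>D. \<psi> (shift \<delta> x)) / card D - \<mu>\<bar>} \<le> prob (\<Union>j<m. \<Delta> j)"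
      by (rule finite_measure_mono) (use \<Delta> in auto)
    also have "\<dots> \<le> (\<Sum>j<m. prob (\<Delta> j))"
      by (rule finite_measure_subadditive_finite) (use \<Delta> in auto)
    also have "\<dots> \<le> (\<Sum>j<m. 2 * exp (- c * card D))" by (rule sum_mono) (rule prob_\<Delta>)
    finally show ?thesis by simp
  qed
  then show ?thesis using c unfolding \<mu>_def by (intro exI[of _ "real m * 2"] exI[of _ c]) auto
qed

section \<open>Approximation by finitely many digits\<close>

text \<open>Powers of two are ordered by refinement, so finitely many approximations reach a common
  base by taking the maximal exponent.\<close>

lemma digit_refine: "digit (2 ^ k) 0 y = digit (2 ^ (k + j)) 0 y div 2 ^ j"
proof -
  have "\<lfloor>2 ^ k * y\<rfloor> = \<lfloor>2 ^ (k + j) * y / of_int (2 ^ j)\<rfloor>"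
    by (simp add: power_add)
  also have "\<dots> = \<lfloor>2 ^ (k + j) * y\<rfloor> div 2 ^ j" by (rule floor_divide_real_eq_div) simp
  finally have "\<lfloor>2 ^ k * y\<rfloor> mod 2 ^ k = (\<lfloor>2 ^ (k + j) * y\<rfloor> mod 2 ^ (k + j)) div 2 ^ j"
    using zmod_zmult2_eq[of "2 ^ k" "\<lfloor>2 ^ (k + j) * y\<rfloor>" "2 ^ j"]
    by (simp add: power_add mult.commute)
  then show ?thesis by (simp add: digit_def nat_div_distrib nat_power_eq)
qed

definition approximable_at :: "nat \<Rightarrow> ('g \<Rightarrow> real) set \<Rightarrow> real \<Rightarrow> bool" where
  "approximable_at k A e \<longleftrightarrow> (\<exists>S P. finite S \<and> (\<forall>a b. (\<forall>i \<in> S. a i = b i) \<longrightarrow> P a = P b) \<and>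
     measure Omega {x \<in> space Omega. (x \<in> A) \<noteq> P (first_digits (2 ^ k) x)} < e)"

lemma approximable_at_mono:
  assumes "approximable_at k A e" "k \<le> k'"
  shows "approximable_at k' A e"
proof -
  obtain S P where S: "finite S" "\<And>a b. (\<forall>i \<in> S. a i = b i) \<Longrightarrow> P a = P b"
     "measure Omega {x \<in> space Omega. (x \<in> A) \<noteq> P (first_digits (2 ^ k) x)} < e"
    using assms(1) unfolding approximable_at_def by blast
  obtain j where j: "k' = k + j" using assms(2) le_Suc_ex by blast
  have eq: "first_digits (2 ^ k) x = (\<lambda>\<gamma>. first_digits (2 ^ k') x \<gamma> div 2 ^ j)" for x :: "'a \<Rightarrow> real"
    unfolding first_digits_def j by (rule ext) (rule digit_refine)
  show ?thesis
    unfolding approximable_at_def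
    by (intro exI[of _ S] exI[of _ "\<lambda>a. P (\<lambda>\<gamma>. a \<gamma> div 2 ^ j)"])
      (use S in \<open>auto simp: eq intro!: S(2)\<close>)
qed

lemma sets_first_digits_dependence:
  assumes "finite S" "\<And>a b. (\<forall>i \<in> S. a i = b i) \<Longrightarrow> P a = P b"
  shows "{x \<in> space Omega. P (first_digits N x)} \<in> sets Omega"
proof -
  \<comment> \<open>Only the product sigma-algebra matters here, so an arbitrary pmf is
    inserted.\<close>
  have "{a. P a} \<in> sets (PiM UNIV (\<lambda>_. measure_pmf (return_pmf 0)))"
    by (rule sets_PiM_finite_dependence[OF assms(1)]) (use assms(2) in simp)
  from measurable_sets[OF measurable_first_digits this] show ?thesis
    by (simp add: vimage_def Int_def conj_commute)
qed

lemma sets_mismatch: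
  assumes "finite S" "\<And>a b. (\<forall>i \<in> S. a i = b i) \<Longrightarrow> P a = P b" "A \<in> sets Omega"
  shows "{x \<in> space Omega. (x \<in> A) \<noteq> P (first_digits N x)} \<in> sets Omega"
proof -
  have "{x \<in> space Omega. (x \<in> A) \<noteq> P (first_digits N x)} =
      (A - {x \<in> space Omega. P (first_digits N x)}) \<union> ({x \<in> space Omega. P (first_digits N x)} - A)"
    using sets.sets_into_space[OF assms(3)] by auto
  then show ?thesis using sets_first_digits_dependence[OF assms(1,2)] assms(3) by auto
qed

lemma approximable_at_Un:
  assumes A: "approximable_at k A e" "A \<in> sets Omega" and B: "approximable_at k B e'" "B \<in> sets Omega"
  shows "approximable_at k (A \<union> B) (e + e')"
proof -
  interpret prob_space "Omega :: ('a \<Rightarrow> real) measure" by (rule prob_space_Omega)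
  obtain S P where S: "finite S" "\<And>a b. (\<forall>i \<in> S. a i = b i) \<Longrightarrow> P a = P b"
     "prob {x \<in> space Omega. (x \<in> A) \<noteq> P (first_digits (2 ^ k) x)} < e"
    using A(1) unfolding approximable_at_def by blast
  obtain S' P' where S': "finite S'" "\<And>a b. (\<forall>i \<in> S'. a i = b i) \<Longrightarrow> P' a = P' b"
     "prob {x \<in> space Omega. (x \<in> B) \<noteq> P' (first_digits (2 ^ k) x)} < e'"
    using B(1) unfolding approximable_at_def by blast
  let ?Q = "\<lambda>a. P a \<or> P' a"
  have Q: "?Q a = ?Q b" if "\<forall>i \<in> S \<union> S'. a i = b i" for a b
    using S(2)[of a b] S'(2)[of a b] that by auto
  have m: "{x \<in> space Omega. (x \<in> A) \<noteq> P (first_digits (2 ^ k) x)} \<in> events"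
      "{x \<in> space Omega. (x \<in> B) \<noteq> P' (first_digits (2 ^ k) x)} \<in> events"
    by (rule sets_mismatch[OF S(1,2) A(2)], simp, rule sets_mismatch[OF S'(1,2) B(2)], simp)
  have "prob {x \<in> space Omega. (x \<in> A \<union> B) \<noteq> ?Q (first_digits (2 ^ k) x)} \<le>
     prob ({x \<in> space Omega. (x \<in> A) \<noteq> P (first_digits (2 ^ k) x)} \<union>
       {x \<in> space Omega. (x \<in> B) \<noteq> P' (first_digits (2 ^ k) x)})"
    by (rule finite_measure_mono) (use m in auto)
  also have "\<dots> \<le> prob {x \<in> space Omega. (x \<in> A) \<noteq> P (first_digits (2 ^ k) x)} +
       prob {x \<in> space Omega. (x \<in> B) \<noteq> P' (first_digits (2 ^ k) x)}"
    by (rule measure_Un_le) (use m in auto)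
  also have "\<dots> < e + e'" using S(3) S'(3) by simp
  finally show ?thesis
    unfolding approximable_at_def using S(1) S'(1) Q by (intro exI[of _ "S \<union> S'"] exI[of _ ?Q]) auto
qed

text \<open>The good sets: they form a sigma-algebra for which all coordinates are measurable, hence
  they include every measurable set.\<close>

definition approximable_sets :: "('g \<Rightarrow> real) set set" where
  "approximable_sets = {A \<in> sets Omega. \<forall>e>0. \<exists>k. approximable_at k A e}"

lemma approximable_UN_lessThan:
  assumes "\<forall>n. A n \<in> approximable_sets" "e > 0"
  shows "\<exists>k. approximable_at k (\<Union>n<N::nat. A n) e"
  using assms(2)
proof (induction N arbitrary: e)
  case 0
  then have "approximable_at 0 (\<Union>n<0. A n) e"
    unfolding approximable_at_def by (intro exI[of _ "{}"] exI[of _ "\<lambda>_. False"]) auto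
  then show ?case by blast
next
  case (Suc N)
  obtain k where k: "approximable_at k (\<Union>n<N. A n) (e / 2)" using Suc.IH[of "e / 2"] Suc.prems by auto
  obtain k' where k': "approximable_at k' (A N) (e / 2)"
    using assms(1)[rule_format, of N] Suc.prems unfolding approximable_sets_def by (auto dest: spec[of _ "e / 2"])
  have "approximable_at (max k k') ((\<Union>n<N. A n) \<union> A N) (e / 2 + e / 2)"
    by (intro approximable_at_Un approximable_at_mono[OF k] approximable_at_mono[OF k'])
      (use assms(1) in \<open>auto simp: approximable_sets_def\<close>)
  then show ?case by (auto simp: lessThan_Suc Un_commute)
qed

text \<open>Complements negate the predicate. A countable union is replaced by a finite one at a
  cost of \<open>e / 2\<close>, by continuity of the measure, and finite unions pass to a common
  base.\<close>

lemma sigma_algebra_approximable: "sigma_algebra (space Omega) (approximable_sets :: ('g \<Rightarrow> real) set set)"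
  unfolding sigma_algebra_iff2
proof (intro conjI ballI allI impI)
  interpret prob_space "Omega :: ('g \<Rightarrow> real) measure" by (rule prob_space_Omega)
  show "approximable_sets \<subseteq> Pow (space Omega)"
    using sets.sets_into_space by (auto simp: approximable_sets_def)
  show "{} \<in> approximable_sets"
    unfolding approximable_sets_def approximable_at_def
    by (auto intro!: exI[of _ "{}"] exI[of _ "\<lambda>_. False"])
  show "space Omega - A \<in> approximable_sets" if A: "A \<in> approximable_sets" for A :: "('g \<Rightarrow> real) set"
    unfolding approximable_sets_def
  proof (intro CollectI conjI allI impI)
    show "space Omega - A \<in> events" using A by (auto simp: approximable_sets_def)
    fix e :: real assume "e > 0"
    then obtain k where "approximable_at k A e" using A by (auto simp: approximable_sets_def)
    then obtain S P where S: "finite S" "\<forall>a b. (\<forall>i \<in> S. a i = b i) \<longrightarrow> P a = P b"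
        "prob {x \<in> space Omega. (x \<in> A) \<noteq> P (first_digits (2 ^ k) x)} < e"
      unfolding approximable_at_def by blast
    have eq: "{x \<in> space Omega. (x \<in> space Omega - A) \<noteq> (\<not> P (first_digits (2 ^ k) x))} =
        {x \<in> space Omega. (x \<in> A) \<noteq> P (first_digits (2 ^ k) x)}" by auto
    have "approximable_at k (space Omega - A) e"
      unfolding approximable_at_def
    proof (intro exI conjI)
      show "prob {x \<in> space Omega. (x \<in> space Omega - A) \<noteq> (\<not> P (first_digits (2 ^ k) x))} < e"
        unfolding eq by (rule S)
    qed (use S in auto)
    then show "\<exists>k. approximable_at k (space Omega - A) e" by blast
  qed
  show "(\<Union>n. A n) \<in> approximable_sets" if "range A \<subseteq> approximable_sets" for A :: "nat \<Rightarrow> ('g \<Rightarrow> real) set"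
    unfolding approximable_sets_def
  proof (intro CollectI conjI allI impI)
    have A: "\<forall>n. A n \<in> approximable_sets" using that by auto
    then have ev: "A n \<in> events" for n by (simp add: approximable_sets_def)
    then show "(\<Union>n. A n) \<in> events" by auto
    fix e :: real assume e: "e > 0"
    have "(\<lambda>N. prob (\<Union>n<N. A n)) \<longlonglongrightarrow> prob (\<Union>N. \<Union>n<N. A n)"
    proof (rule finite_Lim_measure_incseq)
      show "incseq (\<lambda>N. \<Union>n<N. A n)" by (intro monoI UN_mono) auto
    qed (use ev in auto)
    also have "(\<Union>N. \<Union>n<N. A n) = (\<Union>n. A n)" by (rule UN_UN_finite_eq[unfolded atLeast0LessThan])
    finally have "\<forall>\<^sub>F N in sequentially. dist (prob (\<Union>n<N. A n)) (prob (\<Union>n. A n)) < e / 2"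
      by (rule tendstoD) (use e in simp)
    from eventually_happens'[OF sequentially_bot this]
    obtain N where N: "dist (prob (\<Union>n<N. A n)) (prob (\<Union>n. A n)) < e / 2" by (elim exE) (rule that)
    obtain k where "approximable_at k (\<Union>n<N. A n) (e / 2)"
      using approximable_UN_lessThan[OF A, of "e / 2"] e by auto
    then obtain S P where S: "finite S" "\<And>a b. (\<forall>i \<in> S. a i = b i) \<Longrightarrow> P a = P b"
        "prob {x \<in> space Omega. (x \<in> (\<Union>n<N. A n)) \<noteq> P (first_digits (2 ^ k) x)} < e / 2"
      unfolding approximable_at_def by blast
    have m: "{x \<in> space Omega. (x \<in> (\<Union>n<N. A n)) \<noteq> P (first_digits (2 ^ k) x)} \<in> events"
      by (rule sets_mismatch[OF S(1,2)]) (use ev in auto)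
    have "prob {x \<in> space Omega. (x \<in> (\<Union>n. A n)) \<noteq> P (first_digits (2 ^ k) x)} \<le>
        prob ({x \<in> space Omega. (x \<in> (\<Union>n<N. A n)) \<noteq> P (first_digits (2 ^ k) x)} \<union> ((\<Union>n. A n) - (\<Union>n<N. A n)))"
    proof (rule finite_measure_mono)
      show "{x \<in> space Omega. (x \<in> (\<Union>n<N. A n)) \<noteq> P (first_digits (2 ^ k) x)} \<union> ((\<Union>n. A n) - (\<Union>n<N. A n)) \<in> events"
        using m ev by (intro sets.Un sets.Diff sets.countable_UN) auto
    qed blast
    also have "\<dots> \<le> prob {x \<in> space Omega. (x \<in> (\<Union>n<N. A n)) \<noteq> P (first_digits (2 ^ k) x)} +
        prob ((\<Union>n. A n) - (\<Union>n<N. A n))"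
      by (rule measure_Un_le[OF m]) (use ev in auto)
    also have "prob ((\<Union>n. A n) - (\<Union>n<N. A n)) = prob (\<Union>n. A n) - prob (\<Union>n<N. A n)"
      by (rule finite_measure_Diff) (use ev in auto)
    also have "\<dots> < e / 2" using N unfolding dist_real_def by linarith
    finally have "prob {x \<in> space Omega. (x \<in> (\<Union>n. A n)) \<noteq> P (first_digits (2 ^ k) x)} < e"
      using S(3) by simp
    then show "\<exists>k. approximable_at k (\<Union>n. A n) e"
      unfolding approximable_at_def using S(1,2) by blast
  qed
qed

lemma measure_Omega_component:
  assumes "B \<in> sets borel"
  shows "measure Omega {x \<in> space Omega. x \<gamma> \<in> B} = measure lborel (B \<inter> {0..1})"
proof -
  interpret prob_space unit_interval by (rule prob_space_unit_interval)
  have B: "B \<inter> {0..1} \<in> sets unit_interval" using assms by (auto simp: sets_restrict_space)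
  have "distr Omega unit_interval (\<lambda>x. x \<gamma>) = unit_interval"
    unfolding Omega_def by (rule distr_PiM_component) (auto simp: prob_space_unit_interval)
  then have "measure unit_interval (B \<inter> {0..1}) = measure (distr Omega unit_interval (\<lambda>x. x \<gamma>)) (B \<inter> {0..1})"
    by simp
  also have "\<dots> = measure Omega ((\<lambda>x. x \<gamma>) -` (B \<inter> {0..1}) \<inter> space Omega)"
    by (rule measure_distr) (use B in \<open>auto simp: Omega_def\<close>)
  also have "(\<lambda>x. x \<gamma>) -` (B \<inter> {0..1}) \<inter> space Omega = {x \<in> space Omega. x \<gamma> \<in> B}"
    by (auto simp: space_Omega)
  also have "measure unit_interval (B \<inter> {0..1}) = measure lborel (B \<inter> {0..1})"
    by (rule measure_restrict_space) auto
  finally show ?thesis by simp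
qed

lemma approximable_halfline: "{x \<in> space Omega. x \<gamma> < c} \<in> approximable_sets"
  unfolding approximable_sets_def
proof (intro CollectI conjI allI impI)
  interpret prob_space "Omega :: ('a \<Rightarrow> real) measure" by (rule prob_space_Omega)
  show meas: "{x \<in> space Omega. x \<gamma> < c} \<in> events" by measurable
  fix e :: real assume "e > 0"
  then obtain k where k: "(1 / 2) ^ k < e" using real_arch_pow_inv[of e "1 / 2"] by auto
  \<comment> \<open>\<open>P\<close> says that the right end of the dyadic cell is at most
    \<open>c\<close>. It errs only on the cell cut by \<open>c\<close>, which lies within
    \<open>(1 / 2) ^ k\<close> of \<open>c\<close>, and possibly at the end point 1, whose digit is
    0.\<close>
  define P where "P a \<longleftrightarrow> real (a \<gamma>) + 1 \<le> 2 ^ k * c" for a :: "'a \<Rightarrow> nat"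
  have m: "{x \<in> space Omega. x \<gamma> \<in> {c - (1 / 2) ^ k..c} \<union> {1}} \<in> events" by measurable
  have "prob {x \<in> space Omega. (x \<in> {x \<in> space Omega. x \<gamma> < c}) \<noteq> P (first_digits (2 ^ k) x)} \<le>
      prob {x \<in> space Omega. x \<gamma> \<in> {c - (1 / 2) ^ k..c} \<union> {1}}"
  proof (rule finite_measure_mono[OF subsetI m])
    fix x :: "'a \<Rightarrow> real"
    assume mis: "x \<in> {x \<in> space Omega. (x \<in> {x \<in> space Omega. x \<gamma> < c}) \<noteq> P (first_digits (2 ^ k) x)}"
    have "x \<gamma> \<in> {c - (1 / 2) ^ k..c}" if "x \<gamma> \<noteq> 1"
    proof -
      have x: "x \<in> space Omega" "(x \<gamma> < c) \<noteq> P (first_digits (2 ^ k) x)" "x \<gamma> \<noteq> 1" using mis that by auto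
      have "0 \<le> x \<gamma>" "x \<gamma> < 1" using x(1,3) by (auto simp: space_Omega less_le)
      then have fl: "0 \<le> \<lfloor>2 ^ k * x \<gamma>\<rfloor>" "\<lfloor>2 ^ k * x \<gamma>\<rfloor> < 2 ^ k"
        by (auto simp: floor_less_iff)
      then have "real (first_digits (2 ^ k) x \<gamma>) = of_int \<lfloor>2 ^ k * x \<gamma>\<rfloor>"
        by (simp add: first_digits_def digit_def)
      then have d: "real (first_digits (2 ^ k) x \<gamma>) \<le> 2 ^ k * x \<gamma>"
          "2 ^ k * x \<gamma> < real (first_digits (2 ^ k) x \<gamma>) + 1" by linarith+
      have "\<not> (P (first_digits (2 ^ k) x) \<and> c \<le> x \<gamma>)"
      proof
        assume "P (first_digits (2 ^ k) x) \<and> c \<le> x \<gamma>"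
        moreover from this have "(2::real) ^ k * c \<le> 2 ^ k * x \<gamma>" by (intro mult_left_mono) auto
        ultimately show False using d unfolding P_def by linarith
      qed
      then have "x \<gamma> < c" "2 ^ k * c < real (first_digits (2 ^ k) x \<gamma>) + 1"
        using x by (auto simp: P_def)
      then have "2 ^ k * (c - x \<gamma>) < 1" using d(1) by (simp add: algebra_simps)
      then have "c - x \<gamma> < (1 / 2) ^ k" by (simp add: power_one_over field_simps)
      then show ?thesis using \<open>x \<gamma> < c\<close> by simp
    qed
    then show "x \<in> {x \<in> space Omega. x \<gamma> \<in> {c - (1 / 2) ^ k..c} \<union> {1}}" using mis by auto
  qed
  also have "\<dots> = measure lborel (({c - (1 / 2) ^ k..c} \<union> {1}) \<inter> {0..1})"
    by (rule measure_Omega_component) auto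
  also have "\<dots> \<le> measure lborel ({c - (1 / 2) ^ k..c} \<union> {1})"
  proof (rule measure_mono_fmeasurable)
    have "{c - (1 / 2) ^ k..c} \<in> fmeasurable lborel" "{1 :: real} \<in> fmeasurable lborel"
      by (auto intro!: fmeasurableI)
    then show "{c - (1 / 2) ^ k..c} \<union> {1} \<in> fmeasurable lborel" by (rule fmeasurable.Un)
  qed auto
  also have "\<dots> \<le> measure lborel {c - (1 / 2) ^ k..c} + measure lborel {1::real}"
    by (rule measure_subadditive) auto
  also have "\<dots> = (1 / 2) ^ k" by simp
  also have "\<dots> < e" by (rule k)
  finally have "prob {x \<in> space Omega. (x \<in> {x \<in> space Omega. x \<gamma> < c}) \<noteq> P (first_digits (2 ^ k) x)} < e" .
  moreover have "finite {\<gamma>}" "\<forall>a b. (\<forall>i \<in> {\<gamma>}. a i = b i) \<longrightarrow> P a = P b" by (simp_all add: P_def)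
  ultimately show "\<exists>k. approximable_at k {x \<in> space Omega. x \<gamma> < c} e"
    unfolding approximable_at_def by blast
qed

lemma sets_Omega_approximable: "sets Omega \<subseteq> (approximable_sets :: ('g \<Rightarrow> real) set set)"
proof -
  define N :: "('g \<Rightarrow> real) measure" where "N = sigma (space Omega) approximable_sets"
  interpret S: sigma_algebra "space Omega" "approximable_sets :: ('g \<Rightarrow> real) set set"
    by (rule sigma_algebra_approximable)
  have N: "space N = space Omega" "sets N = approximable_sets"
    unfolding N_def using S.space_closed by (simp_all add: S.sets_measure_of_eq)
  have [measurable]: "(\<lambda>x. x \<gamma>) \<in> borel_measurable N" for \<gamma>
    unfolding borel_measurable_iff_less N by (intro allI approximable_halfline)
  have "sets Omega \<subseteq> sets N"
    unfolding Omega_def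
  proof (rule sets_PiM_in_sets)
    show "space N = (\<Pi>\<^sub>E i\<in>UNIV. space unit_interval)" unfolding N by (simp add: Omega_def space_PiM)
    fix \<gamma> :: 'g and A assume "A \<in> sets unit_interval"
    then have [measurable]: "A \<in> sets borel" by (auto simp: sets_restrict_space)
    show "{x \<in> space N. x \<gamma> \<in> A} \<in> sets N" by measurable
  qed
  then show ?thesis by (simp add: N)
qed

section \<open>Compact targets and weak-* neighbourhoods\<close>

lemma compact_finite_net:
  fixes K :: "'k::metric_space set"
  assumes "compact K" "e > 0"
  obtains C where "finite C" "C \<subseteq> K" "K \<subseteq> (\<Union>c \<in> C. ball c e)"
proof -
  have "K \<subseteq> (\<Union>c \<in> K. ball c e)" using assms(2) by auto
  then obtain C where "C \<subseteq> K" "finite C" "K \<subseteq> (\<Union>c \<in> C. ball c e)"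
    using compactE_image[OF assms(1), of K "\<lambda>c. ball c e"] by auto
  then show ?thesis using that by blast
qed

text \<open>With a finite net, \<open>f x\<close> is known up to \<open>e\<close> once it is known
  which balls around net points contain it. Each of these finitely many questions is an approximable
  set.\<close>

lemma approximate_by_digits:
  fixes f :: "('g \<Rightarrow> real) \<Rightarrow> 'k::metric_space"
  assumes K: "compact (UNIV :: 'k set)" and f: "f \<in> Omega \<rightarrow>\<^sub>M borel" and e: "e > 0"
  obtains N S F B where "N > 0" "finite S" "\<forall>a b. (\<forall>i \<in> S. a i = b i) \<longrightarrow> F a = F b"
    "B \<in> sets Omega" "measure Omega B < e"
    "\<forall>x \<in> space Omega - B. dist (f x) (F (first_digits N x)) < e"
proof -
  interpret prob_space "Omega :: ('g \<Rightarrow> real) measure" by (rule prob_space_Omega)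
  obtain C :: "'k set" where C: "finite C" "UNIV \<subseteq> (\<Union>c \<in> C. ball c e)"
    by (rule compact_finite_net[OF K e])
  \<comment> \<open>The \<open>+ 1\<close> keeps the total of the \<open>card C\<close> errors
    strictly below \<open>e\<close> and the denominator positive.\<close>
  define e' where "e' = e / (card C + 1)"
  have e': "e' > 0" using e by (simp add: e'_def)
  define A where "A c = f -` ball c e \<inter> space Omega" for c
  have A: "A c \<in> events" for c unfolding A_def by (rule measurable_sets[OF f]) auto
  have "\<forall>c. \<exists>k. approximable_at k (A c) e'"
    using A sets_Omega_approximable e' unfolding approximable_sets_def by blast
  from choice[OF this] obtain k where k: "\<forall>c. approximable_at (k c) (A c) e'" by (elim exE) (rule that)
  define m where "m = Max (insert 0 (k ` C))"
  define R where "R c S P \<longleftrightarrow> finite S \<and> (\<forall>a b. (\<forall>i \<in> S. a i = b i) \<longrightarrow> P a = P b) \<and>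
     prob {x \<in> space Omega. (x \<in> A c) \<noteq> P (first_digits (2 ^ m) x)} < e'" for c S P
  have "\<exists>S P. R c S P" if "c \<in> C" for c
  proof -
    have "k c \<le> m" using C that by (simp add: m_def)
    then have "approximable_at m (A c) e'" using k approximable_at_mono by blast
    then show ?thesis by (simp only: approximable_at_def R_def)
  qed
  then obtain S P where R: "\<And>c. c \<in> C \<Longrightarrow> R c (S c) (P c)" by metis
  have SP: "finite (S c)" "(\<forall>i \<in> S c. a i = b i) \<Longrightarrow> P c a = P c b"
      "prob {x \<in> space Omega. (x \<in> A c) \<noteq> P c (first_digits (2 ^ m) x)} < e'" if "c \<in> C" for c a b
    using R[OF that] by (auto simp: R_def)
  define B where "B = (\<Union>c \<in> C. {x \<in> space Omega. (x \<in> A c) \<noteq> P c (first_digits (2 ^ m) x)})"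
  \<comment> \<open>Any ball that contains \<open>f x\<close> will do, so the choice among several
    is free. If no \<open>P c\<close> holds the value is arbitrary, which happens only for points in
    \<open>B\<close>.\<close>
  define F where "F a = (SOME c. c \<in> C \<and> P c a)" for a
  have m: "{x \<in> space Omega. (x \<in> A c) \<noteq> P c (first_digits (2 ^ m) x)} \<in> events" if "c \<in> C" for c
    by (rule sets_mismatch[OF SP(1)[OF that] SP(2)[OF that] A])
  show ?thesis
  proof (rule that[of "2 ^ m" "\<Union>(S ` C)" F B])
    show "finite (\<Union>(S ` C))" by (rule finite_UN_I[OF C(1) SP(1)])
    show "\<forall>a b. (\<forall>i \<in> \<Union>(S ` C). a i = b i) \<longrightarrow> F a = F b"
    proof (intro allI impI)
      fix a b :: "'g \<Rightarrow> nat" assume ab: "\<forall>i \<in> \<Union>(S ` C). a i = b i"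
      have "P c a = P c b" if "c \<in> C" for c
        by (rule SP(2)[OF that], rule ballI, rule bspec[OF ab], rule UN_I[OF that])
      then have "(\<lambda>c. c \<in> C \<and> P c a) = (\<lambda>c. c \<in> C \<and> P c b)" by (intro ext) blast
      then show "F a = F b" by (simp only: F_def)
    qed
    show "B \<in> events" unfolding B_def by (rule sets.finite_UN[OF C(1) m])
    have "prob B \<le> (\<Sum>c \<in> C. prob {x \<in> space Omega. (x \<in> A c) \<noteq> P c (first_digits (2 ^ m) x)})"
      unfolding B_def by (rule finite_measure_subadditive_finite[OF C(1)], rule image_subsetI, rule m)
    also have "\<dots> \<le> (\<Sum>c \<in> C. e')" by (rule sum_mono, rule less_imp_le, rule SP(3))
    also have "\<dots> = card C * e'" by simp
    also have "\<dots> < e" using e by (simp add: e'_def field_simps)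
    finally show "prob B < e" .
    show "\<forall>x \<in> space Omega - B. dist (f x) (F (first_digits (2 ^ m) x)) < e"
    proof
      fix x assume x: "x \<in> space Omega - B"
      have iff: "x \<in> A c \<longleftrightarrow> P c (first_digits (2 ^ m) x)" if "c \<in> C" for c
        using x that unfolding B_def by blast
      have "f x \<in> (\<Union>c \<in> C. ball c e)" using C(2) by (rule subsetD) simp
      then obtain c where c: "c \<in> C" "f x \<in> ball c e" by (elim UN_E) (rule that)
      have "x \<in> A c" using c(2) x by (simp add: A_def)
      then have "c \<in> C \<and> P c (first_digits (2 ^ m) x)" using iff[OF c(1)] c(1) by simp
      then have F: "F (first_digits (2 ^ m) x) \<in> C \<and> P (F (first_digits (2 ^ m) x)) (first_digits (2 ^ m) x)"
        unfolding F_def by (rule someI)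
      then have "x \<in> A (F (first_digits (2 ^ m) x))" using iff by blast
      then show "dist (f x) (F (first_digits (2 ^ m) x)) < e" by (simp add: A_def dist_commute)
    qed
  qed simp
qed

text \<open>Although it is not of class \<^class>\<open>second_countable_topology\<close>, a compact metric space has a
  countable base of balls.\<close>

lemma measurable_into_compact:
  fixes h :: "'w \<Rightarrow> 'l::metric_space"
  assumes K: "compact (UNIV :: 'l set)" and h: "\<And>c. (\<lambda>x. dist c (h x)) \<in> borel_measurable M"
  shows "h \<in> M \<rightarrow>\<^sub>M borel"
proof (rule borel_measurableI)
  fix U :: "'l set" assume U: "open U"
  have "\<exists>C. finite C \<and> (UNIV :: 'l set) \<subseteq> (\<Union>c \<in> C. ball c (1 / Suc n))" for n
    by (rule compact_finite_net[OF K, of "1 / Suc n"]) auto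
  then have "\<forall>n. \<exists>C. finite C \<and> (UNIV :: 'l set) \<subseteq> (\<Union>c \<in> C. ball c (1 / Suc n))" by blast
  from choice[OF this] obtain C
    where C': "\<forall>n. finite (C n) \<and> (UNIV :: 'l set) \<subseteq> (\<Union>c \<in> C n. ball c (1 / Suc n))"
    by (elim exE) (rule that)
  then have C: "finite (C n)" "(UNIV :: 'l set) \<subseteq> (\<Union>c \<in> C n. ball c (1 / Suc n))" for n
    by (simp, elim allE[of _ n] conjE)
  define I where "I = {(n, c). c \<in> C n \<and> ball c (1 / Suc n) \<subseteq> U}"
  have "I \<subseteq> (SIGMA n:UNIV. C n)" by (auto simp: I_def)
  then have "countable I" by (rule countable_subset) (use C in \<open>auto intro: countable_finite\<close>)
  have "U = (\<Union>(n, c) \<in> I. ball c (1 / Suc n))"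
  proof (intro equalityI subsetI)
    fix x assume "x \<in> U"
    then obtain e where e: "e > 0" "ball x e \<subseteq> U" using U open_contains_ball by blast
    obtain n where n: "1 / Suc n < e / 2" using reals_Archimedean[of "e / 2"] e(1) by (auto simp: inverse_eq_divide)
    have "x \<in> (\<Union>c \<in> C n. ball c (1 / Suc n))" using C(2) by (rule subsetD) simp
    then obtain c where c: "c \<in> C n" "x \<in> ball c (1 / Suc n)" by (elim UN_E) (rule that)
    have "ball c (1 / Suc n) \<subseteq> ball x e"
    proof
      fix y assume "y \<in> ball c (1 / Suc n)"
      then have "dist x y < 1 / Suc n + 1 / Suc n" using c(2) dist_triangle2[of x y c]
        by (simp add: dist_commute)
      then show "y \<in> ball x e" using n by simp
    qed
    then have "(n, c) \<in> I" using c e by (auto simp: I_def)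
    then show "x \<in> (\<Union>(n, c) \<in> I. ball c (1 / Suc n))" using c(2) by (intro UN_I[of "(n, c)"]) auto
  qed (auto simp: I_def)
  then have "h -` U \<inter> space M = (\<Union>(n, c) \<in> I. {x \<in> space M. dist c (h x) < 1 / Suc n})"
    by (auto simp: ball_def)
  also have "\<dots> \<in> sets M"
    using \<open>countable I\<close> h by (intro sets.countable_UN') (auto simp: case_prod_beta)
  finally show "h -` U \<inter> space M \<in> sets M" .
qed

text \<open>The metric on functions is a series in the distances of the coordinates.\<close>

lemma measurable_into_compact_fun:
  fixes h :: "'w \<Rightarrow> 'g::countable \<Rightarrow> 'k::metric_space"
  assumes K: "compact (UNIV :: ('g \<Rightarrow> 'k) set)" and h: "\<And>\<gamma>. (\<lambda>x. h x \<gamma>) \<in> M \<rightarrow>\<^sub>M borel"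
  shows "h \<in> M \<rightarrow>\<^sub>M borel"
proof (rule measurable_into_compact[OF K])
  fix c :: "'g \<Rightarrow> 'k"
  have [measurable]: "(\<lambda>x. dist (c \<gamma>) (h x \<gamma>)) \<in> borel_measurable M" for \<gamma>
    by (rule measurable_compose[OF h borel_measurable_continuous_onI]) (intro continuous_intros)
  show "(\<lambda>x. dist c (h x)) \<in> borel_measurable M"
    unfolding dist_fun_def by measurable
qed

lemma compact_UNIV_fun:
  assumes "compact (UNIV :: 'k::topological_space set)"
  shows "compact (UNIV :: ('g \<Rightarrow> 'k) set)"
proof -
  have "compact_space (product_topology (\<lambda>_::'g. euclidean :: 'k topology) UNIV)"
    by (subst compact_space_product_topology) (use assms in \<open>auto simp: compact_space_def\<close>)
  then show ?thesis unfolding euclidean_product_topology by (simp add: compact_space_def)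
qed

lemma uniform_continuity_window:
  fixes \<phi> :: "('g::countable \<Rightarrow> 'k::metric_space) \<Rightarrow> real"
  assumes "compact (UNIV :: 'k set)" "continuous_on UNIV \<phi>" "r > 0"
  shows "\<exists>W d. finite W \<and> d > 0 \<and>
    (\<forall>x y. (\<forall>\<gamma> \<in> W. dist (x \<gamma>) (y \<gamma>) < d) \<longrightarrow> \<bar>\<phi> x - \<phi> y\<bar> < r)"
proof -
  have "uniformly_continuous_on UNIV \<phi>"
    by (rule compact_uniformly_continuous) (use assms compact_UNIV_fun in auto)
  then obtain d where d: "d > 0" "\<And>x y. dist x y < d \<Longrightarrow> dist (\<phi> x) (\<phi> y) < r"
    unfolding uniformly_continuous_on_def using assms(3) by (metis UNIV_I)
  \<comment> \<open>\<open>dist x y\<close> is at most twice the largest of the first distances plus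
    \<open>(1 / 2) ^ N\<close>, so less than \<open>2 * (d / 4) + d / 2\<close>.\<close>
  obtain N where N: "(1 / 2) ^ N < d / 2" using real_arch_pow_inv[of "d / 2" "1 / 2"] d by auto
  show ?thesis
  proof (intro exI[of _ "from_nat ` {..N}"] exI[of _ "d / 4"] conjI allI impI)
    fix x y :: "'g \<Rightarrow> 'k" assume xy: "\<forall>\<gamma> \<in> from_nat ` {..N}. dist (x \<gamma>) (y \<gamma>) < d / 4"
    let ?D = "{dist (x (from_nat n)) (y (from_nat n))|n. n \<le> N}"
    have "?D = (\<lambda>n. dist (x (from_nat n)) (y (from_nat n))) ` {..N}" by auto
    then have "Max ?D < d / 4" using xy by (subst Max_less_iff) auto
    then have "dist x y < d" using dist_fun_le_dist_first_terms[of x y N] N by simp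
    then show "\<bar>\<phi> x - \<phi> y\<bar> < r" using d(2) by (simp add: dist_real_def)
  qed (use d in auto)
qed

text \<open>Intersections unite the test functions and take the smaller radius; a union keeps those
  of one member that contains \<mu>.\<close>

lemma weak_star_neighbourhood:
  fixes U :: "'l::topological_space measure set"
  assumes "openin weak_star_topology U" "\<mu> \<in> U"
  shows "\<exists>\<Phi> r. finite \<Phi> \<and> r > 0 \<and> (\<forall>\<phi> \<in> \<Phi>. continuous_on UNIV \<phi>) \<and>
    (\<forall>\<nu> \<in> Prob. (\<forall>\<phi> \<in> \<Phi>. \<bar>(\<integral>y. \<phi> y \<partial>\<nu>) - (\<integral>y. \<phi> y \<partial>\<mu>)\<bar> < (r::real)) \<longrightarrow> \<nu> \<in> U)"
    (is "\<exists>\<Phi> r. ?P U \<Phi> r")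
proof -
  have "generate_topology_on {{\<mu> \<in> Prob. (\<integral>y. \<phi> y \<partial>\<mu>) \<in> V} | (\<phi> :: 'l \<Rightarrow> real) V.
      continuous_on UNIV \<phi> \<and> open V} U"
    using assms(1) unfolding weak_star_topology_def openin_topology_generated_by_iff .
  then show ?thesis using assms(2)
  proof (induction U rule: generate_topology_on.induct)
    case (Int a b)
    then have "\<mu> \<in> a" "\<mu> \<in> b" by auto
    obtain \<Phi> r where a: "?P a \<Phi> r" using Int.IH(1)[OF \<open>\<mu> \<in> a\<close>] by (elim exE) (rule that)
    obtain \<Psi> s where b: "?P b \<Psi> s" using Int.IH(2)[OF \<open>\<mu> \<in> b\<close>] by (elim exE) (rule that)
    show ?case by (intro exI[of _ "\<Phi> \<union> \<Psi>"] exI[of _ "min r s"]) (use a b in auto)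
  next
    case (UN A)
    then obtain k where k: "k \<in> A" "\<mu> \<in> k" by auto
    obtain \<Phi> r where P: "?P k \<Phi> r" using UN.IH[OF k] by (elim exE) (rule that)
    show ?case by (intro exI[of _ \<Phi>] exI[of _ r]) (use P k(1) in auto)
  next
    case (Basis s)
    then obtain \<phi> :: "'l \<Rightarrow> real" and V where s: "s = {\<mu> \<in> Prob. (\<integral>y. \<phi> y \<partial>\<mu>) \<in> V}" "continuous_on UNIV \<phi>" "open V"
      by blast
    then obtain r where r: "r > 0" "ball (\<integral>y. \<phi> y \<partial>\<mu>) r \<subseteq> V"
      using Basis.prems open_contains_ball by blast
    show ?case
    proof (intro exI[of _ "{\<phi>}"] exI[of _ r] conjI ballI impI)
      fix \<nu> assume "\<nu> \<in> Prob" "\<forall>\<phi>\<in>{\<phi>}. \<bar>(\<integral>y. \<phi> y \<partial>\<nu>) - (\<integral>y. \<phi> y \<partial>\<mu>)\<bar> < r"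
      then have "(\<integral>y. \<phi> y \<partial>\<nu>) \<in> ball (\<integral>y. \<phi> y \<partial>\<mu>) r" by (simp add: dist_real_def abs_minus_commute)
      then show "\<nu> \<in> s" using r \<open>\<nu> \<in> Prob\<close> by (auto simp: s)
    qed (use s r in auto)
  qed simp
qed

section \<open>The local lemma on the shift\<close>

lemma rational_interval_avoiding:
  fixes y :: real
  assumes "finite Z" "y \<notin> Z"
  obtains a b :: rat where "of_rat a < y" "y < of_rat b"
    "\<And>z. z \<in> Z \<Longrightarrow> \<not> (of_rat a < z \<and> z < of_rat b)"
proof -
  obtain d where d: "d > 0" "\<forall>z \<in> Z. z \<noteq> y \<longrightarrow> d \<le> dist y z"
    using finite_set_avoid[OF assms(1)] by blast
  obtain a where a: "y - d < of_rat a" "of_rat a < y" using of_rat_dense[of "y - d" y] d(1) by auto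
  obtain b where b: "y < of_rat b" "of_rat b < y + d" using of_rat_dense[of y "y + d"] d(1) by auto
  show ?thesis
  proof (rule that[OF a(2) b(1)])
    fix z assume "z \<in> Z"
    then have "d \<le> \<bar>y - z\<bar>" using d(2) assms(2) by (auto simp: dist_real_def)
    then show "\<not> (of_rat a < z \<and> z < of_rat b)" using a b by linarith
  qed
qed

text \<open>The constraints of kind \<open>n\<close> are the translates of \<open>viol n\<close>. A
  coordinate \<open>v\<close> is read by at most \<open>card (R n)\<close> of them, those at
  \<open>- r + v\<close> with \<open>r\<close> in \<open>R n\<close>; this gives the first factor in
  \<open>sum_viol\<close>, which is the local lemma condition grouped by kinds.\<close>

locale shift_lll =
  fixes N :: nat and R :: "nat \<Rightarrow> 'g::{group_add, countable} set"
    and viol :: "nat \<Rightarrow> ('g \<Rightarrow> nat) \<Rightarrow> bool" and p :: "nat \<Rightarrow> real" and \<eta> :: real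
  assumes N: "N > 0" and R: "finite (R n)" "R n \<noteq> {}"
    and viol_cong: "(\<And>i. i \<in> R n \<Longrightarrow> a i = b i) \<Longrightarrow> viol n a = viol n b"
    and prob_viol: "measure (PiM UNIV (\<lambda>_. measure_pmf (pmf_of_set {..<N}))) {a. viol n a} \<le> p n"
    and \<eta>: "\<eta> \<ge> 0"
    and sum_viol: "finite J \<Longrightarrow> (\<Sum>n \<in> J. card (R n) * (p n * exp (\<eta> * card (R n)))) \<le> \<eta>"
begin

definition vbl :: "nat \<times> 'g \<Rightarrow> 'g set" where
  "vbl = (\<lambda>(n, \<gamma>). (\<lambda>r. r + \<gamma>) ` R n)"

definition bad :: "nat \<times> 'g \<Rightarrow> ('g \<Rightarrow> nat) \<Rightarrow> bool" where
  "bad = (\<lambda>(n, \<gamma>) a. viol n (shift \<gamma> a))"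

lemma card_vbl: "card (vbl (n, \<gamma>)) = card (R n)"
  by (auto simp: vbl_def inj_on_def intro!: card_image)

lemma vbl_preimage: "{\<gamma>. v \<in> vbl (n, \<gamma>)} = (\<lambda>r. - r + v) ` R n"
proof (intro set_eqI iffI)
  fix \<gamma> assume "\<gamma> \<in> {\<gamma>. v \<in> vbl (n, \<gamma>)}"
  then obtain r where "r \<in> R n" "v = r + \<gamma>" by (auto simp: vbl_def)
  then show "\<gamma> \<in> (\<lambda>r. - r + v) ` R n" by (intro image_eqI[of _ _ r]) (auto simp flip: add.assoc)
next
  fix \<gamma> assume "\<gamma> \<in> (\<lambda>r. - r + v) ` R n"
  then obtain r where "r \<in> R n" "\<gamma> = - r + v" by auto
  then show "\<gamma> \<in> {\<gamma>. v \<in> vbl (n, \<gamma>)}" by (auto simp: vbl_def image_iff simp flip: add.assoc intro!: bexI[of _ r])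
qed

lemma vbl_add: "v + \<delta> \<in> vbl (n, \<gamma> + \<delta>) \<longleftrightarrow> v \<in> vbl (n, \<gamma>)"
  by (auto simp: vbl_def image_iff simp flip: add.assoc)

sublocale event_system vbl bad
proof
  show "finite (vbl e)" "vbl e \<noteq> {}" for e using R by (auto simp: vbl_def split: prod.split)
  show "bad e a = bad e b" if "\<And>v. v \<in> vbl e \<Longrightarrow> a v = b v" for e a b
    using that by (cases e) (auto simp: bad_def vbl_def shift_def intro!: viol_cong)
qed

sublocale lll_system vbl bad "pmf_of_set {..<N}" "\<lambda>(n, \<gamma>). p n" \<eta>
proof
  let ?M = "PiM UNIV (\<lambda>_::'g. measure_pmf (pmf_of_set {..<N}))"
  interpret M: prob_space ?M by (rule prob_space_PiM_pmf)
  have p0: "p n \<ge> 0" for n using prob_viol[of n] measure_nonneg order_trans by blast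
  show "measure ?M {x. bad e x} \<le> (case e of (n, \<gamma>) \<Rightarrow> p n)" for e
  proof (cases e)
    case (Pair n \<gamma>)
    have ev: "{a. viol n a} \<in> M.events"
      by (rule sets_PiM_finite_dependence[OF R(1)[of n]]; rule viol_cong; simp)
    have "measure ?M {a. viol n a} = M.prob (shift \<gamma> -` {a. viol n a} \<inter> space ?M)"
      by (subst (1) distr_shift[of _ \<gamma>, symmetric], rule measure_distr[OF measurable_shift ev])
    then show ?thesis using prob_viol[of n] by (simp add: Pair bad_def vimage_def)
  qed
  show "\<eta> \<ge> 0" by (rule \<eta>)
  show "(\<Sum>e \<in> E. (case e of (n, \<gamma>) \<Rightarrow> p n) * exp (\<eta> * card (vbl e))) \<le> \<eta>"
    if E: "finite E" "\<And>e. e \<in> E \<Longrightarrow> v \<in> vbl e" for E v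
  proof -
    let ?w = "\<lambda>n. p n * exp (\<eta> * card (R n))"
    have "(\<Sum>e \<in> E. (case e of (n, \<gamma>) \<Rightarrow> p n) * exp (\<eta> * card (vbl e))) = (\<Sum>e \<in> E. ?w (fst e))"
      by (rule sum.cong) (auto simp: card_vbl)
    also have "\<dots> = (\<Sum>n \<in> fst ` E. \<Sum>e \<in> {e \<in> E. fst e = n}. ?w (fst e))"
      by (rule sum.image_gen[OF E(1)])
    also have "\<dots> \<le> (\<Sum>n \<in> fst ` E. card (R n) * ?w n)"
    proof (rule sum_mono)
      fix n
      have "{e \<in> E. fst e = n} \<subseteq> Pair n ` {\<gamma>. v \<in> vbl (n, \<gamma>)}" using E(2) by force
      also have "\<dots> = (\<lambda>r. (n, - r + v)) ` R n" unfolding vbl_preimage by auto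
      finally have "card {e \<in> E. fst e = n} \<le> card (R n)" by (rule surj_card_le[OF R(1)])
      then have "card {e \<in> E. fst e = n} * ?w n \<le> card (R n) * ?w n"
        using p0 by (intro mult_right_mono) auto
      then show "(\<Sum>e \<in> {e \<in> E. fst e = n}. ?w (fst e)) \<le> card (R n) * ?w n" by simp
    qed
    also have "\<dots> \<le> \<eta>" by (rule sum_viol) (use E in auto)
    finally show ?thesis .
  qed
qed

text \<open>Symmetry is broken by the coordinates of \<open>x\<close>: the events of one kind that are inspected at the
  same time are those around points whose coordinate is the only one nearby that lies in some rational
  interval. The last component of the decoded quadruple makes each pair occur infinitely often.\<close>

definition schedule :: "('g \<Rightarrow> real) \<Rightarrow> nat \<Rightarrow> (nat \<times> 'g) set" where
  "schedule x t = (case from_nat t :: nat \<times> rat \<times> rat \<times> nat of (n, a, b, j) \<Rightarrow>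
     {(n, \<gamma>) | \<gamma>. of_rat a < x \<gamma> \<and> x \<gamma> < of_rat b \<and>
       (\<forall>\<gamma>'. \<gamma>' \<noteq> \<gamma> \<longrightarrow> vbl (n, \<gamma>) \<inter> vbl (n, \<gamma>') \<noteq> {} \<longrightarrow>
         \<not> (of_rat a < x \<gamma>' \<and> x \<gamma>' < of_rat b))})"

lemma disjoint_schedule: "\<forall>t. disjoint_vbl (schedule x t)"
  unfolding disjoint_vbl_def schedule_def by (auto split: prod.split)

text \<open>Only finitely many translates overlap the one at \<gamma>, so injectivity of
  \<open>x\<close> lets a rational interval isolate \<open>x \<gamma>\<close> from their
  coordinates. The free component \<open>j\<close> repeats this inspection infinitely often.\<close>

lemma infinite_schedule:
  assumes x: "inj x"
  shows "infinite {t. e \<in> schedule x t}"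
proof (cases e)
  case (Pair n \<gamma>)
  define Y where "Y = {\<gamma>'. \<gamma>' \<noteq> \<gamma> \<and> vbl (n, \<gamma>) \<inter> vbl (n, \<gamma>') \<noteq> {}}"
  have "Y \<subseteq> (\<Union>v \<in> vbl (n, \<gamma>). {\<gamma>'. v \<in> vbl (n, \<gamma>')})" by (auto simp: Y_def)
  moreover have "finite \<dots>" unfolding vbl_preimage using finite_vbl R by auto
  ultimately have "finite (x ` Y)" using finite_subset by blast
  moreover have "x \<gamma> \<notin> x ` Y" using injD[OF x] by (auto simp: Y_def)
  ultimately obtain a b :: rat where ab: "of_rat a < x \<gamma>" "x \<gamma> < of_rat b"
      "\<And>z. z \<in> x ` Y \<Longrightarrow> \<not> (of_rat a < z \<and> z < of_rat b)"
    using rational_interval_avoiding by metis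
  have "e \<in> schedule x (to_nat (n, a, b, j))" for j :: nat
    using ab unfolding schedule_def Pair by (auto simp: Y_def)
  then have "range (\<lambda>j::nat. to_nat (n, a, b, j)) \<subseteq> {t. e \<in> schedule x t}" by auto
  moreover have "inj (\<lambda>j::nat. to_nat (n, a, b, j))" by (auto simp: inj_def)
  then have "infinite (range (\<lambda>j::nat. to_nat (n, a, b, j)))" using finite_imageD by blast
  ultimately show ?thesis using finite_subset by blast
qed

abbreviation values_at :: "('g \<Rightarrow> real) \<Rightarrow> 'g \<Rightarrow> nat \<Rightarrow> nat" where
  "values_at x \<equiv> (\<lambda>v i. table N x (v, i))"

definition solution :: "('g \<Rightarrow> real) \<Rightarrow> 'g \<Rightarrow> nat" where
  "solution x v = values_at x v (final_count (values_at x) (schedule x) v)"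

section \<open>Equivariance, measurability and correctness of the solution\<close>

lemma table_shift: "table N (shift \<delta> x) (v, i) = table N x (v + \<delta>, i)"
  by (simp add: table_def shift_def)

text \<open>The schedule refers only to values of \<open>x\<close> and to overlaps, both of which
  are carried along by right translation. With \<open>table_shift\<close> this makes the whole run
  equivariant.\<close>

lemma schedule_shift: "(n, \<gamma>) \<in> schedule (shift \<delta> x) t \<longleftrightarrow> (n, \<gamma> + \<delta>) \<in> schedule x t"
proof -
  have ov: "vbl (n, \<gamma>) \<inter> vbl (n, \<gamma>') \<noteq> {} \<longleftrightarrow> vbl (n, \<gamma> + \<delta>) \<inter> vbl (n, \<gamma>' + \<delta>) \<noteq> {}" for n \<gamma> \<gamma>'
  proof -
    have "(\<exists>v. v \<in> vbl (n, \<gamma>) \<and> v \<in> vbl (n, \<gamma>')) \<longleftrightarrow>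
        (\<exists>v. v + \<delta> \<in> vbl (n, \<gamma> + \<delta>) \<and> v + \<delta> \<in> vbl (n, \<gamma>' + \<delta>))" by (simp add: vbl_add)
    also have "\<dots> \<longleftrightarrow> (\<exists>v. v \<in> vbl (n, \<gamma> + \<delta>) \<and> v \<in> vbl (n, \<gamma>' + \<delta>))"
      by (metis diff_add_cancel)
    finally show ?thesis by blast
  qed
  have all: "(\<forall>\<gamma>'. P (\<gamma>' + \<delta>)) \<longleftrightarrow> (\<forall>\<gamma>'. P \<gamma>')" for P by (metis diff_add_cancel)
  obtain m a b j where t: "(from_nat t :: nat \<times> rat \<times> rat \<times> nat) = (m, a, b, j)" by (metis surj_pair)
  define P where "P \<gamma>' \<longleftrightarrow> \<gamma>' \<noteq> \<gamma> + \<delta> \<longrightarrow> vbl (n, \<gamma> + \<delta>) \<inter> vbl (n, \<gamma>') \<noteq> {} \<longrightarrow>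
    \<not> (of_rat a < x \<gamma>' \<and> x \<gamma>' < of_rat b)" for \<gamma>'
  have "(n, \<gamma>) \<in> schedule (shift \<delta> x) t \<longleftrightarrow> n = m \<and> of_rat a < x (\<gamma> + \<delta>) \<and> x (\<gamma> + \<delta>) < of_rat b \<and>
      (\<forall>\<gamma>'. P (\<gamma>' + \<delta>))"
    unfolding schedule_def t shift_def P_def using ov by auto
  also have "\<dots> \<longleftrightarrow> n = m \<and> of_rat a < x (\<gamma> + \<delta>) \<and> x (\<gamma> + \<delta>) < of_rat b \<and> (\<forall>\<gamma>'. P \<gamma>')"
    by (simp only: all)
  also have "\<dots> \<longleftrightarrow> (n, \<gamma> + \<delta>) \<in> schedule x t"
    unfolding schedule_def t P_def by auto
  finally show ?thesis .
qed

lemma count_shift: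
  "count (values_at (shift \<delta> x)) (schedule (shift \<delta> x)) t v = count (values_at x) (schedule x) t (v + \<delta>)"
proof (induction t arbitrary: v)
  case (Suc t)
  let ?A = "\<lambda>u. values_at x u (count (values_at x) (schedule x) t u)"
  have "(\<exists>e \<in> schedule (shift \<delta> x) t. v \<in> vbl e \<and> bad e (shift \<delta> ?A)) \<longleftrightarrow>
      (\<exists>n \<gamma>. (n, \<gamma> + \<delta>) \<in> schedule x t \<and> v + \<delta> \<in> vbl (n, \<gamma> + \<delta>) \<and> bad (n, \<gamma> + \<delta>) ?A)"
    by (simp add: Bex_def schedule_shift vbl_add bad_def shift_shift)
  also have "\<dots> \<longleftrightarrow> (\<exists>e \<in> schedule x t. v + \<delta> \<in> vbl e \<and> bad e ?A)"
    by (metis (no_types, lifting) diff_add_cancel surj_pair)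
  finally have ex: "(\<exists>e \<in> schedule (shift \<delta> x) t. v \<in> vbl e \<and> bad e (shift \<delta> ?A)) \<longleftrightarrow>
      (\<exists>e \<in> schedule x t. v + \<delta> \<in> vbl e \<and> bad e ?A)" .
  have vals: "(\<lambda>u. values_at (shift \<delta> x) u (count (values_at (shift \<delta> x)) (schedule (shift \<delta> x)) t u)) = shift \<delta> ?A"
    unfolding Suc.IH by (rule ext) (simp add: table_def shift_def)
  show ?case unfolding count.simps unfolding vals unfolding ex unfolding Suc.IH ..
qed simp

lemma solution_shift: "solution (shift \<delta> x) = shift \<delta> (solution x)"
proof
  fix v
  have "final_count (values_at (shift \<delta> x)) (schedule (shift \<delta> x)) v =
      final_count (values_at x) (schedule x) (v + \<delta>)"
    unfolding final_count_def count_shift ..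
  then show "solution (shift \<delta> x) v = shift \<delta> (solution x) v"
    unfolding solution_def by (simp add: table_shift, simp add: shift_def)
qed

lemma measurable_table_index:
  assumes [measurable]: "k \<in> Omega \<rightarrow>\<^sub>M count_space UNIV"
  shows "(\<lambda>x. table N x (v, k x)) \<in> Omega \<rightarrow>\<^sub>M count_space UNIV"
  unfolding table_def case_prod_conv
  by (rule measurable_compose_countable[OF _ assms]) measurable

text \<open>There are countably many events, so the quantifiers over events and group elements are
  countable unions and intersections, and each single event reads finitely many coordinates.\<close>

lemma measurable_count:
  "(\<lambda>x. count (values_at x) (schedule x) t v) \<in> Omega \<rightarrow>\<^sub>M count_space UNIV"
proof (induction t arbitrary: v)
  case (Suc t)
  note [measurable] = Suc.IH
  let ?M = "PiM UNIV (\<lambda>_::'g. measure_pmf (pmf_of_set {..<N}))"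
  have A: "(\<lambda>x u. values_at x u (count (values_at x) (schedule x) t u)) \<in> Omega \<rightarrow>\<^sub>M ?M"
    by (rule measurable_PiM_single') (use measurable_table_index[OF Suc.IH] in auto)
  have "bad e \<in> ?M \<rightarrow>\<^sub>M count_space UNIV" for e
    by (rule measurable_PiM_finite_dependence[OF finite_vbl[of e]]; (rule bad_cong)?; simp)
  from measurable_compose[OF A this]
  have [measurable]: "Measurable.pred Omega
      (\<lambda>x. bad e (\<lambda>u. values_at x u (count (values_at x) (schedule x) t u)))" for e .
  have [measurable]: "Measurable.pred Omega (\<lambda>x. e \<in> schedule x t)" for e
  proof -
    obtain n a b j where t: "(from_nat t :: nat \<times> rat \<times> rat \<times> nat) = (n, a, b, j)" by (metis surj_pair)
    obtain m \<gamma> where e: "e = (m, \<gamma>)" by fastforce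
    have "(\<lambda>x. e \<in> schedule x t) = (\<lambda>x. m = n \<and> of_rat a < x \<gamma> \<and> x \<gamma> < of_rat b \<and>
       (\<forall>\<gamma>'. \<gamma>' \<noteq> \<gamma> \<longrightarrow> vbl (n, \<gamma>) \<inter> vbl (n, \<gamma>') \<noteq> {} \<longrightarrow> \<not> (of_rat a < x \<gamma>' \<and> x \<gamma>' < of_rat b)))"
      by (auto simp: schedule_def t e)
    then show ?thesis by simp
  qed
  have "(\<lambda>x. \<exists>e \<in> schedule x t. v \<in> vbl e \<and> bad e (\<lambda>u. values_at x u (count (values_at x) (schedule x) t u))) =
    (\<lambda>x. \<exists>e. e \<in> schedule x t \<and> v \<in> vbl e \<and> bad e (\<lambda>u. values_at x u (count (values_at x) (schedule x) t u)))"
    by (simp only: Bex_def)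
  then have [measurable]: "Measurable.pred Omega (\<lambda>x. \<exists>e \<in> schedule x t. v \<in> vbl e \<and>
      bad e (\<lambda>u. values_at x u (count (values_at x) (schedule x) t u)))"
    by simp
  show ?case unfolding count.simps by measurable
qed simp

lemma measurable_solution: "(\<lambda>x. solution x v) \<in> Omega \<rightarrow>\<^sub>M count_space UNIV"
proof -
  note [measurable] = measurable_count
  have "(\<lambda>x. final_count (values_at x) (schedule x) v) \<in> Omega \<rightarrow>\<^sub>M count_space UNIV"
    unfolding final_count_def by measurable
  then show ?thesis unfolding solution_def by (rule measurable_table_index)
qed

text \<open>Almost every point has pairwise different coordinates and, at every coordinate, finitely
  many valid witnesses. So every event is inspected infinitely often and the run stabilises
  everywhere.\<close>

lemma AE_solution: "AE x in Omega. \<forall>n \<gamma>. \<not> viol n (shift \<gamma> (solution x))"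
proof -
  let ?P = "PiM UNIV (\<lambda>_. measure_pmf (pmf_of_set {..<N}))"
  have "AE y in distr Omega ?P (table N). finite {W \<in> stacks v. valid (\<lambda>v i. y (v, i)) W}" for v
    unfolding distr_table[OF N] by (rule AE_finite_valid)
  from AE_distrD[OF measurable_table this]
  have "AE x in Omega. finite {W \<in> stacks v. valid (values_at x) W}" for v .
  then have "AE x in Omega. \<forall>v. finite {W \<in> stacks v. valid (values_at x) W}"
    by (simp add: AE_all_countable)
  moreover have "AE x in Omega. \<forall>\<gamma> \<delta>::'g. \<gamma> \<noteq> \<delta> \<longrightarrow> x \<gamma> \<noteq> (x \<delta> :: real)"
    unfolding AE_all_countable by (intro allI AE_impI AE_Omega_neq)
  ultimately show ?thesis
  proof (eventually_elim, intro allI)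
    fix x :: "'g \<Rightarrow> real" and n \<gamma>
    assume fin: "\<forall>v. finite {W \<in> stacks v. valid (values_at x) W}"
      and "\<forall>\<gamma> \<delta>. \<gamma> \<noteq> \<delta> \<longrightarrow> x \<gamma> \<noteq> x \<delta>"
    then have "inj x" by (auto simp: inj_def)
    then have "\<not> bad (n, \<gamma>) (\<lambda>v. values_at x v (final_count (values_at x) (schedule x) v))"
      by (intro final_not_bad[OF disjoint_schedule] infinite_schedule) (use fin in auto)
    then show "\<not> viol n (shift \<gamma> (solution x))" by (simp add: bad_def solution_def[abs_def])
  qed
qed

text \<open>A coordinate without a valid witness is never resampled and keeps the first digit of its
  row.\<close>

lemma solution_eq_first_digits:
  obtains Z where "Z \<in> sets Omega" "measure Omega Z \<le> \<eta>"
    "\<And>x. x \<in> space Omega - Z \<Longrightarrow> solution x v = first_digits N x v"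
proof -
  let ?P = "PiM UNIV (\<lambda>_. measure_pmf (pmf_of_set {..<N}))"
  let ?Z' = "{y. \<exists>W \<in> stacks v. valid (\<lambda>v i. y (v, i)) W}"
  let ?Z = "table N -` ?Z' \<inter> space Omega"
  show ?thesis
  proof (rule that[of ?Z])
    show "?Z \<in> sets Omega" by (rule measurable_sets[OF measurable_table sets_ex_valid])
    have "measure Omega ?Z = measure (distr Omega ?P (table N)) ?Z'"
      by (rule measure_distr[symmetric, OF measurable_table sets_ex_valid])
    then show "measure Omega ?Z \<le> \<eta>" using prob_ex_valid[of v] by (simp add: distr_table[OF N])
    fix x assume "x \<in> space Omega - ?Z"
    then have "final_count (values_at x) (schedule x) v = 0"
      by (intro final_count_eq_0[OF disjoint_schedule]) auto
    then show "solution x v = first_digits N x v"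
      by (simp add: solution_def first_digits_def table_def)
  qed
qed

end

section \<open>Weak-* neighbourhoods and empirical measures\<close>

lemma concentration_family:
  fixes q :: "'a::countable pmf" and \<psi> :: "'j \<Rightarrow> ('g::group_add \<Rightarrow> 'a) \<Rightarrow> real"
  assumes \<Phi>: "finite \<Phi>" and Q: "finite Q" and r: "r > 0"
    and dep: "\<And>j x y. j \<in> \<Phi> \<Longrightarrow> (\<And>i. i \<in> Q \<Longrightarrow> x i = y i) \<Longrightarrow> \<psi> j x = \<psi> j y"
    and bnd: "\<And>j x. j \<in> \<Phi> \<Longrightarrow> \<bar>\<psi> j x\<bar> \<le> B"
  defines "M \<equiv> PiM UNIV (\<lambda>_. measure_pmf q)"
  shows "\<exists>b c::real. c > 0 \<and> b \<ge> 0 \<and> (\<forall>D. finite D \<longrightarrow> D \<noteq> {} \<longrightarrow>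
    measure M {x. \<exists>j \<in> \<Phi>. r \<le> \<bar>(\<Sum>\<delta>\<in>D. \<psi> j (shift \<delta> x)) / card D - (\<integral>x. \<psi> j x \<partial>M)\<bar>} \<le>
      b * exp (- c * card D))"
  using \<Phi> dep bnd
proof (induction \<Phi> rule: finite_induct)
  case empty
  show ?case by (rule exI[of _ 0], rule exI[of _ 1]) auto
next
  case (insert k \<Phi>)
  interpret prob_space M unfolding M_def by (rule prob_space_PiM_pmf)
  define V where "V D j = {x. r \<le> \<bar>(\<Sum>\<delta>\<in>D. \<psi> j (shift \<delta> x)) / card D - (\<integral>x. \<psi> j x \<partial>M)\<bar>}" for D j
  have V: "V D j \<in> events" if "finite D" "j \<in> insert k \<Phi>" for D j
    unfolding M_def V_def
  proof (rule sets_PiM_finite_dependence)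
    show "finite (\<Union>\<delta> \<in> D. (\<lambda>a. a + \<delta>) ` Q)" using that Q by auto
    fix x y :: "'g \<Rightarrow> 'a" assume "\<And>i. i \<in> (\<Union>\<delta> \<in> D. (\<lambda>a. a + \<delta>) ` Q) \<Longrightarrow> x i = y i"
    then have "\<psi> j (shift \<delta> x) = \<psi> j (shift \<delta> y)" if "\<delta> \<in> D" for \<delta>
      using that \<open>j \<in> insert k \<Phi>\<close> by (intro insert.prems(1)) (auto simp: shift_def)
    then have "(\<Sum>\<delta>\<in>D. \<psi> j (shift \<delta> x)) = (\<Sum>\<delta>\<in>D. \<psi> j (shift \<delta> y))" by (rule sum.cong[OF refl])
    then show "(r \<le> \<bar>(\<Sum>\<delta>\<in>D. \<psi> j (shift \<delta> x)) / card D - (\<integral>x. \<psi> j x \<partial>Pi\<^sub>M UNIV (\<lambda>_. measure_pmf q))\<bar>) =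
      (r \<le> \<bar>(\<Sum>\<delta>\<in>D. \<psi> j (shift \<delta> y)) / card D - (\<integral>x. \<psi> j x \<partial>Pi\<^sub>M UNIV (\<lambda>_. measure_pmf q))\<bar>)"
      by simp
  qed
  have "\<exists>b c::real. c > 0 \<and> b \<ge> 0 \<and> (\<forall>D. finite D \<longrightarrow> D \<noteq> {} \<longrightarrow>
      prob {x. \<exists>j \<in> \<Phi>. r \<le> \<bar>(\<Sum>\<delta>\<in>D. \<psi> j (shift \<delta> x)) / card D - (\<integral>x. \<psi> j x \<partial>M)\<bar>} \<le> b * exp (- c * card D))"
  proof (rule insert.IH)
    fix j and x y :: "'g \<Rightarrow> 'a" assume "j \<in> \<Phi>" "\<And>i. i \<in> Q \<Longrightarrow> x i = y i"
    then show "\<psi> j x = \<psi> j y" by (intro insert.prems(1)) auto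
  next
    fix j and x :: "'g \<Rightarrow> 'a" assume "j \<in> \<Phi>"
    then show "\<bar>\<psi> j x\<bar> \<le> B" by (intro insert.prems(2)) auto
  qed
  then obtain b c :: real where bc: "c > 0" "b \<ge> 0"
    "\<forall>D. finite D \<longrightarrow> D \<noteq> {} \<longrightarrow>
      prob {x. \<exists>j \<in> \<Phi>. r \<le> \<bar>(\<Sum>\<delta>\<in>D. \<psi> j (shift \<delta> x)) / card D - (\<integral>x. \<psi> j x \<partial>M)\<bar>} \<le> b * exp (- c * card D)"
    by (elim exE conjE) (rule that)
  have "\<exists>b c::real. c > 0 \<and> (\<forall>D. finite D \<longrightarrow> D \<noteq> {} \<longrightarrow> prob (V D k) \<le> b * exp (- c * card D))"
    unfolding V_def M_def
  proof (rule concentration[OF Q _ _ r])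
    fix x y :: "'g \<Rightarrow> 'a" assume "\<And>i. i \<in> Q \<Longrightarrow> x i = y i"
    then show "\<psi> k x = \<psi> k y" by (intro insert.prems(1)) auto
  next
    show "\<bar>\<psi> k x\<bar> \<le> B" for x by (rule insert.prems(2)) simp
  qed
  then obtain b' c' :: real where bc': "c' > 0"
    "\<forall>D. finite D \<longrightarrow> D \<noteq> {} \<longrightarrow> prob (V D k) \<le> b' * exp (- c' * card D)"
    by (elim exE conjE) (rule that)
  \<comment> \<open>The slower decay rate is kept. The absolute value is taken because
    \<open>concentration\<close> gives no sign for \<open>b'\<close>.\<close>
  show ?case
  proof (rule exI[of _ "b + \<bar>b'\<bar>"], rule exI[of _ "min c c'"], intro conjI allI impI)
    fix D :: "'g set" assume D: "finite D" "D \<noteq> {}"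
    let ?V = "{x. \<exists>j \<in> \<Phi>. r \<le> \<bar>(\<Sum>\<delta>\<in>D. \<psi> j (shift \<delta> x)) / card D - (\<integral>x. \<psi> j x \<partial>M)\<bar>}"
    have "?V = (\<Union>j \<in> \<Phi>. V D j)" by (auto simp: V_def)
    then have ev: "?V \<in> events" "V D k \<in> events" using V D insert.hyps by (auto intro!: sets.finite_UN)
    have "prob ?V \<le> b * exp (- c * card D)" using bc(3) D by blast
    also have "\<dots> \<le> b * exp (- min c c' * card D)"
      using bc by (intro mult_left_mono) (auto intro: mult_right_mono)
    finally have 1: "prob ?V \<le> b * exp (- min c c' * card D)" .
    have "prob (V D k) \<le> b' * exp (- c' * card D)" using bc'(2) D by blast
    also have "\<dots> \<le> \<bar>b'\<bar> * exp (- min c c' * card D)"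
    proof (rule mult_mono)
      have "min c c' * card D \<le> c' * card D" by (rule mult_right_mono) auto
      then show "exp (- c' * card D) \<le> exp (- min c c' * card D)"
        by (simp only: exp_le_cancel_iff minus_mult_left[symmetric] neg_le_iff_le)
    qed simp_all
    finally have 2: "prob (V D k) \<le> \<bar>b'\<bar> * exp (- min c c' * card D)" .
    have eq: "{x. \<exists>j \<in> insert k \<Phi>. r \<le> \<bar>(\<Sum>\<delta>\<in>D. \<psi> j (shift \<delta> x)) / card D - (\<integral>x. \<psi> j x \<partial>M)\<bar>} = ?V \<union> V D k"
      by (auto simp: V_def)
    show "prob {x. \<exists>j \<in> insert k \<Phi>. r \<le> \<bar>(\<Sum>\<delta>\<in>D. \<psi> j (shift \<delta> x)) / card D - (\<integral>x. \<psi> j x \<partial>M)\<bar>} \<le>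
        (b + \<bar>b'\<bar>) * exp (- min c c' * card D)"
      using measure_Un_le[OF ev] 1 2 unfolding eq distrib_right by linarith
  qed (use bc bc' in auto)
qed

section \<open>The growth constant and families of test functions\<close>

lemma sum_inverse_squares_le: "(\<Sum>n<m. 1 / (real n + 2)\<^sup>2) \<le> 1 - 1 / (real m + 1)"
proof (induction m)
  case (Suc m)
  have "1 / (real m + 2)\<^sup>2 \<le> 1 / ((real m + 1) * (real m + 2))"
    by (intro divide_left_mono) (auto simp: power2_eq_square)
  also have "\<dots> = 1 / (real m + 1) - 1 / (real m + 2)" by (simp add: field_simps)
  finally show ?case using Suc.IH by (simp add: add_ac)
qed simp

text \<open>With \<open>C = (t + 2) / c\<close>, the exponential is at most
  \<open>(n + 2) ^ - (t + 2)\<close>. Two of these powers make the series converge with sum at most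
  1, and the other \<open>t\<close> contribute a factor of at most \<open>(1 / 2) ^ t\<close>, which
  makes the total small.\<close>

lemma logarithmic_growth_sum:
  fixes A c \<eta> :: real
  assumes "A \<ge> 0" "c > 0" "\<eta> > 0"
  obtains C where "C > 0"
    "\<And>d J. finite J \<Longrightarrow> (\<And>n. C * ln (real n + 2) \<le> d n) \<Longrightarrow> (\<Sum>n\<in>J. A * exp (- c * d n)) \<le> \<eta>"
proof -
  obtain t where "(1 / 2) ^ t < \<eta> / (A + 1)" using real_arch_pow_inv[of "\<eta> / (A + 1)" "1 / 2"] assms by auto
  then have "(A + 1) * (1 / 2) ^ t < \<eta>" using assms by (simp add: field_simps)
  moreover have "A * (1 / 2) ^ t \<le> (A + 1) * (1 / 2) ^ t" by (intro mult_right_mono) auto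
  ultimately have t: "A * (1 / 2) ^ t \<le> \<eta>" by linarith
  show ?thesis
  proof (rule that[of "real (t + 2) / c"])
    show "real (t + 2) / c > 0" using assms by simp
    fix d :: "nat \<Rightarrow> real" and J :: "nat set"
    assume J: "finite J" and d: "\<And>n. real (t + 2) / c * ln (real n + 2) \<le> d n"
    obtain m where m: "J \<subseteq> {..<m}" using J finite_nat_iff_bounded by blast
    have "A * exp (- c * d n) \<le> A * (1 / 2) ^ t * (1 / (real n + 2)\<^sup>2)" for n
    proof -
      have "real (t + 2) * ln (real n + 2) \<le> c * d n" using d[of n] assms by (simp add: field_simps)
      then have "exp (- c * d n) \<le> exp (- (real (t + 2) * ln (real n + 2)))" by simp
      also have "\<dots> = (1 / (real n + 2)) ^ (t + 2)"
        by (simp only: exp_minus exp_of_nat_mult) (simp add: power_one_over inverse_eq_divide)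
      also have "\<dots> = (1 / (real n + 2)) ^ t * (1 / (real n + 2)\<^sup>2)"
        by (simp only: power_add power_one_over)
      also have "\<dots> \<le> (1 / 2) ^ t * (1 / (real n + 2)\<^sup>2)"
        by (intro mult_right_mono power_mono) (auto simp: field_simps)
      finally have "A * exp (- c * d n) \<le> A * ((1 / 2) ^ t * (1 / (real n + 2)\<^sup>2))"
        using assms(1) by (rule mult_left_mono)
      then show ?thesis by (simp only: mult.assoc)
    qed
    then have "(\<Sum>n\<in>J. A * exp (- c * d n)) \<le> (\<Sum>n\<in>J. A * (1 / 2) ^ t * (1 / (real n + 2)\<^sup>2))"
      by (rule sum_mono)
    also have "\<dots> \<le> (\<Sum>n<m. A * (1 / 2) ^ t * (1 / (real n + 2)\<^sup>2))"
      by (rule sum_mono2) (use m assms in auto)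
    also have "\<dots> = A * (1 / 2) ^ t * (\<Sum>n<m. 1 / (real n + 2)\<^sup>2)" by (rule sum_distrib_left[symmetric])
    also have "\<dots> \<le> A * (1 / 2) ^ t * 1"
    proof (rule mult_left_mono)
      have "0 \<le> 1 / (real m + 1)" by simp
      then show "(\<Sum>n<m. 1 / (real n + 2)\<^sup>2) \<le> 1" using sum_inverse_squares_le[of m] by linarith
    qed (use assms in auto)
    also have "\<dots> \<le> \<eta>" using t by simp
    finally show "(\<Sum>n\<in>J. A * exp (- c * d n)) \<le> \<eta>" .
  qed
qed

lemma uniform_continuity_window_family:
  fixes \<Phi> :: "(('g::countable \<Rightarrow> 'k::metric_space) \<Rightarrow> real) set"
  assumes K: "compact (UNIV :: 'k set)" and r: "r > 0"
    and "finite \<Phi>" "\<forall>\<phi> \<in> \<Phi>. continuous_on UNIV \<phi>"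
  shows "\<exists>W d. finite W \<and> d > 0 \<and>
    (\<forall>\<phi> \<in> \<Phi>. \<forall>x y. (\<forall>\<gamma> \<in> W. dist (x \<gamma>) (y \<gamma>) < d) \<longrightarrow> \<bar>\<phi> x - \<phi> y\<bar> < r)"
  using assms(3,4)
proof (induction \<Phi> rule: finite_induct)
  case empty
  then show ?case by (intro exI[of _ "{}"] exI[of _ 1]) auto
next
  case (insert \<phi> \<Phi>)
  have "\<exists>W d. finite W \<and> d > 0 \<and>
      (\<forall>x y. (\<forall>\<gamma> \<in> W. dist (x \<gamma>) (y \<gamma>) < d) \<longrightarrow> \<bar>\<phi> x - \<phi> y\<bar> < r)"
    using insert.prems by (intro uniform_continuity_window K r) simp
  then obtain W d where W: "finite W" "d > 0"
      "\<forall>x y. (\<forall>\<gamma> \<in> W. dist (x \<gamma>) (y \<gamma>) < d) \<longrightarrow> \<bar>\<phi> x - \<phi> y\<bar> < r"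
    by (elim exE conjE) (rule that)
  have "\<exists>W d. finite W \<and> d > 0 \<and>
    (\<forall>\<phi> \<in> \<Phi>. \<forall>x y. (\<forall>\<gamma> \<in> W. dist (x \<gamma>) (y \<gamma>) < d) \<longrightarrow> \<bar>\<phi> x - \<phi> y\<bar> < r)"
    using insert.IH insert.prems by simp
  then obtain W' d' where W': "finite W'" "d' > 0"
      "\<forall>\<phi> \<in> \<Phi>. \<forall>x y. (\<forall>\<gamma> \<in> W'. dist (x \<gamma>) (y \<gamma>) < d') \<longrightarrow> \<bar>\<phi> x - \<phi> y\<bar> < r"
    by (elim exE conjE) (rule that)
  show ?case
  proof (intro exI[of _ "W \<union> W'"] exI[of _ "min d d'"] conjI ballI allI impI)
    fix \<phi>' and x y :: "'g \<Rightarrow> 'k" assume *: "\<phi>' \<in> insert \<phi> \<Phi>" "\<forall>\<gamma> \<in> W \<union> W'. dist (x \<gamma>) (y \<gamma>) < min d d'"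
    show "\<bar>\<phi>' x - \<phi>' y\<bar> < r"
    proof (cases "\<phi>' = \<phi>")
      case True
      then show ?thesis using W(3) * by simp
    next
      case False
      then have "\<phi>' \<in> \<Phi>" "\<forall>\<gamma> \<in> W'. dist (x \<gamma>) (y \<gamma>) < d'" using * by auto
      then show ?thesis using W'(3) by blast
    qed
  qed (use W W' in auto)
qed

lemma bounded_family:
  fixes \<Phi> :: "('l::topological_space \<Rightarrow> real) set"
  assumes K: "compact (UNIV :: 'l set)" and "finite \<Phi>" "\<forall>\<phi> \<in> \<Phi>. continuous_on UNIV \<phi>"
  shows "\<exists>B. \<forall>\<phi> \<in> \<Phi>. \<forall>x. \<bar>\<phi> x\<bar> \<le> B"
  using assms(2,3)
proof (induction \<Phi> rule: finite_induct)
  case (insert \<phi> \<Phi>)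
  have "bounded (range \<phi>)"
    using compact_continuous_image[OF _ K] insert.prems by (intro compact_imp_bounded) auto
  then obtain b where b: "\<And>x. \<bar>\<phi> x\<bar> \<le> b" by (auto simp: bounded_iff)
  obtain B where B: "\<forall>\<phi> \<in> \<Phi>. \<forall>x. \<bar>\<phi> x\<bar> \<le> B" using insert by auto
  have "\<bar>\<phi>' x\<bar> \<le> max b B" if "\<phi>' \<in> insert \<phi> \<Phi>" for \<phi>' x
    using that B b[of x] by (cases "\<phi>' = \<phi>") (auto intro: le_max_iff_disj[THEN iffD2])
  then show ?case by blast
qed simp

section \<open>Shifts, coding maps and integrals over \<open>Omega\<close>\<close>

lemma measurable_shift_Omega: "shift \<gamma> \<in> Omega \<rightarrow>\<^sub>M Omega"
  unfolding Omega_def by (rule measurable_shift)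

lemma distr_shift_Omega: "distr Omega Omega (shift (\<gamma> :: 'g::group_add)) = Omega"
  using distr_PiM_reindex[of UNIV "\<lambda>_::'g. unit_interval" "\<lambda>\<eta>. \<eta> + \<gamma>" UNIV] prob_space_unit_interval inj_add_right[of \<gamma>]
  by (simp add: Omega_def shift_def[abs_def] restrict_UNIV)

lemma measurable_coding_map:
  fixes f :: "('g::{group_add, countable} \<Rightarrow> real) \<Rightarrow> 'k::metric_space"
  assumes "compact (UNIV :: 'k set)" "f \<in> Omega \<rightarrow>\<^sub>M borel"
  shows "coding_map f \<in> Omega \<rightarrow>\<^sub>M borel"
proof (rule measurable_into_compact_fun[OF compact_UNIV_fun[OF assms(1)]])
  show "(\<lambda>x. coding_map f x \<gamma>) \<in> Omega \<rightarrow>\<^sub>M borel" for \<gamma>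
    unfolding coding_map_def by (rule measurable_compose[OF measurable_shift_Omega assms(2)])
qed

lemma first_digits_shift: "first_digits N (shift \<gamma> x) = shift \<gamma> (first_digits N x)"
  by (simp add: first_digits_def shift_def)

lemma empirical_pushforward_in_Prob: "empirical_pushforward D \<pi> x \<in> Prob"
  unfolding Prob_def empirical_pushforward_def
  by (auto intro!: measure_pmf.prob_space_distr)

lemma integral_empirical_pushforward:
  assumes "finite D" "D \<noteq> {}" and \<phi>: "continuous_on UNIV (\<phi> :: _ \<Rightarrow> real)"
  shows "(\<integral>y. \<phi> y \<partial>empirical_pushforward D \<pi> x) = (\<Sum>\<delta>\<in>D. \<phi> (\<pi> (shift \<delta> x))) / card D"
proof -
  have "(\<integral>y. \<phi> y \<partial>empirical_pushforward D \<pi> x) = (\<integral>y. \<phi> (\<pi> y) \<partial>measure_pmf (orbit_pmf D x))"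
    unfolding empirical_pushforward_def
    by (rule integral_distr) (use \<phi> in \<open>auto intro: borel_measurable_continuous_onI\<close>)
  also have "\<dots> = (\<Sum>\<delta>\<in>D. \<phi> (\<pi> (shift \<delta> x))) / card D"
    unfolding orbit_pmf_eq_map_pmf[OF assms(1,2)] integral_map_pmf
    by (rule integral_pmf_of_set[OF assms(2,1)])
  finally show ?thesis .
qed

lemma (in prob_space) integral_affine_indicator:
  fixes a b :: real
  assumes "A \<in> events"
  shows "integrable M (\<lambda>x. a + b * indicator A x)" "(\<integral>x. a + b * indicator A x \<partial>M) = a + b * prob A"
proof -
  have "integrable M (indicator A :: _ \<Rightarrow> real)"
    by (rule integrable_real_indicator) (use assms in \<open>auto simp: emeasure_eq_measure\<close>)
  then have int: "integrable M (\<lambda>x. b * indicator A x)" by (rule integrable_mult_right)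
  show "integrable M (\<lambda>x. a + b * indicator A x)"
    by (intro Bochner_Integration.integrable_add int) simp
  show "(\<integral>x. a + b * indicator A x \<partial>M) = a + b * prob A"
    using int assms by (subst Bochner_Integration.integral_add) (auto simp: prob_space)
qed

section \<open>Choice of the constants and construction of \<open>g\<close>\<close>

theorem theorem2p6:
  fixes f :: "('g::{group_add, countable} \<Rightarrow> real) \<Rightarrow> 'k::metric_space"
    and \<epsilon> :: real
    and U :: "('g \<Rightarrow> 'k) measure set"
  assumes "infinite (UNIV :: 'g set)"
    and "compact (UNIV :: 'k set)"
    and "f \<in> Omega \<rightarrow>\<^sub>M borel"
    and "\<epsilon> > 0"
    and "openin weak_star_topology U"
    and "pushforward_Omega (coding_map f) \<in> U"
  shows "\<exists>C::real. C > 0 \<and>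
    (\<forall>D :: nat \<Rightarrow> 'g set.
      (\<forall>n. finite (D n) \<and> real (card (D n)) \<ge> C * ln (real n + 2)) \<longrightarrow>
      (\<exists>g. g \<in> Omega \<rightarrow>\<^sub>M borel \<and> dist_Omega f g \<le> \<epsilon> \<and>
        (\<forall>n. AE x in Omega. empirical_pushforward (D n) (coding_map g) x \<in> U)))"
proof -
  interpret O: prob_space "Omega :: ('g \<Rightarrow> real) measure" by (rule prob_space_Omega)
  note K = assms(2) and f = assms(3)
  define \<mu> where "\<mu> = pushforward_Omega (coding_map f)"
  obtain \<Phi> :: "(('g \<Rightarrow> 'k) \<Rightarrow> real) set" and r :: real where \<Phi>: "finite \<Phi>" "r > 0" "\<forall>\<phi> \<in> \<Phi>. continuous_on UNIV \<phi>"
    "\<forall>\<nu> \<in> Prob. (\<forall>\<phi> \<in> \<Phi>. \<bar>(\<integral>y. \<phi> y \<partial>\<nu>) - (\<integral>y. \<phi> y \<partial>\<mu>)\<bar> < r) \<longrightarrow> \<nu> \<in> U"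
    using weak_star_neighbourhood[OF assms(5,6), folded \<mu>_def] by (elim exE conjE) (rule that)
  \<comment> \<open>Four errors of at most \<open>r1\<close> add up in the end: two between the mean
    of \<psi> and the integral over \<mu>, one for the deviation of the average from that mean, and
    one for the window. The fifth share makes the total less than \<open>r\<close>.\<close>
  define r1 where "r1 = r / 5"
  have r1: "r1 > 0" using \<Phi>(2) by (simp add: r1_def)
  obtain B0 where B0: "\<forall>\<phi> \<in> \<Phi>. \<forall>x. \<bar>\<phi> x\<bar> \<le> B0"
    using bounded_family[OF compact_UNIV_fun[OF K] \<Phi>(1,3)] by (elim exE) (rule that)
  \<comment> \<open>If \<Phi> is empty, nothing is known about the sign of
    \<open>B0\<close>.\<close>
  define B where "B = \<bar>B0\<bar> + 1"
  have B: "\<bar>\<phi> x\<bar> \<le> B" if "\<phi> \<in> \<Phi>" for \<phi> x using B0[rule_format, OF that, of x] by (auto simp: B_def)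
  have B_pos: "B > 0" by (simp add: B_def)
  obtain W d where W: "finite W" "d > 0"
    "\<forall>\<phi> \<in> \<Phi>. \<forall>x y. (\<forall>\<gamma> \<in> W. dist (x \<gamma>) (y \<gamma>) < d) \<longrightarrow> \<bar>\<phi> x - \<phi> y\<bar> < r1"
    using uniform_continuity_window_family[OF K r1 \<Phi>(1,3)] by (elim exE conjE) (rule that)
  define \<Delta> where "\<Delta> = diameter (UNIV :: 'k set) + 1"
  have diam: "dist a b \<le> \<Delta>" for a b :: 'k
    using diameter_bounded_bound[OF compact_imp_bounded[OF K], of a b] by (simp add: \<Delta>_def)
  have \<Delta>: "\<Delta> > 0" using diameter_ge_0[OF compact_imp_bounded[OF K]] by (simp add: \<Delta>_def)
  \<comment> \<open>The first bound keeps the digit approximation within the tolerance of the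
    window, the second pays for the exceptional sets at all \<open>card W\<close> translates, and
    the third keeps their contribution to the distance from \<open>f\<close> below a quarter of
    \<epsilon>.\<close>
  define e where "e = min d (min (r1 / (2 * B * (card W + 1))) (\<epsilon> / (4 * (1 + \<Delta>))))"
  have e: "e > 0" "e \<le> d" using W(2) r1 B_pos assms(4) \<Delta> by (auto simp: e_def)
  have "e \<le> r1 / (2 * B * (card W + 1))" by (simp add: e_def)
  then have "e * (2 * B * (card W + 1)) \<le> r1" using B_pos by (simp add: pos_le_divide_eq)
  moreover have "0 \<le> B * (e * 2)" using e(1) B_pos by simp
  ultimately have e_W: "2 * B * (card W * e) \<le> r1" by (simp add: algebra_simps)
  have "e \<le> \<epsilon> / (4 * (1 + \<Delta>))" by (simp add: e_def)
  then have e_\<epsilon>: "4 * (e + \<Delta> * e) \<le> \<epsilon>" using \<Delta> by (simp add: pos_le_divide_eq algebra_simps)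
  obtain N S F Z0 where N: "N > 0" and S: "finite S"
    and F': "\<forall>a b. (\<forall>i \<in> S. a i = b i) \<longrightarrow> F a = F b"
    and Z0: "Z0 \<in> O.events" "O.prob Z0 < e"
      "\<forall>x \<in> space Omega - Z0. dist (f x) (F (first_digits N x)) < e"
    by (rule approximate_by_digits[OF K f e(1)])
  have F: "F a = F b" if "\<And>i. i \<in> S \<Longrightarrow> a i = b i" for a b using F' that by blast
  define q where "q = pmf_of_set {..<N}"
  define M where "M = PiM UNIV (\<lambda>_::'g. measure_pmf q)"
  interpret M: prob_space M unfolding M_def by (rule prob_space_PiM_pmf)
  \<comment> \<open>Overwriting the coordinates outside the window makes this a function of finitely
    many digits, at a cost of less than \<open>r1\<close>.\<close>
  define \<psi> where "\<psi> \<phi> a = \<phi> (\<lambda>\<gamma>. if \<gamma> \<in> W then F (shift \<gamma> a) else undefined)" for \<phi> :: "('g \<Rightarrow> 'k) \<Rightarrow> real" and a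
  \<comment> \<open>The element 0 keeps \<open>Q\<close> nonempty even if \<open>S\<close> or
    \<open>W\<close> is empty, so that every event of the system has variables.\<close>
  define Q where "Q = insert 0 ((\<lambda>(s, \<gamma>). s + \<gamma>) ` (S \<times> W))"
  have Q: "finite Q" "Q \<noteq> {}" using S W(1) by (auto simp: Q_def)
  have \<psi>_dep: "\<psi> \<phi> a = \<psi> \<phi> b" if "\<And>i. i \<in> Q \<Longrightarrow> a i = b i" for \<phi> a b
  proof -
    have "F (shift \<gamma> a) = F (shift \<gamma> b)" if "\<gamma> \<in> W" for \<gamma>
    proof (rule F)
      fix s assume "s \<in> S"
      then have "s + \<gamma> \<in> Q" using that by (force simp: Q_def)
      then show "shift \<gamma> a s = shift \<gamma> b s" using \<open>\<And>i. i \<in> Q \<Longrightarrow> a i = b i\<close> by (simp add: shift_def)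
    qed
    then show ?thesis unfolding \<psi>_def by (intro arg_cong[of _ _ \<phi>] ext) simp
  qed
  have \<psi>_window: "\<bar>\<psi> \<phi> a - \<phi> y\<bar> < r1"
    if "\<phi> \<in> \<Phi>" "\<And>\<gamma>. \<gamma> \<in> W \<Longrightarrow> dist (F (shift \<gamma> a)) (y \<gamma>) < d" for \<phi> a y
    using W(3) that unfolding \<psi>_def by auto
  have \<psi>_bound: "\<bar>\<psi> \<phi> a\<bar> \<le> B" if "\<phi> \<in> \<Phi>" for \<phi> a unfolding \<psi>_def by (rule B[OF that])
  have \<psi>_meas: "\<psi> \<phi> \<in> borel_measurable M" for \<phi>
    unfolding M_def by (rule measurable_PiM_finite_dependence[OF Q(1)]; (rule \<psi>_dep)?; simp)
  have expectation: "\<bar>(\<integral>a. \<psi> \<phi> a \<partial>M) - (\<integral>y. \<phi> y \<partial>\<mu>)\<bar> \<le> 2 * r1" if \<phi>: "\<phi> \<in> \<Phi>" for \<phi>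
  proof -
    have \<phi>_meas: "\<phi> \<in> borel_measurable borel"
      using \<Phi>(3) \<phi> by (intro borel_measurable_continuous_onI) auto
    have fd: "first_digits N \<in> Omega \<rightarrow>\<^sub>M M" unfolding M_def by (rule measurable_first_digits)
    have dM: "M = distr Omega M (first_digits N)"
      unfolding M_def q_def by (rule distr_first_digits[OF N, symmetric])
    have "(\<integral>a. \<psi> \<phi> a \<partial>M) = (\<integral>a. \<psi> \<phi> a \<partial>distr Omega M (first_digits N))" using dM by simp
    also have "\<dots> = (\<integral>x. \<psi> \<phi> (first_digits N x) \<partial>Omega)" by (rule integral_distr[OF fd \<psi>_meas])
    finally have 1: "(\<integral>a. \<psi> \<phi> a \<partial>M) = (\<integral>x. \<psi> \<phi> (first_digits N x) \<partial>Omega)" .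
    have 2: "(\<integral>y. \<phi> y \<partial>\<mu>) = (\<integral>x. \<phi> (coding_map f x) \<partial>Omega)"
      unfolding \<mu>_def pushforward_Omega_def
      by (rule integral_distr[OF measurable_coding_map[OF K f] \<phi>_meas])
    have int1: "integrable Omega (\<lambda>x. \<psi> \<phi> (first_digits N x))"
      by (rule O.integrable_const_bound[of _ B])
        (use \<psi>_bound[OF \<phi>] measurable_compose[OF fd \<psi>_meas] in auto)
    have int2: "integrable Omega (\<lambda>x. \<phi> (coding_map f x))"
      by (rule O.integrable_const_bound[of _ B])
        (use B[OF \<phi>] measurable_compose[OF measurable_coding_map[OF K f] \<phi>_meas] in auto)
    \<comment> \<open>Outside \<open>Z\<close> the digits approximate \<open>f\<close> at every
      translate in the window. By shift invariance, \<open>Z\<close> has measure at most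
      \<open>card W * e\<close>, and on it the trivial bound \<open>2 * B\<close> is used.\<close>
    define Z where "Z = (\<Union>\<gamma> \<in> W. shift \<gamma> -` Z0 \<inter> space Omega)"
    have ev: "shift \<gamma> -` Z0 \<inter> space Omega \<in> O.events" for \<gamma>
      by (rule measurable_sets[OF measurable_shift_Omega Z0(1)])
    have Z: "Z \<in> O.events" unfolding Z_def using W(1) ev by (intro sets.finite_UN) auto
    have "O.prob (shift \<gamma> -` Z0 \<inter> space Omega) \<le> e" for \<gamma>
      using measure_distr[OF measurable_shift_Omega Z0(1), of \<gamma>] Z0(2) by (simp add: distr_shift_Omega)
    then have "(\<Sum>\<gamma> \<in> W. O.prob (shift \<gamma> -` Z0 \<inter> space Omega)) \<le> (\<Sum>\<gamma> \<in> W. e)"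
      by (intro sum_mono)
    moreover have "O.prob Z \<le> (\<Sum>\<gamma> \<in> W. O.prob (shift \<gamma> -` Z0 \<inter> space Omega))"
      unfolding Z_def by (rule O.finite_measure_subadditive_finite) (use W(1) ev in auto)
    ultimately have prob_Z: "O.prob Z \<le> card W * e" by simp
    have pointwise: "\<bar>\<psi> \<phi> (first_digits N x) - \<phi> (coding_map f x)\<bar> \<le> r1 + 2 * B * indicator Z x"
      if x: "x \<in> space Omega" for x
    proof (cases "x \<in> Z")
      case True
      then show ?thesis using \<psi>_bound[OF \<phi>, of "first_digits N x"] B[OF \<phi>, of "coding_map f x"] r1
        by simp
    next
      case False
      have "dist (F (shift \<gamma> (first_digits N x))) (coding_map f x \<gamma>) < d" if "\<gamma> \<in> W" for \<gamma>
      proof -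
        have "shift \<gamma> x \<in> space Omega - Z0"
          using False that x measurable_space[OF measurable_shift_Omega x] unfolding Z_def by blast
        then have "dist (f (shift \<gamma> x)) (F (first_digits N (shift \<gamma> x))) < e" by (rule bspec[OF Z0(3)])
        then show ?thesis using e(2) by (simp add: coding_map_def first_digits_shift dist_commute)
      qed
      then show ?thesis using \<psi>_window[OF \<phi>] False by (simp add: less_imp_le)
    qed
    have "\<bar>(\<integral>x. \<psi> \<phi> (first_digits N x) \<partial>Omega) - (\<integral>x. \<phi> (coding_map f x) \<partial>Omega)\<bar> =
        \<bar>\<integral>x. \<psi> \<phi> (first_digits N x) - \<phi> (coding_map f x) \<partial>Omega\<bar>"
      using int1 int2 by simp
    also have "\<dots> \<le> (\<integral>x. \<bar>\<psi> \<phi> (first_digits N x) - \<phi> (coding_map f x)\<bar> \<partial>Omega)"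
      by (rule integral_abs_bound)
    also have "\<dots> \<le> (\<integral>x. r1 + 2 * B * indicator Z x \<partial>Omega)"
      by (rule integral_mono'[OF O.integral_affine_indicator(1)[OF Z] pointwise]) (use r1 B_pos in auto)
    also have "\<dots> = r1 + 2 * B * O.prob Z" by (rule O.integral_affine_indicator(2)[OF Z])
    also have "\<dots> \<le> r1 + 2 * B * (card W * e)" using prob_Z B_pos by (intro add_left_mono mult_left_mono) auto
    also have "\<dots> \<le> 2 * r1" using e_W by simp
    finally show ?thesis unfolding 1 2 .
  qed

  have "\<exists>b c::real. c > 0 \<and> b \<ge> 0 \<and> (\<forall>D. finite D \<longrightarrow> D \<noteq> {} \<longrightarrow>
      M.prob {x. \<exists>\<phi> \<in> \<Phi>. r1 \<le> \<bar>(\<Sum>\<delta>\<in>D. \<psi> \<phi> (shift \<delta> x)) / card D - (\<integral>x. \<psi> \<phi> x \<partial>M)\<bar>} \<le>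
        b * exp (- c * card D))"
    unfolding M_def
    by (rule concentration_family[OF \<Phi>(1) Q(1) r1]; (rule \<psi>_dep | rule \<psi>_bound); simp)
  then obtain b c :: real where bc: "c > 0" "b \<ge> 0" "\<forall>D. finite D \<longrightarrow> D \<noteq> {} \<longrightarrow>
      M.prob {x. \<exists>\<phi> \<in> \<Phi>. r1 \<le> \<bar>(\<Sum>\<delta>\<in>D. \<psi> \<phi> (shift \<delta> x)) / card D - (\<integral>x. \<psi> \<phi> x \<partial>M)\<bar>} \<le>
        b * exp (- c * card D)"
    by (elim exE conjE) (rule that)
  \<comment> \<open>The first bound lets \<open>exp (\<eta> * card (R n))\<close> consume at most
    half of the decay \<open>c\<close>. The second makes resampling of any of the digits read by
    \<open>F\<close> cost at most a quarter of \<epsilon>.\<close>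
  define \<eta> where "\<eta> = min (c / (2 * card Q)) (\<epsilon> / (4 * \<Delta> * (card S + 1)))"
  have cQ: "real (card Q) > 0" using Q by (simp add: card_gt_0_iff)
  have \<eta>: "\<eta> > 0" using bc(1) cQ assms(4) \<Delta> by (simp add: \<eta>_def)
  have "\<eta> \<le> c / (2 * card Q)" by (simp add: \<eta>_def)
  then have \<eta>_c: "\<eta> * card Q \<le> c / 2" using cQ by (simp add: pos_le_divide_eq algebra_simps)
  have "\<eta> \<le> \<epsilon> / (4 * \<Delta> * (card S + 1))" by (simp add: \<eta>_def)
  then have "\<eta> * (4 * \<Delta> * (card S + 1)) \<le> \<epsilon>" using \<Delta> by (simp add: pos_le_divide_eq)
  moreover have "0 \<le> \<Delta> * \<eta>" using \<Delta> \<eta> by simp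
  ultimately have \<eta>_S: "4 * (\<Delta> * (card S * \<eta>)) \<le> \<epsilon>" by (simp add: algebra_simps)
  \<comment> \<open>The factor \<open>4 / c\<close> comes from
    \<open>k \<le> (4 / c) * exp (c * k / 4)\<close>, which trades the linear number of translates
    for half of the remaining decay.\<close>
  define A where "A = card Q * b * (4 / c)"
  have A: "A \<ge> 0" using bc by (simp add: A_def)
  \<comment> \<open>All ingredients of \<open>C\<close> are fixed before the sequence
    \<open>D\<close> is given.\<close>
  obtain C where C: "C > 0"
    "\<And>d J. finite J \<Longrightarrow> (\<And>n. C * ln (real n + 2) \<le> d n) \<Longrightarrow> (\<Sum>n\<in>J. A * exp (- (c / 4) * d n)) \<le> \<eta>"
    using logarithmic_growth_sum[OF A _ \<eta>, of "c / 4"] bc(1) by auto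
  show ?thesis
  proof (intro exI[of _ C] conjI allI impI)
    fix D :: "nat \<Rightarrow> 'g set"
    assume D': "\<forall>n. finite (D n) \<and> real (card (D n)) \<ge> C * ln (real n + 2)"
    then have D: "finite (D n)" "C * ln (real n + 2) \<le> card (D n)" for n by auto
    \<comment> \<open>The summand 2 in the logarithm makes the lower bound positive already at
      \<open>n = 0\<close>.\<close>
    have D_ne: "D n \<noteq> {}" for n
    proof
      assume "D n = {}"
      moreover have "0 < C * ln (real n + 2)" using C(1) by (intro mult_pos_pos) auto
      ultimately show False using D(2)[of n] by simp
    qed
    define R where "R n = (\<lambda>(s, \<delta>). s + \<delta>) ` (Q \<times> D n)" for n
    define viol where "viol n a \<longleftrightarrow> (\<exists>\<phi> \<in> \<Phi>. r1 \<le>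
      \<bar>(\<Sum>\<delta>\<in>D n. \<psi> \<phi> (shift \<delta> a)) / card (D n) - (\<integral>x. \<psi> \<phi> x \<partial>M)\<bar>)" for n a
    define p where "p n = b * exp (- c * card (D n))" for n
    have card_R: "real (card (R n)) \<le> real (card Q) * card (D n)" for n
      using card_image_le[of "Q \<times> D n" "\<lambda>(s, \<delta>). s + \<delta>"] Q(1) D(1)
      by (simp add: R_def card_cartesian_product flip: of_nat_mult)
    have summand: "card (R n) * (p n * exp (\<eta> * card (R n))) \<le> A * exp (- (c / 4) * card (D n))" for n
    proof -
      let ?k = "real (card (D n))"
      have "\<eta> * card (R n) \<le> \<eta> * (card Q * ?k)" using card_R[of n] \<eta> by (intro mult_left_mono) auto
      also have "\<dots> = (\<eta> * card Q) * ?k" by simp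
      also have "\<dots> \<le> (c / 2) * ?k" by (rule mult_right_mono[OF \<eta>_c]) simp
      finally have "p n * exp (\<eta> * card (R n)) \<le> b * exp (- c * ?k) * exp ((c / 2) * ?k)"
        using bc(2) unfolding p_def by (intro mult_left_mono) auto
      also have "\<dots> = b * exp (- (c / 2) * ?k)" by (simp add: mult.assoc flip: exp_add)
      finally have pe: "p n * exp (\<eta> * card (R n)) \<le> b * exp (- (c / 2) * ?k)" .
      have "card (R n) * (p n * exp (\<eta> * card (R n))) \<le> (card Q * ?k) * (b * exp (- (c / 2) * ?k))"
        by (rule mult_mono[OF card_R pe]) (use bc(2) in \<open>simp_all add: p_def\<close>)
      also have "\<dots> = card Q * b * (4 / c) * ((c / 4) * ?k * exp (- (c / 2) * ?k))"
        using bc(1) by simp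
      also have "\<dots> \<le> card Q * b * (4 / c) * exp (- (c / 4) * ?k)"
      proof (rule mult_left_mono)
        have "(c / 4) * ?k \<le> exp ((c / 4) * ?k)" using exp_ge_add_one_self[of "(c / 4) * ?k"] by linarith
        then have "(c / 4) * ?k * exp (- (c / 2) * ?k) \<le> exp ((c / 4) * ?k) * exp (- (c / 2) * ?k)"
          by (rule mult_right_mono) simp
        also have "\<dots> = exp (- (c / 4) * ?k)" by (simp flip: exp_add)
        finally show "(c / 4) * ?k * exp (- (c / 2) * ?k) \<le> exp (- (c / 4) * ?k)" .
      qed (use bc in simp)
      finally show ?thesis by (simp only: A_def)
    qed
    interpret L: shift_lll N R viol p \<eta>
    proof
      show "N > 0" by (rule N)
      show "finite (R n)" "R n \<noteq> {}" for n using Q D(1) D_ne by (auto simp: R_def)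
      show "viol n x = viol n y" if xy: "\<And>i. i \<in> R n \<Longrightarrow> x i = y i" for n x y
      proof -
        have "\<psi> \<phi> (shift \<delta> x) = \<psi> \<phi> (shift \<delta> y)" if "\<delta> \<in> D n" for \<phi> \<delta>
        proof (rule \<psi>_dep)
          fix i assume "i \<in> Q"
          then have "i + \<delta> \<in> R n" using that by (force simp: R_def)
          then show "shift \<delta> x i = shift \<delta> y i" using xy by (simp add: shift_def)
        qed
        then have "(\<Sum>\<delta>\<in>D n. \<psi> \<phi> (shift \<delta> x)) = (\<Sum>\<delta>\<in>D n. \<psi> \<phi> (shift \<delta> y))" for \<phi>
          by (intro sum.cong) auto
        then show ?thesis by (simp add: viol_def)
      qed
      show "measure (PiM UNIV (\<lambda>_. measure_pmf (pmf_of_set {..<N}))) {a. viol n a} \<le> p n" for n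
        using bc(3) D(1)[of n] D_ne[of n] unfolding viol_def p_def M_def q_def by blast
      show "\<eta> \<ge> 0" using \<eta> by simp
      show "(\<Sum>n \<in> J. card (R n) * (p n * exp (\<eta> * card (R n)))) \<le> \<eta>" if "finite J" for J
        using sum_mono[of J, OF summand] C(2)[OF that D(2)] by (rule order_trans)
    qed
    define g where "g x = F (L.solution x)" for x
    have g: "g \<in> Omega \<rightarrow>\<^sub>M borel"
    proof -
      have "L.solution \<in> Omega \<rightarrow>\<^sub>M M"
        unfolding M_def by (rule measurable_PiM_single') (use L.measurable_solution in auto)
      moreover have "F \<in> M \<rightarrow>\<^sub>M borel"
        unfolding M_def by (rule measurable_PiM_finite_dependence[OF S]; (rule F)?; simp)
      ultimately show ?thesis unfolding g_def by (rule measurable_compose)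
    qed
    have "\<forall>v. \<exists>Z. Z \<in> O.events \<and> O.prob Z \<le> \<eta> \<and>
        (\<forall>x \<in> space Omega - Z. L.solution x v = first_digits N x v)"
      using L.solution_eq_first_digits by metis
    from choice[OF this] obtain Z where Z: "\<forall>v. Z v \<in> O.events \<and> O.prob (Z v) \<le> \<eta> \<and>
        (\<forall>x \<in> space Omega - Z v. L.solution x v = first_digits N x v)"
      by (elim exE) (rule that)
    \<comment> \<open>Outside \<open>Y\<close>, none of the digits that \<open>F\<close> reads has
      been changed and \<open>F\<close> approximates \<open>f\<close>, so \<open>g\<close> is within
      \<open>e\<close> of \<open>f\<close>; on \<open>Y\<close> the diameter bound \<Delta> is
      used.\<close>
    define Y where "Y = Z0 \<union> (\<Union>v \<in> S. Z v)"
    have Y: "Y \<in> O.events" unfolding Y_def using Z Z0(1) S by (intro sets.Un sets.finite_UN) auto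
    have "O.prob Y \<le> O.prob Z0 + O.prob (\<Union>v \<in> S. Z v)"
      unfolding Y_def using Z Z0(1) S by (intro measure_Un_le sets.finite_UN) auto
    also have "O.prob (\<Union>v \<in> S. Z v) \<le> (\<Sum>v \<in> S. O.prob (Z v))"
      by (rule O.finite_measure_subadditive_finite) (use S Z in auto)
    also have "\<dots> \<le> (\<Sum>v \<in> S. \<eta>)" using Z by (intro sum_mono) auto
    finally have prob_Y: "O.prob Y \<le> e + card S * \<eta>" using Z0(2) by simp
    have pointwise: "dist (f x) (g x) \<le> e + \<Delta> * indicator Y x" if x: "x \<in> space Omega" for x
    proof (cases "x \<in> Y")
      case True
      then show ?thesis using diam[of "f x" "g x"] e(1) by simp
    next
      case False
      have "L.solution x v = first_digits N x v" if "v \<in> S" for v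
        using Z x False that unfolding Y_def by blast
      then have "g x = F (first_digits N x)" unfolding g_def by (rule F)
      moreover have "dist (f x) (F (first_digits N x)) < e"
        by (rule bspec[OF Z0(3)]) (use x False in \<open>auto simp: Y_def\<close>)
      ultimately show ?thesis using False by simp
    qed
    have "dist_Omega f g \<le> (\<integral>x. e + \<Delta> * indicator Y x \<partial>Omega)"
      unfolding dist_Omega_def
      by (rule integral_mono'[OF O.integral_affine_indicator(1)[OF Y] pointwise]) (use e(1) \<Delta> in auto)
    also have "\<dots> = e + \<Delta> * O.prob Y" by (rule O.integral_affine_indicator(2)[OF Y])
    also have "\<dots> \<le> e + \<Delta> * (e + card S * \<eta>)" using prob_Y \<Delta> by (intro add_left_mono mult_left_mono) auto
    also have "\<dots> \<le> \<epsilon>" using e_\<epsilon> \<eta>_S assms(4) by (simp add: distrib_left)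
    finally have dist: "dist_Omega f g \<le> \<epsilon>" .
    have "AE x in Omega. empirical_pushforward (D n) (coding_map g) x \<in> U" for n
      using L.AE_solution
    proof (rule eventually_mono)
      fix x assume "\<forall>n \<gamma>. \<not> viol n (shift \<gamma> (L.solution x))"
      \<comment> \<open>The average over \<open>D n\<close> at \<open>x\<close> itself is the
        constraint at the identity.\<close>
      then have "\<not> viol n (shift 0 (L.solution x))" by blast
      then have ok: "\<not> viol n (L.solution x)" by (simp add: shift_def)
      let ?\<nu> = "empirical_pushforward (D n) (coding_map g) x"
      have "\<bar>(\<integral>y. \<phi> y \<partial>?\<nu>) - (\<integral>y. \<phi> y \<partial>\<mu>)\<bar> < r" if \<phi>: "\<phi> \<in> \<Phi>" for \<phi>
      proof -
        let ?z = "L.solution x" and ?k = "real (card (D n))"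
        have k: "?k > 0" using D(1) D_ne by (simp add: card_gt_0_iff)
        \<comment> \<open>By equivariance, the orbit of \<open>x\<close> under \<open>g\<close> is
          read off from translates of a single configuration. On the window the coding map of
          \<open>g\<close> agrees exactly with what \<psi> reads, so only the overwritten
          coordinates matter.\<close>
        have close: "\<bar>\<phi> (coding_map g (shift \<delta> x)) - \<psi> \<phi> (shift \<delta> ?z)\<bar> \<le> r1" for \<delta>
        proof -
          have "coding_map g (shift \<delta> x) = (\<lambda>\<gamma>. F (shift \<gamma> (shift \<delta> ?z)))"
            by (simp add: coding_map_def g_def L.solution_shift)
          then have "\<bar>\<psi> \<phi> (shift \<delta> ?z) - \<phi> (coding_map g (shift \<delta> x))\<bar> < r1"
            using W(2) by (intro \<psi>_window[OF \<phi>]) simp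
          then show ?thesis by linarith
        qed
        have "(\<integral>y. \<phi> y \<partial>?\<nu>) = (\<Sum>\<delta>\<in>D n. \<phi> (coding_map g (shift \<delta> x))) / ?k"
          using \<Phi>(3) \<phi> by (intro integral_empirical_pushforward[OF D(1) D_ne]) auto
        moreover have "\<bar>(\<Sum>\<delta>\<in>D n. \<phi> (coding_map g (shift \<delta> x))) / ?k - (\<Sum>\<delta>\<in>D n. \<psi> \<phi> (shift \<delta> ?z)) / ?k\<bar> \<le> r1"
        proof -
          have "\<bar>\<Sum>\<delta>\<in>D n. \<phi> (coding_map g (shift \<delta> x)) - \<psi> \<phi> (shift \<delta> ?z)\<bar> \<le> (\<Sum>\<delta>\<in>D n. r1)"
            by (rule order_trans[OF sum_abs]) (intro sum_mono close)
          then have "\<bar>\<Sum>\<delta>\<in>D n. \<phi> (coding_map g (shift \<delta> x)) - \<psi> \<phi> (shift \<delta> ?z)\<bar> / ?k \<le> r1"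
            using k by (simp add: pos_divide_le_eq mult.commute)
          then show ?thesis using k by (simp add: sum_subtractf diff_divide_distrib[symmetric] abs_divide)
        qed
        moreover have "\<bar>(\<Sum>\<delta>\<in>D n. \<psi> \<phi> (shift \<delta> ?z)) / ?k - (\<integral>x. \<psi> \<phi> x \<partial>M)\<bar> < r1"
          using ok \<phi> unfolding viol_def by (auto simp: not_le)
        ultimately have "\<bar>(\<integral>y. \<phi> y \<partial>?\<nu>) - (\<integral>y. \<phi> y \<partial>\<mu>)\<bar> < 4 * r1"
          using expectation[OF \<phi>] by linarith
        also have "\<dots> < r" using \<Phi>(2) by (simp add: r1_def)
        finally show ?thesis .
      qed
      then show "?\<nu> \<in> U" using \<Phi>(4) empirical_pushforward_in_Prob by blast
    qed
    then show "\<exists>g. g \<in> Omega \<rightarrow>\<^sub>M borel \<and> dist_Omega f g \<le> \<epsilon> \<and>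
        (\<forall>n. AE x in Omega. empirical_pushforward (D n) (coding_map g) x \<in> U)"
      using g dist by blast
  qed (rule C(1))
qed

end
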